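(* Let $k\in\mathbb{N}$, $\ell\in\mathbb{R}_+$ with $k\le\ell$, and let $\Phi(x)=\varphi_{\ell,k}(\|x\|_2)$ on $\mathbb{R}^{2k+1}$, where $\varphi_{\ell,k}$ is the Wu function. Then $$\mathcal{N}_\Phi(\mathbb{R}^{2k+1})=P*L^2(\mathbb{R}^{2k+1}):=\{P*g:g\in L^2(\mathbb{R}^{2k+1})\},$$ where $P(x)=\frac{\Gamma(\ell+1)}{\Gamma(\ell-k+1)}(2/\pi)^{k/2}(1-\|x\|_2^2)_+^{\ell-k}$. Moreover, the convolution operator $C_P:L^2(\mathbb{R}^{2k+1})\to\mathcal{N}_\Phi(\mathbb{R}^{2k+1})$, $C_Pg=P*g$, is a bijective isometry.
   Context: $\mathbb{R}_+=[0,\infty)$. For $\ell\ge0$ let $f_\ell(r)=(1-r^2)_+^\ell$ and $f_\ell*f_\ell(r)=\int_{\mathbb{R}}f_\ell(|y|)f_\ell(|r-y|)\,dy$, $r\ge0$. Let $\mathscr{D}\varphi(r):=-\frac1r\varphi'(r)$, $\mathscr{D}^k$ its $k$-fold iterate, and $\varphi_{\ell,k}(r):=\mathscr{D}^k(f_\ell*f_\ell)(r)$ (Wu function) for $k\in\mathbb{N}$, $\ell\in\mathbb{R}_+$, $k\le\ell$. The native space $\mathcal{N}_\Phi(\mathbb{R}^d)$ of a positive definite continuous function $\Phi$ is the reproducing kernel Hilbert space of real functions on $\mathbb{R}^d$ with reproducing kernel $(x,y)\mapsto\Phi(x-y)$, with its Hilbert norm. *)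

theory Defs
  imports "HOL-Analysis.Analysis"
begin

text \<open>Truncated power f_l(r) = (1 - r^2)_+^l (convention: 0 powr 0 = 0, so for l = 0
  this is the indicator of the open interval (-1,1); irrelevant a.e.).\<close>
definition trunc_pow :: "real \<Rightarrow> real \<Rightarrow> real" where
  "trunc_pow l r = (max 0 (1 - r^2)) powr l"

definition wu_conv :: "real \<Rightarrow> real \<Rightarrow> real" where
  "wu_conv l r = (LINT y|lborel. trunc_pow l \<bar>y\<bar> * trunc_pow l \<bar>r - y\<bar>)"

definition wu_D :: "(real \<Rightarrow> real) \<Rightarrow> real \<Rightarrow> real" where
  "wu_D \<phi> r = - deriv \<phi> r / r"

definition wu_fun :: "real \<Rightarrow> nat \<Rightarrow> real \<Rightarrow> real" where
  "wu_fun l k r = (if r = 0 then Lim (at_right 0) ((wu_D ^^ k) (wu_conv l))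
                   else (wu_D ^^ k) (wu_conv l) r)"

definition L2 :: "('a::euclidean_space \<Rightarrow> real) set" where
  "L2 = {g. g \<in> borel_measurable lebesgue \<and> integrable lebesgue (\<lambda>x. (g x)^2)}"

definition L2_norm :: "('a::euclidean_space \<Rightarrow> real) \<Rightarrow> real" where
  "L2_norm g = sqrt (LINT x|lebesgue. (g x)^2)"

definition conv :: "('a::euclidean_space \<Rightarrow> real) \<Rightarrow> ('a \<Rightarrow> real) \<Rightarrow> 'a \<Rightarrow> real" where
  "conv P g x = (LINT y|lebesgue. P (x - y) * g y)"

definition wu_P :: "real \<Rightarrow> nat \<Rightarrow> 'a::euclidean_space \<Rightarrow> real" where
  "wu_P l k x = Gamma (l + 1) / Gamma (l - real k + 1) * (2 / pi) powr (real k / 2)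
                * trunc_pow (l - real k) (norm x)"

definition hilbert_fun_space ::
  "('a \<Rightarrow> real) set \<Rightarrow> (('a \<Rightarrow> real) \<Rightarrow> ('a \<Rightarrow> real) \<Rightarrow> real) \<Rightarrow> bool" where
  "hilbert_fun_space H ip \<longleftrightarrow>
     (\<lambda>x. 0) \<in> H \<and>
     (\<forall>f\<in>H. \<forall>g\<in>H. (\<lambda>x. f x + g x) \<in> H) \<and>
     (\<forall>f\<in>H. \<forall>c. (\<lambda>x. c * f x) \<in> H) \<and>
     (\<forall>f\<in>H. \<forall>g\<in>H. ip f g = ip g f) \<and>
     (\<forall>f\<in>H. \<forall>g\<in>H. \<forall>h\<in>H. ip (\<lambda>x. f x + g x) h = ip f h + ip g h) \<and>
     (\<forall>f\<in>H. \<forall>g\<in>H. \<forall>c. ip (\<lambda>x. c * f x) g = c * ip f g) \<and>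
     (\<forall>f\<in>H. ip f f \<ge> 0) \<and>
     (\<forall>f\<in>H. ip f f = 0 \<longrightarrow> f = (\<lambda>x. 0)) \<and>
     (\<forall>s. (\<forall>n. s n \<in> H) \<longrightarrow>
        (\<forall>e>0. \<exists>N. \<forall>m\<ge>N. \<forall>n\<ge>N.
            sqrt (ip (\<lambda>x. s m x - s n x) (\<lambda>x. s m x - s n x)) < e) \<longrightarrow>
        (\<exists>f\<in>H. (\<lambda>n. sqrt (ip (\<lambda>x. s n x - f x) (\<lambda>x. s n x - f x))) \<longlonglongrightarrow> 0))"

text \<open>(H, ip) is the native space of Phi: the reproducing kernel Hilbert space of real
  functions on the space with reproducing kernel (x,y) |-> Phi(x - y).\<close>
definition native_space ::
  "('a::real_normed_vector \<Rightarrow> real) \<Rightarrow> ('a \<Rightarrow> real) set \<Rightarrow> (('a \<Rightarrow> real) \<Rightarrow> ('a \<Rightarrow> real) \<Rightarrow> real) \<Rightarrow> bool"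
  where
  "native_space \<Phi> H ip \<longleftrightarrow>
     hilbert_fun_space H ip \<and>
     (\<forall>y. (\<lambda>x. \<Phi> (x - y)) \<in> H) \<and>
     (\<forall>f\<in>H. \<forall>y. ip f (\<lambda>x. \<Phi> (x - y)) = f y)"

end

theory Submission
  imports Defs "HOL-Probability.Probability" "HOL-Complex_Analysis.Complex_Analysis"
begin

text \<open>
  Let \<open>m = l - k\<close> and \<open>d = 2 k + 1\<close>. Up to a constant, the one-dimensional function
  \<open>(1 - t\<^sup>2)\<^sub>+ powr l\<close> is the marginal of \<open>(1 - |y|\<^sup>2)\<^sub>+ powr m\<close> under projection of the
  \<open>d\<close>-dimensional space to a coordinate axis. Hence \<open>wu_conv l\<close> is the marginal of the radial
  function \<open>U\<close> obtained by convolving \<open>(1 - |y|\<^sup>2)\<^sub>+ powr m\<close> with itself, and taking the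
  marginal of a radial function in \<open>2 k\<close> directions amounts to \<open>k\<close> successive integrations in
  \<open>r\<^sup>2\<close>, which \<open>wu_D ^^ k\<close> undoes. This gives \<open>\<Phi> = P * P\<close>.

  Convolution with \<open>P\<close> is injective on square-integrable functions because the Fourier transform
  of \<open>P\<close> is radial and analytic along rays, so it vanishes only on countably many spheres. Transporting
  the inner product along the convolution turns \<open>P * L\<^sup>2\<close> into a Hilbert space, whose
  reproducing kernel is \<open>P * P\<close>, and a reproducing kernel Hilbert space is determined by its kernel.
\<close>

section \<open>Isometries and cylindrical coordinates\<close>

text \<open>The dimension and the constant belong together. The squared length of the 2 k transverse
  coordinates has density pi^k s^(k-1) / (k-1)!, which is pi^k times Cauchy's kernel for k-fold
  repeated integration; so a marginal is an integer number of integrations, and \<open>wu_D\<close>,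
  acting on F(r^2) as -2 F', removes them one at a time. With G = Gamma (m + 1) / Gamma (l + 1),
  projecting each factor costs pi^k G, the marginal of the convolution gives pi^k and the
  derivatives give 2^k: in total (2 / pi)^k / G^2, the square of the constant in
  \<open>wu_P\<close>.

  Injectivity is proved by duality with real cosine integrals: if p * g = 0, then g is orthogonal to
  the transform of every multiple of the transform of p, and such multiples approximate Gaussians
  with an error controlled in L^2.

  Identities between marginals are first proved for nonnegative integrals against test functions,
  where Fubini asks only for measurability; continuity then makes them pointwise, as differentiation
  requires.\<close>

lemma nn_integral_lborel_shift:
  fixes f :: "'a::euclidean_space \<Rightarrow> ennreal"
  assumes [measurable]: "f \<in> borel_measurable borel"
  shows "(\<integral>\<^sup>+x. f (c + x) \<partial>lborel) = (\<integral>\<^sup>+x. f x \<partial>lborel)"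
proof -
  have "(\<integral>\<^sup>+x. f x \<partial>lborel) = (\<integral>\<^sup>+x. f x \<partial>distr lborel borel ((+) c))"
    by (simp add: lborel_distr_plus)
  also have "\<dots> = (\<integral>\<^sup>+x. f (c + x) \<partial>lborel)"
    by (rule nn_integral_distr) auto
  finally show ?thesis ..
qed

lemma lborel_distr_minus:
  fixes c :: "'a::euclidean_space"
  shows "distr lborel borel (\<lambda>x. c - x) = lborel"
  by (subst (2) lborel_affine[of "-1" c]) (auto simp: density_1)

lemma nn_integral_lborel_minus:
  fixes f :: "'a::euclidean_space \<Rightarrow> ennreal"
  assumes [measurable]: "f \<in> borel_measurable borel"
  shows "(\<integral>\<^sup>+x. f (c - x) \<partial>lborel) = (\<integral>\<^sup>+x. f x \<partial>lborel)"
  using nn_integral_distr[of "\<lambda>x. c - x" lborel borel f] by (simp add: lborel_distr_minus)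

lemma integral_lborel_minus:
  fixes f :: "'a::euclidean_space \<Rightarrow> real"
  assumes "f \<in> borel_measurable borel"
  shows "(\<integral>x. f (c - x) \<partial>lborel) = (\<integral>x. f x \<partial>lborel)"
  using integral_distr[of "\<lambda>x. c - x" lborel borel f] assms by (simp add: lborel_distr_minus)

lemma integral_lborel_shift:
  fixes f :: "'a::euclidean_space \<Rightarrow> real"
  assumes "f \<in> borel_measurable borel"
  shows "(\<integral>x. f (c + x) \<partial>lborel) = (\<integral>x. f x \<partial>lborel)"
  using integral_distr[of "(+) c" lborel borel f] assms by (simp add: lborel_distr_plus)

text \<open>
  Uniqueness of Haar measure, tested against the indicator \<open>B\<close> of the unit ball, which \<open>T\<close> preserves:
  both sides of the claim agree after multiplication by the volume of the ball.
\<close>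

lemma lborel_distr_isometry:
  fixes T :: "'a::euclidean_space \<Rightarrow> 'a"
  assumes T: "linear T" "\<And>x. norm (T x) = norm x" "\<And>x. T (T x) = x"
  shows "distr lborel borel T = lborel"
proof (rule measure_eqI)
  have [measurable]: "T \<in> borel_measurable borel"
    by (intro borel_measurable_continuous_onI linear_continuous_on) (simp add: T(1) linear_conv_bounded_linear[symmetric])
  fix A assume "A \<in> sets (distr lborel borel T)"
  then have [measurable]: "A \<in> sets borel" by simp
  define f :: "'a \<Rightarrow> ennreal" where "f = indicator A"
  define B :: "'a \<Rightarrow> ennreal" where "B = indicator (ball 0 1)"
  have [measurable]: "f \<in> borel_measurable borel" "B \<in> borel_measurable borel"
    unfolding f_def B_def by (auto intro!: borel_measurable_indicator)
  let ?V = "\<integral>\<^sup>+y. B y \<partial>lborel"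
  have V: "?V = emeasure lborel (ball (0::'a) 1)"
    by (simp add: B_def)
  have "(\<integral>\<^sup>+x. f (T x) \<partial>lborel) * ?V = (\<integral>\<^sup>+x. (\<integral>\<^sup>+y. f (T x) * B y \<partial>lborel) \<partial>lborel)"
    by (simp add: nn_integral_cmult nn_integral_multc)
  also have "\<dots> = (\<integral>\<^sup>+x. (\<integral>\<^sup>+y. f (T x) * B (- T x + y) \<partial>lborel) \<partial>lborel)"
    by (subst nn_integral_lborel_shift) auto
  also have "\<dots> = (\<integral>\<^sup>+y. (\<integral>\<^sup>+x. f (T x) * B (- T x + y) \<partial>lborel) \<partial>lborel)"
    by (rule lborel_pair.Fubini') measurable
  \<comment> \<open>Because \<open>T\<close> is an involution, shifting by \<open>T y\<close> turns
    \<open>T (T y + x)\<close> into \<open>y + T x\<close>; now \<open>y\<close> is gone from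
    \<open>B\<close>, and translation invariance applies to \<open>f\<close>.\<close>
  also have "\<dots> = (\<integral>\<^sup>+y. (\<integral>\<^sup>+x. f (T (T y + x)) * B (- T (T y + x) + y) \<partial>lborel) \<partial>lborel)"
    by (intro nn_integral_cong nn_integral_lborel_shift[symmetric]) measurable
  also have "\<dots> = (\<integral>\<^sup>+y. (\<integral>\<^sup>+x. f (T x + y) * B (- T x) \<partial>lborel) \<partial>lborel)"
    by (simp add: linear_add[OF T(1)] T(3) add.commute)
  also have "\<dots> = (\<integral>\<^sup>+x. (\<integral>\<^sup>+y. f (T x + y) * B (- T x) \<partial>lborel) \<partial>lborel)"
    by (rule lborel_pair.Fubini') measurable
  also have "\<dots> = (\<integral>\<^sup>+x. (\<integral>\<^sup>+y. f y * B (- T x) \<partial>lborel) \<partial>lborel)"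
    by (simp add: nn_integral_multc nn_integral_lborel_shift)
  also have "\<dots> = (\<integral>\<^sup>+x. (\<integral>\<^sup>+y. f y * B x \<partial>lborel) \<partial>lborel)"
    by (intro nn_integral_cong) (auto simp: B_def indicator_def T(2))
  also have "\<dots> = (\<integral>\<^sup>+y. f y \<partial>lborel) * ?V"
    by (simp add: nn_integral_cmult nn_integral_multc)
  finally have eq: "?V * (\<integral>\<^sup>+x. f (T x) \<partial>lborel) = ?V * (\<integral>\<^sup>+y. f y \<partial>lborel)"
    by (simp add: mult.commute)
  have "emeasure lborel (ball (0::'a) 1) \<noteq> 0"
    using emeasure_lborel_ball_finite[of "0::'a" 1]
    using unit_ball_vol_pos[of "real DIM('a)"] by (auto simp: emeasure_ball simp del: unit_ball_vol_pos)
  moreover have "emeasure lborel (ball (0::'a) 1) \<noteq> top"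
    using emeasure_lborel_ball_finite[of "0::'a" 1] by auto
  ultimately have "(\<integral>\<^sup>+x. f (T x) \<partial>lborel) = (\<integral>\<^sup>+y. f y \<partial>lborel)"
    using eq by (simp add: V ennreal_mult_cancel_left)
  moreover have "(\<lambda>x. f (T x)) = indicator (T -` A)"
    by (auto simp: f_def indicator_def)
  ultimately show "emeasure (distr lborel borel T) A = emeasure lborel A"
    using measurable_sets[of T borel borel A] by (simp add: emeasure_distr f_def)
qed simp

text \<open>Householder reflection in the hyperplane orthogonal to \<open>x - y\<close>; the equal
  norms enter as \<open>2 * (x \<bullet> v) = v \<bullet> v\<close>. Being an involution, it meets
  the hypotheses of \<open>lborel_distr_isometry\<close>.\<close>

lemma reflection_exists:
  fixes x y :: "'a::real_inner"
  assumes "norm x = norm y"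
  obtains T :: "'a \<Rightarrow> 'a" where "linear T" "\<And>z. norm (T z) = norm z" "\<And>z. T (T z) = z" "T x = y"
proof (cases "x = y")
  case True
  then show ?thesis using that[of "\<lambda>z. z"] by (auto simp: linear_iff)
next
  case False
  define v where "v = x - y"
  have v: "v \<bullet> v \<noteq> 0" using False by (auto simp: v_def)
  define T where "T z = z - (2 * (z \<bullet> v) / (v \<bullet> v)) *\<^sub>R v" for z
  have "linear T"
    unfolding linear_iff T_def by (auto simp: inner_add_left algebra_simps add_divide_distrib)
  moreover have "T (T z) = z" for z
    using v by (auto simp: T_def inner_diff_left field_simps)
  moreover have "norm (T z) = norm z" for z
  proof -
    have "T z \<bullet> T z = z \<bullet> z"
      using v by (simp add: T_def inner_diff_left inner_diff_right inner_commute[of v z] field_simps)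
    then show ?thesis by (simp add: norm_eq)
  qed
  moreover have "T x = y"
  proof -
    have "x \<bullet> x = y \<bullet> y" using assms by (simp add: norm_eq)
    then have "2 * (x \<bullet> v) = v \<bullet> v"
      by (simp add: v_def inner_diff_left inner_diff_right inner_commute[of y x])
    then show ?thesis using v by (simp add: T_def) (simp add: v_def)
  qed
  ultimately show ?thesis using that by blast
qed

lemma integral_lborel_isometry:
  fixes T :: "'a::euclidean_space \<Rightarrow> 'a" and f :: "'a \<Rightarrow> real"
  assumes "linear T" "\<And>x. norm (T x) = norm x" "\<And>x. T (T x) = x"
    and [measurable]: "f \<in> borel_measurable borel"
  shows "(\<integral>x. f (T x) \<partial>lborel) = (\<integral>x. f x \<partial>lborel)"
proof -
  have "T \<in> borel_measurable borel"
    by (intro borel_measurable_continuous_onI linear_continuous_on) (simp add: assms(1) linear_conv_bounded_linear[symmetric])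
  then show ?thesis
    using integral_distr[of T lborel borel f] lborel_distr_isometry[OF assms(1-3)] by simp
qed

lemma isometry_inner:
  fixes T :: "'a::real_inner \<Rightarrow> 'a"
  assumes "linear T" "\<And>x. norm (T x) = norm x"
  shows "T x \<bullet> T y = x \<bullet> y"
proof -
  have "T (x + y) \<bullet> T (x + y) = (x + y) \<bullet> (x + y)" "T x \<bullet> T x = x \<bullet> x" "T y \<bullet> T y = y \<bullet> y"
    using assms(2) by (simp_all add: dot_square_norm)
  then show ?thesis
    by (simp add: linear_add[OF assms(1)] inner_add_left inner_add_right inner_commute)
qed

text \<open>Derivative in \<open>s\<close> of \<open>pi ^ k * s ^ k / fact k\<close>, the volume of
  the ball of squared radius \<open>s\<close> in dimension \<open>2 * k\<close>; hence the density
  of the squared norm there.\<close>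

definition sq_density :: "nat \<Rightarrow> real \<Rightarrow> real" where
  "sq_density k s = (if 0 < s then pi ^ k * s ^ (k - 1) / fact (k - 1) else 0)"

lemma sq_density_nonneg: "0 \<le> sq_density k s"
  by (simp add: sq_density_def)

lemma borel_measurable_sq_density [measurable]: "sq_density k \<in> borel_measurable borel"
  unfolding sq_density_def by measurable

lemma nn_integral_sq_density:
  assumes "0 < k"
  shows "(\<integral>\<^sup>+s. ennreal (sq_density k s) * indicator {..a} s \<partial>lborel)
    = ennreal (if 0 < a then pi ^ k * a ^ k / fact k else 0)"
proof (cases "0 < a")
  case True
  have "(\<integral>\<^sup>+s. ennreal (sq_density k s) * indicator {..a} s \<partial>lborel)
      = (\<integral>\<^sup>+s. ennreal (pi ^ k * s ^ (k - 1) / fact (k - 1)) * indicator {0..a} s \<partial>lborel)"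
    by (intro nn_integral_cong_AE, use AE_lborel_singleton[of "0::real"] in eventually_elim)
       (auto simp: sq_density_def indicator_def)
  also have "\<dots> = ennreal (pi ^ k * a ^ k / fact k - pi ^ k * 0 ^ k / fact k)"
  proof (rule nn_integral_FTC_Icc)
    fix x assume "x \<in> {0..a}"
    show "((\<lambda>x. pi ^ k * x ^ k / fact k) has_real_derivative pi ^ k * x ^ (k - 1) / fact (k - 1)) (at x)"
      using assms by (auto intro!: derivative_eq_intros simp: fact_reduce[of k])
  qed (use True assms in \<open>auto intro!: divide_nonneg_pos\<close>)
  finally show ?thesis using True assms by (simp add: power_0_left)
next
  case False
  then have "ennreal (sq_density k s) * indicator {..a} s = 0" for s
    by (auto simp: sq_density_def indicator_def)
  then show ?thesis using False by (simp only: nn_integral_const) simp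
qed

text \<open>Sublevel sets of the sum of squares are balls, so the ball volume formula settles the
  half-lines \<open>{..a}\<close>, which generate the Borel sets.\<close>

lemma distr_sum_squares:
  assumes I: "finite I" "card I = 2 * k" and k: "0 < k"
  shows "distr (Pi\<^sub>M I (\<lambda>_. lborel)) borel (\<lambda>z. \<Sum>i\<in>I. (z i)\<^sup>2) = density lborel (\<lambda>s. ennreal (sq_density k s))"
    (is "?M = ?N")
proof (rule measure_eqI_generator_eq)
  let ?P = "Pi\<^sub>M I (\<lambda>_. lborel :: real measure)"
  let ?E = "range (\<lambda>a. {..a::real})"
  have pos: "emeasure ?M {..a} = ennreal (pi ^ k * a ^ k / fact k)" if "0 < a" for a
  proof -
    have "emeasure ?M {..a} = emeasure ?P ({f. sqrt (\<Sum>i\<in>I. (f i)\<^sup>2) \<le> sqrt a} \<inter> space ?P)"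
      by (subst emeasure_distr) (auto simp: vimage_def intro!: arg_cong[where f="emeasure ?P"])
    also have "\<dots> = ennreal (unit_ball_vol (real (card I)) * sqrt a ^ card I)"
      using I that by (intro emeasure_cball_aux) auto
    also have "\<dots> = ennreal (pi ^ k * a ^ k / fact k)"
      using that by (simp add: I unit_ball_vol_def power_mult powr_realpow Gamma_fact[symmetric] add.commute)
    finally show ?thesis .
  qed
  \<comment> \<open>The ball volume formula is used for positive radii only; for
    \<open>a \<le> 0\<close> the measure is squeezed by the volumes of balls whose squared radius
    \<open>e\<close> tends to 0.\<close>
  have zero: "emeasure ?M {..a} = 0" if "a \<le> 0" for a
  proof (rule ccontr)
    assume ne: "emeasure ?M {..a} \<noteq> 0"
    have le: "emeasure ?M {..a} \<le> ennreal (pi ^ k * e ^ k / fact k)" if "0 < e" for e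
      using emeasure_mono[of "{..a}" "{..e}" ?M] pos[OF that] \<open>a \<le> 0\<close> that by simp
    have "((\<lambda>e. pi ^ k * e ^ k / fact k) \<longlongrightarrow> pi ^ k * 0 ^ k / fact k) (at_right 0)"
      by (intro tendsto_intros) auto
    from tendsto_ennrealI[OF this]
    have "((\<lambda>e. ennreal (pi ^ k * e ^ k / fact k)) \<longlongrightarrow> 0) (at_right 0)"
      using k by (simp add: power_0_left)
    moreover have "\<forall>\<^sub>F e in at_right 0. emeasure ?M {..a} \<le> ennreal (pi ^ k * e ^ k / fact k)"
      using le by (auto simp: eventually_at_filter)
    ultimately have "emeasure ?M {..a} \<le> 0"
      by (intro tendsto_lowerbound) auto
    with ne show False by simp
  qed
  show "Int_stable ?E" by (auto simp: Int_stable_def)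
  show "?E \<subseteq> Pow UNIV" by auto
  show "sets ?M = sigma_sets UNIV ?E" "sets ?N = sigma_sets UNIV ?E"
    by (simp_all add: borel_eq_atMost)
  show "range (\<lambda>i. {..real i}) \<subseteq> ?E" by auto
  show "(\<Union>i. {..real i}) = UNIV" by (auto simp: real_arch_simple)
  show "emeasure ?M {..real i} \<noteq> \<infinity>" for i
    using pos[of "real i"] zero[of "real i"] by (cases "i = 0") auto
  fix X assume "X \<in> ?E"
  then obtain a where X: "X = {..a}" by auto
  show "emeasure ?M X = emeasure ?N X"
    using pos[of a] zero[of a] nn_integral_sq_density[OF k, of a]
    by (auto simp: X emeasure_density not_less)
qed

text \<open>\<open>(norm x)^2 - (x \<bullet> b)^2\<close> is the squared norm of the component
  orthogonal to \<open>b\<close>. The coordinate along \<open>b\<close> is split off the product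
  measure behind \<open>lborel\<close>.\<close>

lemma nn_integral_PiM_cylinder:
  fixes F :: "real \<Rightarrow> real \<Rightarrow> ennreal"
  assumes b: "b \<in> (Basis :: 'a::euclidean_space set)"
    and F [measurable]: "case_prod F \<in> borel_measurable borel"
  defines "I \<equiv> Basis - {b}"
  shows "(\<integral>\<^sup>+(x::'a). F (x \<bullet> b) ((norm x)\<^sup>2 - (x \<bullet> b)\<^sup>2) \<partial>lborel)
    = (\<integral>\<^sup>+t. (\<integral>\<^sup>+z. F t (\<Sum>i\<in>I. (z i)\<^sup>2) \<partial>Pi\<^sub>M I (\<lambda>_. lborel)) \<partial>lborel)"
proof -
  have I: "finite I" "insert b I = Basis" "b \<notin> I"
    using b by (auto simp: I_def)
  interpret product_sigma_finite "\<lambda>_. lborel :: real measure" by standard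
  have [measurable]: "case_prod F \<in> borel_measurable (borel \<Otimes>\<^sub>M borel)"
    using F by (simp add: borel_prod)
  let ?S = "\<lambda>f. \<Sum>c\<in>Basis. f c *\<^sub>R (c :: 'a)"
  have S1: "?S f \<bullet> b = f b" for f
    using b by (simp add: inner_sum_left inner_Basis if_distrib cong: if_cong)
  have S2: "(norm (?S f))\<^sup>2 - (?S f \<bullet> b)\<^sup>2 = (\<Sum>i\<in>I. (f i)\<^sup>2)" for f
  proof -
    have "(norm (?S f))\<^sup>2 = (\<Sum>i\<in>Basis. (f i)\<^sup>2)"
      by (subst norm_sum_Pythagorean) (auto simp: pairwise_def orthogonal_def inner_Basis)
    also have "\<dots> = (f b)\<^sup>2 + (\<Sum>i\<in>I. (f i)\<^sup>2)"
      using I by (metis sum.insert)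
    finally show ?thesis by (simp add: S1)
  qed
  have "(\<integral>\<^sup>+(x::'a). F (x \<bullet> b) ((norm x)\<^sup>2 - (x \<bullet> b)\<^sup>2) \<partial>lborel)
      = (\<integral>\<^sup>+f. F (f b) (\<Sum>i\<in>I. (f i)\<^sup>2) \<partial>Pi\<^sub>M (insert b I) (\<lambda>_. lborel))"
  proof -
    have "F (?S f \<bullet> b) ((norm (?S f))\<^sup>2 - (?S f \<bullet> b)\<^sup>2) = F (f b) (\<Sum>i\<in>I. (f i)\<^sup>2)" for f
      by (subst S2, subst S1, rule refl)
    then show ?thesis
      by (subst lborel_eq, subst nn_integral_distr) (simp_all only: I, measurable)
  qed
  also have "\<dots> = (\<integral>\<^sup>+t. (\<integral>\<^sup>+z. F t (\<Sum>i\<in>I. (z i)\<^sup>2) \<partial>Pi\<^sub>M I (\<lambda>_. lborel)) \<partial>lborel)"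
  proof (subst product_nn_integral_insert_rev[OF I(1,3)])
    have "(\<Sum>i\<in>I. ((z(b := t)) i)\<^sup>2) = (\<Sum>i\<in>I. (z i)\<^sup>2)" for z :: "'a \<Rightarrow> real" and t
      using I(3) by (intro sum.cong) auto
    then show "(\<integral>\<^sup>+ t. \<integral>\<^sup>+ z. F ((z(b := t)) b) (\<Sum>i\<in>I. ((z(b := t)) i)\<^sup>2) \<partial>Pi\<^sub>M I (\<lambda>_. lborel) \<partial>lborel)
        = (\<integral>\<^sup>+t. (\<integral>\<^sup>+z. F t (\<Sum>i\<in>I. (z i)\<^sup>2) \<partial>Pi\<^sub>M I (\<lambda>_. lborel)) \<partial>lborel)"
      by simp
  qed measurable
  finally show ?thesis .
qed

lemma nn_integral_cylinder:
  fixes F :: "real \<Rightarrow> real \<Rightarrow> ennreal"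
  assumes b: "b \<in> (Basis :: 'a::euclidean_space set)" and dim: "DIM('a) = 2 * k + 1" and k: "0 < k"
    and F [measurable]: "case_prod F \<in> borel_measurable borel"
  shows "(\<integral>\<^sup>+(x::'a). F (x \<bullet> b) ((norm x)\<^sup>2 - (x \<bullet> b)\<^sup>2) \<partial>lborel)
    = (\<integral>\<^sup>+t. (\<integral>\<^sup>+s. F t s * ennreal (sq_density k s) \<partial>lborel) \<partial>lborel)"
proof -
  define I where "I = Basis - {b}"
  have I: "finite I" "card I = 2 * k"
    using b dim by (auto simp: I_def)
  have [measurable]: "case_prod F \<in> borel_measurable (borel \<Otimes>\<^sub>M borel)"
    using F by (simp add: borel_prod)
  have "(\<integral>\<^sup>+(x::'a). F (x \<bullet> b) ((norm x)\<^sup>2 - (x \<bullet> b)\<^sup>2) \<partial>lborel)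
      = (\<integral>\<^sup>+t. (\<integral>\<^sup>+z. F t (\<Sum>i\<in>I. (z i)\<^sup>2) \<partial>Pi\<^sub>M I (\<lambda>_. lborel)) \<partial>lborel)"
    unfolding I_def by (rule nn_integral_PiM_cylinder[OF b F])
  also have "\<dots> = (\<integral>\<^sup>+t. (\<integral>\<^sup>+s. F t s \<partial>distr (Pi\<^sub>M I (\<lambda>_. lborel)) borel (\<lambda>z. \<Sum>i\<in>I. (z i)\<^sup>2)) \<partial>lborel)"
    by (intro nn_integral_cong, subst nn_integral_distr) auto
  also have "\<dots> = (\<integral>\<^sup>+t. (\<integral>\<^sup>+s. F t s * ennreal (sq_density k s) \<partial>lborel) \<partial>lborel)"
    unfolding distr_sum_squares[OF I k]
    by (intro nn_integral_cong) (simp add: nn_integral_density mult.commute)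
  finally show ?thesis .
qed

text \<open>For \<open>k = 0\<close> there are no transverse directions, and the squared transverse
  norm is a point mass at 0 instead of having a density; dimension one is therefore treated
  apart.\<close>

lemma nn_integral_cylinder_0:
  fixes F :: "real \<Rightarrow> ennreal"
  assumes b: "b \<in> (Basis :: 'a::euclidean_space set)" and dim: "DIM('a) = 1"
    and F [measurable]: "F \<in> borel_measurable borel"
  shows "(\<integral>\<^sup>+(x::'a). F (x \<bullet> b) \<partial>lborel) = (\<integral>\<^sup>+t. F t \<partial>lborel)"
proof -
  have B: "Basis - {b} = {}"
    using b dim by (metis card_1_singletonE singletonD Diff_cancel)
  have "(\<lambda>(t, s). F t) \<in> borel_measurable (borel :: (real \<times> real) measure)"
    unfolding borel_prod[symmetric] by measurable
  then show ?thesis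
    using nn_integral_PiM_cylinder[OF b, of "\<lambda>t s. F t", unfolded B]
    by (simp only: PiM_empty nn_integral_count_space_finite) simp
qed

section \<open>Truncated powers and their self-convolutions\<close>

lemma trunc_pow_nonneg [simp]: "0 \<le> trunc_pow m r"
  by (simp add: trunc_pow_def)

lemma trunc_pow_le_1: "0 \<le> m \<Longrightarrow> trunc_pow m r \<le> 1"
  unfolding trunc_pow_def by (rule powr_le1) auto

lemma trunc_pow_abs [simp]: "trunc_pow m \<bar>r\<bar> = trunc_pow m r"
  by (simp add: trunc_pow_def)

lemma trunc_pow_eq_0: "1 \<le> \<bar>r\<bar> \<Longrightarrow> trunc_pow m r = 0"
  using one_le_power[of "\<bar>r\<bar>" 2] by (simp add: trunc_pow_def max_def)

lemma borel_measurable_trunc_pow [measurable]: "trunc_pow m \<in> borel_measurable borel"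
  unfolding trunc_pow_def by measurable

text \<open>At \<open>\<bar>r\<bar> = 1\<close> the function jumps when \<open>m = 0\<close>, since
  \<open>0 powr 0 = 0\<close>. Excluding this null set keeps the argument uniform in
  \<open>m\<close>.\<close>

lemma isCont_trunc_pow: "\<bar>r\<bar> \<noteq> 1 \<Longrightarrow> isCont (trunc_pow m) r"
proof -
  assume r: "\<bar>r\<bar> \<noteq> 1"
  show ?thesis
  proof (cases "\<bar>r\<bar> < 1")
    case True
    then have "r\<^sup>2 < 1" by (simp add: abs_square_less_1)
    then show ?thesis unfolding trunc_pow_def by (intro continuous_intros) (auto simp: max_def)
  next
    case False
    then have "\<forall>\<^sub>F x in nhds r. 1 < \<bar>x\<bar>"
      using r order_tendstoD(1)[of abs "\<bar>r\<bar>" "nhds r" 1] tendsto_rabs[OF filterlim_ident, of r] by auto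
    then have "\<forall>\<^sub>F x in nhds r. trunc_pow m x = 0"
      by eventually_elim (simp add: trunc_pow_eq_0)
    then show ?thesis by (subst isCont_cong) auto
  qed
qed

lemma isCont_trunc_pow_norm:
  "norm (x :: 'a::real_normed_vector) \<noteq> 1 \<Longrightarrow> isCont (\<lambda>x. trunc_pow m (norm x)) x"
  by (rule isCont_o2[OF _ isCont_trunc_pow]) auto

lemma AE_norm_neq: "AE x in lborel. norm (x :: 'a::euclidean_space) \<noteq> r"
proof -
  have "negligible (sphere (0::'a) r)" by (rule negligible_sphere)
  then have "sphere (0::'a) r \<in> null_sets lborel"
    by (simp add: negligible_iff_null_sets null_sets_completion_iff)
  then show ?thesis
    by (rule AE_I') auto
qed

lemma AE_lborel_minus:
  assumes "AE z in lborel. P (z :: 'a::euclidean_space)"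
  shows "AE y in lborel. P (x - y)"
proof -
  have "AE z in distr lborel borel (\<lambda>y. x - y). P z"
    by (subst lborel_distr_minus) (rule assms)
  then show ?thesis
    by (rule AE_distrD[rotated]) simp
qed

text \<open>Dominated convergence along sequences. Continuity of \<open>h\<close> almost everywhere
  suffices, so that \<open>h\<close> may be a truncated power with a jump or the indicator of a box,
  while \<open>g\<close> is only locally integrable.\<close>

lemma continuous_convolution:
  fixes h g :: "'a::euclidean_space \<Rightarrow> real"
  assumes [measurable]: "h \<in> borel_measurable borel" "g \<in> borel_measurable borel"
    and bd: "\<And>z. \<bar>h z\<bar> \<le> C" and supp: "\<And>z. R < norm z \<Longrightarrow> h z = 0"
    and cont: "AE z in lborel. isCont h z"
    and loc: "\<And>r. integrable lborel (\<lambda>y. indicator (cball 0 r) y * g y)"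
  shows "continuous_on UNIV (\<lambda>x. \<integral>y. h (x - y) * g y \<partial>lborel)"
proof (clarsimp simp: continuous_on_eq_continuous_at)
  fix x
  show "isCont (\<lambda>x. \<integral>y. h (x - y) * g y \<partial>lborel) x"
  proof (rule continuous_at_sequentiallyI)
    fix u assume u: "u \<longlonglongrightarrow> x"
    have C: "0 \<le> C" using bd[of 0] by linarith
    obtain B where B: "\<And>n. norm (u n) \<le> B"
      using convergent_imp_Bseq[of u] u by (auto simp: Bseq_def convergent_def)
    show "(\<lambda>n. \<integral>y. h (u n - y) * g y \<partial>lborel) \<longlonglongrightarrow> (\<integral>y. h (x - y) * g y \<partial>lborel)"
    proof (rule integral_dominated_convergence)
      show "integrable lborel (\<lambda>y. C * \<bar>indicator (cball 0 (B + R)) y * g y\<bar>)"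
        by (intro integrable_mult_right integrable_abs loc)
      have "AE y in lborel. isCont h (x - y)"
        using cont by (rule AE_lborel_minus)
      then show "AE y in lborel. (\<lambda>n. h (u n - y) * g y) \<longlonglongrightarrow> h (x - y) * g y"
      proof eventually_elim
        case (elim y)
        then have "(\<lambda>n. h (u n - y)) \<longlonglongrightarrow> h (x - y)"
          by (rule isCont_tendsto_compose) (intro tendsto_intros u)
        then show ?case by (intro tendsto_intros)
      qed
      show "AE y in lborel. norm (h (u n - y) * g y) \<le> C * \<bar>indicator (cball 0 (B + R)) y * g y\<bar>" for n
      proof (rule AE_I2)
        fix y
        show "norm (h (u n - y) * g y) \<le> C * \<bar>indicator (cball 0 (B + R)) y * g y\<bar>"
        proof (cases "norm y \<le> B + R")
          case True
          then show ?thesis using bd[of "u n - y"] by (simp add: abs_mult mult_right_mono)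
        next
          case False
          moreover have "norm y - norm (u n) \<le> norm (u n - y)"
            using norm_triangle_ineq2[of y "u n"] by (simp add: norm_minus_commute)
          ultimately have "R < norm (u n - y)" using B[of n] by linarith
          then show ?thesis using C by (simp add: supp)
        qed
      qed
    qed measurable
  qed
qed

section \<open>Self-convolutions of radial truncated powers\<close>

lemma integrable_trunc_pow:
  assumes "0 \<le> m"
  shows "integrable lborel (\<lambda>y::'a::euclidean_space. trunc_pow m (norm y))"
proof (rule Bochner_Integration.integrable_bound)
  show "integrable lborel (indicator (cball 0 1) :: 'a \<Rightarrow> real)"
    using emeasure_lborel_cball_finite[of "0::'a" 1] by (simp add: integrable_indicator_iff)
  show "AE y in lborel. norm (trunc_pow m (norm (y::'a))) \<le> norm (indicator (cball 0 1) y :: real)"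
    using trunc_pow_le_1[OF assms] trunc_pow_eq_0[of _ m]
    by (intro AE_I2) (auto simp: indicator_def not_le less_imp_le)
qed measurable

text \<open>Generic in the space: on the reals it is \<open>wu_conv\<close>, on the space of
  dimension \<open>2 * k + 1\<close> it is the self-convolution of \<open>wu_P\<close> without the
  constant.\<close>

definition tconv :: "real \<Rightarrow> 'a::euclidean_space \<Rightarrow> real" where
  "tconv m x = (\<integral>y. trunc_pow m (norm (x - y)) * trunc_pow m (norm y) \<partial>lborel)"

lemma tconv_integrable:
  assumes "0 \<le> m"
  shows "integrable lborel (\<lambda>y::'a::euclidean_space. trunc_pow m (norm (x - y)) * trunc_pow m (norm y))"
  by (rule Bochner_Integration.integrable_bound[OF integrable_trunc_pow[OF assms]])
     (auto intro!: AE_I2 mult_left_le_one_le trunc_pow_le_1 assms simp: abs_mult)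

lemma nn_tconv:
  assumes "0 \<le> m"
  shows "ennreal (tconv m x) = (\<integral>\<^sup>+y. ennreal (trunc_pow m (norm (x - y))) * ennreal (trunc_pow m (norm y)) \<partial>lborel)"
  unfolding tconv_def
  by (subst nn_integral_eq_integral[OF tconv_integrable[OF assms], symmetric]) (auto simp: ennreal_mult)

lemma tconv_nonneg: "0 \<le> tconv m x"
  unfolding tconv_def by (rule Bochner_Integration.integral_nonneg) auto

lemma continuous_tconv:
  assumes "0 \<le> m"
  shows "continuous_on UNIV (tconv m :: 'a::euclidean_space \<Rightarrow> real)"
  unfolding tconv_def
proof (rule continuous_convolution[where C=1 and R=1])
  show "AE z in lborel. isCont (\<lambda>z::'a. trunc_pow m (norm z)) z"
    using AE_norm_neq[of 1] by eventually_elim (rule isCont_trunc_pow_norm)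
  show "integrable lborel (\<lambda>y::'a. indicator (cball 0 r) y * trunc_pow m (norm y))" for r
    by (rule Bochner_Integration.integrable_bound[OF integrable_trunc_pow[OF assms]])
       (auto simp: indicator_def)
qed (auto simp: trunc_pow_le_1 assms trunc_pow_eq_0)

lemma borel_measurable_tconv [measurable]: "0 \<le> m \<Longrightarrow> tconv m \<in> borel_measurable borel"
  by (intro borel_measurable_continuous_onI continuous_tconv)

lemma tconv_radial:
  fixes x y :: "'a::euclidean_space"
  assumes "norm x = norm y"
  shows "tconv m x = tconv m y"
proof -
  obtain T :: "'a \<Rightarrow> 'a" where T: "linear T" "\<And>z. norm (T z) = norm z" "\<And>z. T (T z) = z" "T x = y"
    using reflection_exists[OF assms] by blast
  have "tconv m y = (\<integral>z. trunc_pow m (norm (T x - T z)) * trunc_pow m (norm (T z)) \<partial>lborel)"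
    unfolding tconv_def T(4)
    by (rule integral_lborel_isometry[OF T(1-3), symmetric, where f="\<lambda>z. trunc_pow m (norm (y - z)) * trunc_pow m (norm z)"]) measurable
  also have "\<dots> = tconv m x"
    by (simp add: tconv_def linear_diff[OF T(1), symmetric] T(2))
  finally show ?thesis ..
qed

lemma tconv_eq_0:
  assumes "2 \<le> norm x"
  shows "tconv m x = 0"
proof -
  have "trunc_pow m (norm (x - y)) * trunc_pow m (norm y) = 0" for y
  proof (cases "norm y < 1")
    case True
    then have "1 \<le> norm (x - y)" using assms norm_triangle_ineq2[of x y] by linarith
    then show ?thesis by (simp add: trunc_pow_eq_0)
  qed (simp add: trunc_pow_eq_0)
  then show ?thesis by (simp only: tconv_def) simp
qed

text \<open>In terms of the squared radius \<open>s\<close>, \<open>wu_D\<close> becomes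
  differentiation times -2. As \<open>sqrt\<close> is odd and defined on the whole line, continuity
  holds also at negative \<open>s\<close>; the bound 4 is the square of the support radius
  2.\<close>

lemma tconv_profile:
  fixes b :: "'a::euclidean_space"
  shows "0 \<le> m \<Longrightarrow> continuous_on UNIV (\<lambda>s. tconv m (sqrt s *\<^sub>R b))"
    and "norm b = 1 \<Longrightarrow> 4 \<le> s \<Longrightarrow> tconv m (sqrt s *\<^sub>R b) = 0"
proof -
  show "0 \<le> m \<Longrightarrow> continuous_on UNIV (\<lambda>s. tconv m (sqrt s *\<^sub>R b))"
    by (rule continuous_on_compose2[OF continuous_tconv]) (auto intro!: continuous_intros)
  assume "norm b = 1" "4 \<le> s"
  moreover have "2 \<le> sqrt s" using \<open>4 \<le> s\<close> real_sqrt_le_mono[of 4 s] by simp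
  ultimately show "tconv m (sqrt s *\<^sub>R b) = 0" by (intro tconv_eq_0) auto
qed

text \<open>The substitution \<open>s = a * u\<close> produces \<open>Beta (real k) (m + 1)\<close>,
  whose factor \<open>Gamma (real k)\<close> cancels the factorial in \<open>sq_density\<close>.
  This is the source of the Gamma quotient in \<open>wu_P\<close>.\<close>

lemma nn_integral_Beta_sq_density:
  assumes k: "0 < k" and m: "0 \<le> m"
  shows "(\<integral>\<^sup>+s. ennreal ((max 0 (a - s)) powr m) * ennreal (sq_density k s) \<partial>lborel)
    = ennreal (pi ^ k * Gamma (m + 1) / Gamma (m + real k + 1) * (max 0 a) powr (m + real k))"
proof (cases "0 < a")
  case False
  then have "ennreal ((max 0 (a - s)) powr m) * ennreal (sq_density k s) = 0" for s
    by (auto simp: sq_density_def)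
  then show ?thesis using False by (simp only: nn_integral_const) simp
next
  case True
  define c where "c = pi ^ k / fact (k - 1) * a powr (m + real k)"
  have c: "0 \<le> c" by (simp add: c_def)
  have "((\<lambda>t. t powr (real k - 1) * (1 - t) powr (m + 1 - 1)) has_integral Beta (real k) (m + 1)) {0..1}"
    using k m by (intro has_integral_Beta_real) auto
  then have beta: "(\<integral>\<^sup>+t. ennreal (indicator {0..1} t * (t powr (real k - 1) * (1 - t) powr m)) \<partial>lborel)
      = ennreal (Beta (real k) (m + 1))"
    by (intro nn_integral_has_integral_lebesgue) auto
  have "(\<integral>\<^sup>+s. ennreal ((max 0 (a - s)) powr m) * ennreal (sq_density k s) \<partial>lborel)
      = ennreal \<bar>a\<bar> * (\<integral>\<^sup>+u. ennreal ((max 0 (a - (0 + a * u))) powr m) * ennreal (sq_density k (0 + a * u)) \<partial>lborel)"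
    using True by (intro nn_integral_real_affine) auto
  also have "\<dots> = (\<integral>\<^sup>+u. ennreal a * (ennreal ((max 0 (a - a * u)) powr m) * ennreal (sq_density k (a * u))) \<partial>lborel)"
    using True by (simp add: nn_integral_cmult)
  also have "\<dots> = (\<integral>\<^sup>+u. ennreal c * ennreal (indicator {0..1} u * (u powr (real k - 1) * (1 - u) powr m)) \<partial>lborel)"
  proof (intro nn_integral_cong)
    fix u :: real
    consider "u \<le> 0" | "1 \<le> u" | "0 < u" "u < 1" by linarith
    then show "ennreal a * (ennreal ((max 0 (a - a * u)) powr m) * ennreal (sq_density k (a * u)))
      = ennreal c * ennreal (indicator {0..1} u * (u powr (real k - 1) * (1 - u) powr m))"
    proof cases
      case 1
      then show ?thesis using True
        by (cases "u = 0") (auto simp: sq_density_def indicator_def zero_less_mult_iff)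
    next
      case 2
      then have "a - a * u \<le> 0" using True by (simp add: algebra_simps)
      then show ?thesis using 2 by (cases "u = 1") (auto simp: max_def indicator_def)
    next
      case 3
      have e1: "max 0 (a - a * u) = a * (1 - u)"
        using 3 True by (simp add: algebra_simps)
      have e2: "(a * u) ^ (k - 1) = a powr (real k - 1) * u powr (real k - 1)"
        using 3 True k powr_realpow[of a "k - 1"] powr_realpow[of u "k - 1"]
        by (simp add: power_mult_distrib of_nat_diff)
      have e3: "a powr (m + real k) = a * a powr m * a powr (real k - 1)"
        using True by (simp add: powr_add powr_diff)
      have "a * ((max 0 (a - a * u)) powr m * sq_density k (a * u))
          = c * (u powr (real k - 1) * (1 - u) powr m)"
        using 3 True by (simp add: sq_density_def e1 e2 e3 c_def powr_mult del: One_nat_def)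
      then show ?thesis using 3 True c
        by (simp add: ennreal_mult'[symmetric] sq_density_nonneg)
    qed
  qed
  also have "\<dots> = ennreal c * ennreal (Beta (real k) (m + 1))"
    by (subst nn_integral_cmult) (auto simp: beta)
  also have "\<dots> = ennreal (c * Beta (real k) (m + 1))"
    using c by (simp add: ennreal_mult')
  also have "c * Beta (real k) (m + 1) = pi ^ k * Gamma (m + 1) / Gamma (m + real k + 1) * a powr (m + real k)"
  proof -
    have "Gamma (real k) = fact (k - 1)"
      using k Gamma_fact[of "k - 1", where 'a=real] by (simp add: of_nat_diff)
    then show ?thesis by (simp add: c_def Beta_def algebra_simps)
  qed
  finally show ?thesis using True by simp
qed

text \<open>Projection along \<open>2 * k\<close> directions raises the exponent by
  \<open>k\<close>. The arbitrary test function \<open>\<phi>\<close> allows the identity to be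
  applied to the two factors of a convolution one after the other.\<close>

lemma nn_integral_trunc_pow_marginal:
  fixes \<phi> :: "real \<Rightarrow> ennreal"
  assumes b: "b \<in> (Basis :: 'a::euclidean_space set)" and dim: "DIM('a) = 2 * k + 1" and k: "0 < k"
    and m: "0 \<le> m" and [measurable]: "\<phi> \<in> borel_measurable borel"
  shows "(\<integral>\<^sup>+(x::'a). \<phi> (x \<bullet> b) * ennreal (trunc_pow m (norm x)) \<partial>lborel)
    = ennreal (pi ^ k * Gamma (m + 1) / Gamma (m + real k + 1))
      * (\<integral>\<^sup>+t. \<phi> t * ennreal (trunc_pow (m + real k) t) \<partial>lborel)"
proof -
  define c where "c = pi ^ k * Gamma (m + 1) / Gamma (m + real k + 1)"
  define F where "F t s = \<phi> t * ennreal ((max 0 (1 - t\<^sup>2 - s)) powr m)" for t s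
  have [measurable]: "case_prod F \<in> borel_measurable borel"
    unfolding borel_prod[symmetric] F_def by measurable
  have c: "0 \<le> c" using m by (simp add: c_def Gamma_real_nonneg)
  have "(\<integral>\<^sup>+(x::'a). \<phi> (x \<bullet> b) * ennreal (trunc_pow m (norm x)) \<partial>lborel)
      = (\<integral>\<^sup>+(x::'a). F (x \<bullet> b) ((norm x)\<^sup>2 - (x \<bullet> b)\<^sup>2) \<partial>lborel)"
    by (simp add: F_def trunc_pow_def)
  also have "\<dots> = (\<integral>\<^sup>+t. (\<integral>\<^sup>+s. F t s * ennreal (sq_density k s) \<partial>lborel) \<partial>lborel)"
    by (rule nn_integral_cylinder[OF b dim k]) measurable
  also have "\<dots> = (\<integral>\<^sup>+t. \<phi> t * ennreal (c * trunc_pow (m + real k) t) \<partial>lborel)"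
  proof (intro nn_integral_cong)
    fix t :: real
    have "(\<integral>\<^sup>+s. F t s * ennreal (sq_density k s) \<partial>lborel)
        = \<phi> t * (\<integral>\<^sup>+s. ennreal ((max 0 (1 - t\<^sup>2 - s)) powr m) * ennreal (sq_density k s) \<partial>lborel)"
      by (subst nn_integral_cmult[symmetric]) (auto simp: F_def mult.assoc)
    also have "\<dots> = \<phi> t * ennreal (c * trunc_pow (m + real k) t)"
      by (simp only: nn_integral_Beta_sq_density[OF k m] trunc_pow_def c_def)
    finally show "(\<integral>\<^sup>+s. F t s * ennreal (sq_density k s) \<partial>lborel) = \<phi> t * ennreal (c * trunc_pow (m + real k) t)" .
  qed
  also have "\<dots> = (\<integral>\<^sup>+t. ennreal c * (\<phi> t * ennreal (trunc_pow (m + real k) t)) \<partial>lborel)"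
    using c by (intro nn_integral_cong) (simp add: ennreal_mult' mult_ac)
  also have "\<dots> = ennreal c * (\<integral>\<^sup>+t. \<phi> t * ennreal (trunc_pow (m + real k) t) \<partial>lborel)"
    by (rule nn_integral_cmult) measurable
  finally show ?thesis by (simp add: c_def)
qed

section \<open>The Wu function as a self-convolution\<close>

text \<open>Repeated tail integration in the squared radius. The tails over all of
  \<open>{s..}\<close> are cut at 4, beyond which the profile of a self-convolution
  vanishes.\<close>

fun iter_int :: "(real \<Rightarrow> real) \<Rightarrow> nat \<Rightarrow> real \<Rightarrow> real" where
  "iter_int V 0 = V"
| "iter_int V (Suc j) = (\<lambda>s. integral {s..4} (iter_int V j))"

lemma has_derivative_tail_integral:
  fixes F :: "real \<Rightarrow> real"
  assumes F: "continuous_on UNIV F" and z: "\<And>s. c \<le> s \<Longrightarrow> F s = 0"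
  shows "((\<lambda>s. integral {s..c} F) has_real_derivative - F s) (at s)"
proof -
  \<comment> \<open>The upper limit is moved past both \<open>s\<close> and \<open>c\<close>, so
    that \<open>s\<close> is interior even when \<open>c \<le> s\<close>; beyond \<open>c\<close>
    nothing is added.\<close>
  define T where "T = max s c + 1"
  have eq: "integral {u..T} F = integral {u..c} F" if "u \<le> T" for u
  proof (cases "u \<le> c")
    case True
    have "integral {u..c} F + integral {c..T} F = integral {u..T} F"
      using True by (intro Henstock_Kurzweil_Integration.integral_combine integrable_continuous_interval
          continuous_on_subset[OF F]) (auto simp: T_def)
    moreover have "integral {c..T} F = 0"
      by (rule integral_unique[OF has_integral_is_0]) (auto simp: z)
    ultimately show ?thesis by simp
  next
    case False
    moreover have "integral {u..T} F = 0"
      using False by (intro integral_unique[OF has_integral_is_0]) (auto simp: z)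
    ultimately show ?thesis by simp
  qed
  have "((\<lambda>u. integral {u..T} F) has_vector_derivative - F s) (at s within {s - 1..T})"
    by (rule integral_has_vector_derivative'[OF continuous_on_subset[OF F]]) (auto simp: T_def)
  moreover have "at s within {s - 1..T} = at s" by (rule at_within_interior) (auto simp: T_def)
  ultimately have "((\<lambda>u. integral {u..T} F) has_real_derivative - F s) (at s)"
    by (simp add: has_real_derivative_iff_has_vector_derivative)
  moreover have "\<forall>\<^sub>F u in nhds s. u < T"
    by (rule order_tendstoD(2)[OF filterlim_ident]) (simp add: T_def)
  then have "\<forall>\<^sub>F u in nhds s. integral {u..T} F = integral {u..c} F"
    by eventually_elim (auto intro: eq)
  ultimately show ?thesis
    by (subst DERIV_cong_ev[OF refl _ refl, symmetric])
qed

lemma iter_int_props: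
  assumes V: "continuous_on UNIV V" "\<And>s. 4 \<le> s \<Longrightarrow> V s = 0" "\<And>s. 0 \<le> V s"
  shows "continuous_on UNIV (iter_int V j)" "\<And>s. 4 \<le> s \<Longrightarrow> iter_int V j s = 0" "\<And>s. 0 \<le> iter_int V j s"
    "(iter_int V (Suc j) has_real_derivative - iter_int V j s) (at s)"
proof -
  have *: "continuous_on UNIV (iter_int V j) \<and> (\<forall>s\<ge>4. iter_int V j s = 0) \<and> (\<forall>s. 0 \<le> iter_int V j s)" for j
  proof (induction j)
    case (Suc j)
    have D: "(iter_int V (Suc j) has_real_derivative - iter_int V j s) (at s)" for s
      unfolding iter_int.simps by (rule has_derivative_tail_integral) (use Suc in auto)
    then have "continuous_on UNIV (iter_int V (Suc j))"
      by (meson DERIV_isCont continuous_at_imp_continuous_on)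
    moreover have "iter_int V (Suc j) s = 0" if "4 \<le> s" for s
      using that by (cases "s = 4") auto
    moreover have "0 \<le> iter_int V (Suc j) s" for s
      using Suc by (auto intro!: integral_nonneg integrable_continuous_interval intro: continuous_on_subset)
    ultimately show ?case by blast
  qed (use V in auto)
  then show c: "continuous_on UNIV (iter_int V j)" and z: "\<And>s. 4 \<le> s \<Longrightarrow> iter_int V j s = 0"
    and "\<And>s. 0 \<le> iter_int V j s" by blast+
  show "(iter_int V (Suc j) has_real_derivative - iter_int V j s) (at s)"
    unfolding iter_int.simps by (rule has_derivative_tail_integral[OF c z])
qed

text \<open>Cauchy's kernel for \<open>Suc j\<close> successive integrations. For
  \<open>j = k - 1\<close> it is \<open>sq_density k\<close> up to \<open>pi ^ k\<close>, which is
  how marginals become repeated integrals.\<close>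

definition pow_kernel :: "nat \<Rightarrow> real \<Rightarrow> real" where
  "pow_kernel j s = (if 0 < s then s ^ j / fact j else 0)"

lemma pow_kernel_nonneg: "0 \<le> pow_kernel j s"
  by (simp add: pow_kernel_def)

lemma borel_measurable_pow_kernel [measurable]: "pow_kernel j \<in> borel_measurable borel"
  unfolding pow_kernel_def by measurable

lemma sq_density_eq: "sq_density k s = pi ^ k * pow_kernel (k - 1) s"
  by (simp add: sq_density_def pow_kernel_def)

text \<open>Convolution with the unit step \<open>pow_kernel 0\<close> is one integration, so this
  is the inductive step of Cauchy's formula.\<close>

lemma pow_kernel_convolution:
  "(\<integral>\<^sup>+s. ennreal (pow_kernel 0 s) * ennreal (pow_kernel j (u - s)) \<partial>lborel) = ennreal (pow_kernel (Suc j) u)"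
proof (cases "0 < u")
  case False
  then have "ennreal (pow_kernel 0 s) * ennreal (pow_kernel j (u - s)) = 0" for s
    by (auto simp: pow_kernel_def)
  then show ?thesis using False by (simp only: nn_integral_const) (simp add: pow_kernel_def)
next
  case True
  have "(\<integral>\<^sup>+s. ennreal (pow_kernel 0 s) * ennreal (pow_kernel j (u - s)) \<partial>lborel)
      = (\<integral>\<^sup>+s. ennreal ((u - s) ^ j / fact j) * indicator {0..u} s \<partial>lborel)"
  proof (rule nn_integral_cong_AE)
    show "AE s in lborel. ennreal (pow_kernel 0 s) * ennreal (pow_kernel j (u - s))
        = ennreal ((u - s) ^ j / fact j) * indicator {0..u} s"
      using AE_lborel_singleton[of 0] AE_lborel_singleton[of u]
      by eventually_elim (auto simp: pow_kernel_def indicator_def)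
  qed
  also have "\<dots> = ennreal (- ((u - u) ^ Suc j / fact (Suc j)) - - ((u - 0) ^ Suc j / fact (Suc j)))"
  proof (rule nn_integral_FTC_Icc)
    fix s assume "s \<in> {0..u}"
    show "((\<lambda>s. - ((u - s) ^ Suc j / fact (Suc j))) has_real_derivative (u - s) ^ j / fact j) (at s)"
      by (rule derivative_eq_intros refl | simp add: field_simps del: of_nat_Suc)+
    show "0 \<le> (u - s) ^ j / fact j" using \<open>s \<in> {0..u}\<close> by simp
  qed (use True in auto)
  finally show ?thesis using True by (simp add: pow_kernel_def)
qed

lemma nn_integral_tail:
  assumes F: "continuous_on UNIV F" "\<And>s. 4 \<le> s \<Longrightarrow> F s = 0" "\<And>s. 0 \<le> F s"
  shows "(\<integral>\<^sup>+s. ennreal (F (a + s)) * ennreal (pow_kernel 0 s) \<partial>lborel) = ennreal (integral {a..4} F)"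
proof -
  have [measurable]: "F \<in> borel_measurable borel"
    by (rule borel_measurable_continuous_onI[OF F(1)])
  have "(\<integral>\<^sup>+s. ennreal (F (a + s)) * ennreal (pow_kernel 0 s) \<partial>lborel)
      = (\<integral>\<^sup>+s. ennreal (F (a + s)) * ennreal (pow_kernel 0 ((a + s) - a)) \<partial>lborel)" by simp
  also have "\<dots> = (\<integral>\<^sup>+u. ennreal (F u) * ennreal (pow_kernel 0 (u - a)) \<partial>lborel)"
    by (rule nn_integral_lborel_shift[where f="\<lambda>u. ennreal (F u) * ennreal (pow_kernel 0 (u - a))"]) measurable
  also have "\<dots> = (\<integral>\<^sup>+u. ennreal (indicator {a..4} u * F u) \<partial>lborel)"
  proof (rule nn_integral_cong_AE)
    show "AE u in lborel. ennreal (F u) * ennreal (pow_kernel 0 (u - a)) = ennreal (indicator {a..4} u * F u)"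
      using AE_lborel_singleton[of a] by eventually_elim (auto simp: pow_kernel_def indicator_def F(2))
  qed
  also have "\<dots> = ennreal (integral {a..4} F)"
  proof (rule nn_integral_has_integral_lebesgue)
    show "(F has_integral integral {a..4} F) {a..4}"
      by (intro integrable_integral integrable_continuous_interval continuous_on_subset[OF F(1)]) auto
  qed (use F in auto)
  finally show ?thesis .
qed

text \<open>Cauchy's formula for repeated integration. The induction writes the outermost tail
  integral with \<open>pow_kernel 0\<close>, and Fubini merges the two kernels.\<close>

lemma nn_integral_pow_kernel:
  assumes V: "continuous_on UNIV V" "\<And>s. 4 \<le> s \<Longrightarrow> V s = 0" "\<And>s. 0 \<le> V s"
  shows "(\<integral>\<^sup>+s. ennreal (V (a + s)) * ennreal (pow_kernel j s) \<partial>lborel) = ennreal (iter_int V (Suc j) a)"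
proof (induction j arbitrary: a)
  case 0
  show ?case using nn_integral_tail[OF V] by simp
next
  case (Suc j)
  have [measurable]: "V \<in> borel_measurable borel"
    by (rule borel_measurable_continuous_onI[OF V(1)])
  note I = iter_int_props[OF V, where j="Suc j"]
  have "ennreal (iter_int V (Suc (Suc j)) a)
      = (\<integral>\<^sup>+s. ennreal (iter_int V (Suc j) (a + s)) * ennreal (pow_kernel 0 s) \<partial>lborel)"
    using nn_integral_tail[OF I(1-3)] by simp
  also have "\<dots> = (\<integral>\<^sup>+s. (\<integral>\<^sup>+t. ennreal (V (a + s + t)) * ennreal (pow_kernel j t) * ennreal (pow_kernel 0 s) \<partial>lborel) \<partial>lborel)"
    by (simp add: Suc[symmetric] nn_integral_multc del: iter_int.simps)
  also have "\<dots> = (\<integral>\<^sup>+s. (\<integral>\<^sup>+t. ennreal (V (a + (s + t))) * ennreal (pow_kernel j ((s + t) - s)) * ennreal (pow_kernel 0 s) \<partial>lborel) \<partial>lborel)"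
    by (simp add: add.assoc)
  also have "\<dots> = (\<integral>\<^sup>+s. (\<integral>\<^sup>+u. ennreal (V (a + u)) * ennreal (pow_kernel j (u - s)) * ennreal (pow_kernel 0 s) \<partial>lborel) \<partial>lborel)"
    by (intro nn_integral_cong nn_integral_lborel_shift[where f="\<lambda>u. ennreal (V (a + u)) * ennreal (pow_kernel j (u - s)) * ennreal (pow_kernel 0 s)" for s]) measurable
  also have "\<dots> = (\<integral>\<^sup>+u. (\<integral>\<^sup>+s. ennreal (V (a + u)) * (ennreal (pow_kernel 0 s) * ennreal (pow_kernel j (u - s))) \<partial>lborel) \<partial>lborel)"
    by (subst lborel_pair.Fubini') (auto simp: mult_ac)
  also have "\<dots> = (\<integral>\<^sup>+u. ennreal (V (a + u)) * ennreal (pow_kernel (Suc j) u) \<partial>lborel)"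
    by (subst nn_integral_cmult) (auto simp: pow_kernel_convolution)
  finally show ?case ..
qed

section \<open>The one-dimensional convolution as a marginal of the higher-dimensional one\<close>

lemma nn_wu_conv:
  assumes "0 \<le> l"
  shows "ennreal (wu_conv l r) = (\<integral>\<^sup>+t. ennreal (trunc_pow l (r - t)) * ennreal (trunc_pow l t) \<partial>lborel)"
  using nn_tconv[OF assms, of r] trunc_pow_abs
  by (simp add: tconv_def wu_conv_def mult.commute)

lemma wu_conv_eq_tconv: "wu_conv l = tconv l"
  by (rule ext) (simp add: wu_conv_def tconv_def mult.commute)

text \<open>Both sides compute the integral of \<open>\<psi> (x \<bullet> b)\<close> against
  \<open>tconv m x\<close> over the whole space. Projection onto the axis commutes with convolution,
  which gives the left side; cylindrical coordinates and Cauchy's formula give the right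
  one.\<close>

lemma nn_integral_wu_conv:
  fixes b :: "'a::euclidean_space"
  assumes b: "b \<in> Basis" and dim: "DIM('a) = 2 * k + 1" and k: "0 < k" and m: "0 \<le> m"
    and [measurable]: "\<psi> \<in> borel_measurable borel"
  defines "c \<equiv> ennreal (pi ^ k * Gamma (m + 1) / Gamma (m + real k + 1))"
    and "V \<equiv> (\<lambda>s. tconv m (sqrt s *\<^sub>R b))"
  shows "(\<integral>\<^sup>+r. \<psi> r * (c * c * ennreal (wu_conv (m + real k) r)) \<partial>lborel)
    = (\<integral>\<^sup>+r. \<psi> r * ennreal (pi ^ k * iter_int V k (r\<^sup>2)) \<partial>lborel)"
proof -
  let ?f = "trunc_pow (m + real k)" and ?g = "\<lambda>x::'a. ennreal (trunc_pow m (norm x))"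
  have [measurable]: "tconv m \<in> borel_measurable (borel :: 'a measure)"
    using m by measurable
  have [measurable]: "wu_conv (m + real k) \<in> borel_measurable borel"
    unfolding wu_conv_eq_tconv using m by (intro borel_measurable_tconv) auto
  have Vc: "continuous_on UNIV V"
    unfolding V_def by (rule tconv_profile(1)[OF m])
  have Vz: "V s = 0" if "4 \<le> s" for s
    unfolding V_def using b that by (intro tconv_profile(2)) auto
  have V0: "0 \<le> V s" for s by (simp add: V_def tconv_nonneg)
  have [measurable]: "V \<in> borel_measurable borel"
    by (rule borel_measurable_continuous_onI[OF Vc])
  have V: "V ((norm x)\<^sup>2) = tconv m x" for x :: 'a
    unfolding V_def using b by (intro tconv_radial) auto
  have "(\<integral>\<^sup>+r. \<psi> r * (c * c * ennreal (wu_conv (m + real k) r)) \<partial>lborel)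
      = (\<integral>\<^sup>+r. (c * c) * (\<psi> r * ennreal (wu_conv (m + real k) r)) \<partial>lborel)"
    by (intro nn_integral_cong) (simp add: mult_ac)
  also have "\<dots> = c * c * (\<integral>\<^sup>+r. \<psi> r * ennreal (wu_conv (m + real k) r) \<partial>lborel)"
    by (rule nn_integral_cmult) measurable
  also have "(\<integral>\<^sup>+r. \<psi> r * ennreal (wu_conv (m + real k) r) \<partial>lborel)
      = (\<integral>\<^sup>+r. (\<integral>\<^sup>+t. \<psi> r * (ennreal (?f (r - t)) * ennreal (?f t)) \<partial>lborel) \<partial>lborel)"
    using m by (simp add: nn_wu_conv nn_integral_cmult)
  also have "\<dots> = (\<integral>\<^sup>+t. (\<integral>\<^sup>+r. \<psi> r * (ennreal (?f (r - t)) * ennreal (?f t)) \<partial>lborel) \<partial>lborel)"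
    by (rule lborel_pair.Fubini') measurable
  also have "\<dots> = (\<integral>\<^sup>+t. (\<integral>\<^sup>+r. \<psi> (t + r) * (ennreal (?f ((t + r) - t)) * ennreal (?f t)) \<partial>lborel) \<partial>lborel)"
    by (intro nn_integral_cong nn_integral_lborel_shift[symmetric, where f="\<lambda>r. \<psi> r * (ennreal (?f (r - t)) * ennreal (?f t))" for t]) measurable
  also have "\<dots> = (\<integral>\<^sup>+t. (\<integral>\<^sup>+r. \<psi> (t + r) * ennreal (?f r) \<partial>lborel) * ennreal (?f t) \<partial>lborel)"
    by (subst nn_integral_multc[symmetric]) (auto simp: mult_ac)
  also have "c * c * \<dots> = c * (\<integral>\<^sup>+t. (c * (\<integral>\<^sup>+r. \<psi> (t + r) * ennreal (?f r) \<partial>lborel)) * ennreal (?f t) \<partial>lborel)"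
    by (subst (2) mult.assoc, subst nn_integral_cmult) (auto simp: mult_ac)
  also have "\<dots> = (\<integral>\<^sup>+(y::'a). (c * (\<integral>\<^sup>+r. \<psi> (y \<bullet> b + r) * ennreal (?f r) \<partial>lborel)) * ?g y \<partial>lborel)"
    unfolding c_def by (rule nn_integral_trunc_pow_marginal[OF b dim k m, symmetric]) measurable
  also have "\<dots> = (\<integral>\<^sup>+(y::'a). (\<integral>\<^sup>+(z::'a). \<psi> (y \<bullet> b + z \<bullet> b) * ?g z \<partial>lborel) * ?g y \<partial>lborel)"
  proof (rule nn_integral_cong)
    fix y :: 'a
    have "c * (\<integral>\<^sup>+r. \<psi> (y \<bullet> b + r) * ennreal (?f r) \<partial>lborel) = (\<integral>\<^sup>+(z::'a). \<psi> (y \<bullet> b + z \<bullet> b) * ?g z \<partial>lborel)"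
      unfolding c_def by (rule nn_integral_trunc_pow_marginal[OF b dim k m, symmetric]) measurable
    then show "(c * (\<integral>\<^sup>+r. \<psi> (y \<bullet> b + r) * ennreal (?f r) \<partial>lborel)) * ?g y
        = (\<integral>\<^sup>+(z::'a). \<psi> (y \<bullet> b + z \<bullet> b) * ?g z \<partial>lborel) * ?g y" by simp
  qed
  also have "\<dots> = (\<integral>\<^sup>+(y::'a). (\<integral>\<^sup>+(z::'a). \<psi> ((y + z) \<bullet> b) * ?g ((y + z) - y) * ?g y \<partial>lborel) \<partial>lborel)"
    by (subst nn_integral_multc[symmetric]) (auto simp: inner_add_left)
  also have "\<dots> = (\<integral>\<^sup>+(y::'a). (\<integral>\<^sup>+(x::'a). \<psi> (x \<bullet> b) * ?g (x - y) * ?g y \<partial>lborel) \<partial>lborel)"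
    by (intro nn_integral_cong nn_integral_lborel_shift[where f="\<lambda>x. \<psi> (x \<bullet> b) * ?g (x - y) * ?g y" for y]) measurable
  also have "\<dots> = (\<integral>\<^sup>+(x::'a). (\<integral>\<^sup>+(y::'a). \<psi> (x \<bullet> b) * (?g (x - y) * ?g y) \<partial>lborel) \<partial>lborel)"
    by (subst lborel_pair.Fubini') (auto simp: mult_ac)
  also have "\<dots> = (\<integral>\<^sup>+(x::'a). \<psi> (x \<bullet> b) * ennreal (tconv m x) \<partial>lborel)"
    by (subst nn_integral_cmult) (auto simp: nn_tconv[OF m])
  \<comment> \<open>Splitting \<open>(norm x)^2\<close> into its axial and transverse parts exposes
    the shape that \<open>nn_integral_cylinder\<close> expects.\<close>
  also have "\<dots> = (\<integral>\<^sup>+(x::'a). \<psi> (x \<bullet> b) * ennreal (V ((x \<bullet> b)\<^sup>2 + ((norm x)\<^sup>2 - (x \<bullet> b)\<^sup>2))) \<partial>lborel)"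
    by (simp add: V)
  also have "\<dots> = (\<integral>\<^sup>+t. (\<integral>\<^sup>+s. \<psi> t * ennreal (V (t\<^sup>2 + s)) * ennreal (sq_density k s) \<partial>lborel) \<partial>lborel)"
    by (rule nn_integral_cylinder[OF b dim k]) (unfold borel_prod[symmetric], measurable)
  also have "\<dots> = (\<integral>\<^sup>+t. \<psi> t * ennreal (pi ^ k * iter_int V k (t\<^sup>2)) \<partial>lborel)"
  proof (intro nn_integral_cong)
    fix t :: real
    have "(\<integral>\<^sup>+s. \<psi> t * ennreal (V (t\<^sup>2 + s)) * ennreal (sq_density k s) \<partial>lborel)
        = (\<integral>\<^sup>+s. (\<psi> t * ennreal (pi ^ k)) * (ennreal (V (t\<^sup>2 + s)) * ennreal (pow_kernel (k - 1) s)) \<partial>lborel)"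
      by (intro nn_integral_cong) (simp add: sq_density_eq ennreal_mult' pow_kernel_nonneg mult_ac)
    also have "\<dots> = (\<psi> t * ennreal (pi ^ k)) * ennreal (iter_int V (Suc (k - 1)) (t\<^sup>2))"
      by (subst nn_integral_cmult) (auto simp: nn_integral_pow_kernel[OF Vc Vz V0] simp del: iter_int.simps)
    also have "\<dots> = \<psi> t * ennreal (pi ^ k * iter_int V k (t\<^sup>2))"
      using k by (simp add: ennreal_mult' mult_ac)
    finally show "(\<integral>\<^sup>+s. \<psi> t * ennreal (V (t\<^sup>2 + s)) * ennreal (sq_density k s) \<partial>lborel)
        = \<psi> t * ennreal (pi ^ k * iter_int V k (t\<^sup>2))" .
  qed
  finally show ?thesis .
qed

text \<open>Testing \<open>nn_integral_wu_conv\<close> on indicators identifies two densities, hence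
  gives equality almost everywhere. Both sides are continuous, so the set of agreement is closed and
  of full measure, that is, everything; equality at every point is what allows differentiation
  later.\<close>

lemma wu_conv_eq_iter_int:
  fixes b :: "'a::euclidean_space"
  assumes b: "b \<in> Basis" and dim: "DIM('a) = 2 * k + 1" and m: "0 \<le> m"
  shows "(pi ^ k * Gamma (m + 1) / Gamma (m + real k + 1))\<^sup>2 * wu_conv (m + real k) r
    = pi ^ k * iter_int (\<lambda>s. tconv m (sqrt s *\<^sub>R b)) k (r\<^sup>2)"
proof (cases "k = 0")
  case True
  \<comment> \<open>With \<open>k = 0\<close> nothing is integrated out; it remains to identify the
    one-dimensional space with the reals through its only coordinate.\<close>
  let ?f = "trunc_pow m"
  have "(\<integral>\<^sup>+(y::'a). ennreal (?f (norm (sqrt (r\<^sup>2) *\<^sub>R b - y)) * ?f (norm y)) \<partial>lborel)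
      = (\<integral>\<^sup>+(y::'a). ennreal (?f (\<bar>r\<bar> - y \<bullet> b) * ?f (y \<bullet> b)) \<partial>lborel)"
  proof (intro nn_integral_cong)
    fix y :: 'a
    have B: "Basis = {b}" using b dim True by (metis card_1_singletonE singletonD mult_0_right add_0)
    have n: "norm z = \<bar>z \<bullet> b\<bar>" for z :: 'a
      using euclidean_representation[of z] b by (subst (asm) B) (metis norm_Basis norm_scaleR mult.right_neutral sum.empty sum.insert finite.emptyI empty_iff add_0_right)
    show "ennreal (?f (norm (sqrt (r\<^sup>2) *\<^sub>R b - y)) * ?f (norm y)) = ennreal (?f (\<bar>r\<bar> - y \<bullet> b) * ?f (y \<bullet> b))"
      using b by (simp add: n inner_diff_left)
  qed
  also have "\<dots> = (\<integral>\<^sup>+t. ennreal (?f (\<bar>r\<bar> - t) * ?f t) \<partial>lborel)"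
    using dim True by (intro nn_integral_cylinder_0[OF b]) auto
  finally have "ennreal (tconv m (sqrt (r\<^sup>2) *\<^sub>R b)) = ennreal (tconv m \<bar>r\<bar>)"
    by (simp add: nn_tconv[OF m] ennreal_mult'[symmetric])
  then have "tconv m (sqrt (r\<^sup>2) *\<^sub>R b) = tconv m \<bar>r\<bar>"
    by (simp add: tconv_nonneg)
  also have "\<dots> = tconv m r"
    by (rule tconv_radial) simp
  finally have "tconv m (sqrt (r\<^sup>2) *\<^sub>R b) = tconv m r" .
  moreover have "0 < Gamma (m + 1)" using m by (intro Gamma_real_pos) auto
  ultimately show ?thesis
    using True by (simp add: wu_conv_eq_tconv)
next
  case False
  then have k: "0 < k" by simp
  define c where "c = pi ^ k * Gamma (m + 1) / Gamma (m + real k + 1)"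
  define V where "V = (\<lambda>s. tconv m (sqrt s *\<^sub>R b))"
  have c: "0 \<le> c" using m by (simp add: c_def Gamma_real_nonneg)
  have Vc: "continuous_on UNIV V"
    unfolding V_def by (rule tconv_profile(1)[OF m])
  have Vz: "V s = 0" if "4 \<le> s" for s
    unfolding V_def using b that by (intro tconv_profile(2)) auto
  have V0: "0 \<le> V s" for s by (simp add: V_def tconv_nonneg)
  note I = iter_int_props[OF Vc Vz V0, where j=k]
  let ?A = "\<lambda>r. c\<^sup>2 * wu_conv (m + real k) r" and ?B = "\<lambda>r. pi ^ k * iter_int V k (r\<^sup>2)"
  have contA: "continuous_on UNIV ?A"
    unfolding wu_conv_eq_tconv using m by (intro continuous_intros continuous_tconv) auto
  have contB: "continuous_on UNIV ?B"
    by (intro continuous_intros continuous_on_compose2[OF I(1)]) auto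
  have [measurable]: "?A \<in> borel_measurable borel" "?B \<in> borel_measurable borel"
    using contA contB by (auto intro: borel_measurable_continuous_onI)
  have "density lborel (\<lambda>r. ennreal (?A r)) = density lborel (\<lambda>r. ennreal (?B r))"
  proof (rule measure_eqI)
    fix S assume "S \<in> sets (density lborel (\<lambda>r. ennreal (?A r)))"
    then have [measurable]: "S \<in> sets borel" by simp
    have [measurable]: "wu_conv (m + real k) \<in> borel_measurable borel"
      unfolding wu_conv_eq_tconv using m by (intro borel_measurable_tconv) auto
    have A: "ennreal (?A r) = ennreal c * ennreal c * ennreal (wu_conv (m + real k) r)" for r
      using c by (simp add: ennreal_mult' power2_eq_square)
    have "emeasure (density lborel (\<lambda>r. ennreal (?A r))) S
        = (\<integral>\<^sup>+r. indicator S r * (ennreal c * ennreal c * ennreal (wu_conv (m + real k) r)) \<partial>lborel)"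
      by (subst emeasure_density) (simp_all add: A mult.commute[of _ "indicator S _"])
    also have "\<dots> = (\<integral>\<^sup>+r. indicator S r * ennreal (?B r) \<partial>lborel)"
      unfolding c_def V_def by (rule nn_integral_wu_conv[OF b dim k m]) measurable
    also have "\<dots> = emeasure (density lborel (\<lambda>r. ennreal (?B r))) S"
      by (subst emeasure_density) (simp_all add: mult.commute[of _ "indicator S _"])
    finally show "emeasure (density lborel (\<lambda>r. ennreal (?A r))) S = emeasure (density lborel (\<lambda>r. ennreal (?B r))) S" .
  qed simp
  then have "AE r in lborel. ennreal (?A r) = ennreal (?B r)"
    by (intro sigma_finite_measure.density_unique[OF sigma_finite_lborel]) auto
  then have "AE r in lborel. r \<in> {r. ?A r = ?B r}"
    by eventually_elim (auto simp: wu_conv_eq_tconv tconv_nonneg I(3))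
  moreover have "closed {r. ?A r = ?B r}"
    using contA contB by (intro closed_Collect_eq)
  ultimately have "r \<in> {r. ?A r = ?B r}"
    by (intro mem_closed_if_AE_lebesgue) (auto simp: AE_completion_iff)
  then show ?thesis by (simp add: c_def V_def)
qed

text \<open>On a function of \<open>r^2\<close>, \<open>wu_D\<close> is -2 times the derivative in
  \<open>r^2\<close>: the factor \<open>1 / r\<close> cancels the inner derivative. Each application
  strips one tail integral, and its minus sign cancels that of the derivative of the tail.\<close>

lemma wu_D_iterate:
  assumes V: "continuous_on UNIV V" "\<And>s. 4 \<le> s \<Longrightarrow> V s = 0" "\<And>s. 0 \<le> V s"
    and w: "\<And>r. w r = C * iter_int V k (r\<^sup>2)"
    and "j \<le> k" "0 < r"
  shows "(wu_D ^^ j) w r = C * 2 ^ j * iter_int V (k - j) (r\<^sup>2)"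
  using \<open>j \<le> k\<close> \<open>0 < r\<close>
proof (induction j arbitrary: r)
  case 0
  then show ?case by (simp add: w)
next
  case (Suc j)
  let ?g = "\<lambda>r. C * 2 ^ j * iter_int V (k - j) (r\<^sup>2)"
  have kj: "k - j = Suc (k - Suc j)" using Suc.prems by simp
  have D: "(iter_int V (k - j) has_real_derivative - iter_int V (k - Suc j) s) (at s)" for s
    unfolding kj by (rule iter_int_props(4)[OF V])
  have "((\<lambda>r. iter_int V (k - j) (r\<^sup>2)) has_real_derivative - iter_int V (k - Suc j) (r\<^sup>2) * (2 * r)) (at r)"
    by (rule DERIV_chain2[OF D]) (auto intro!: derivative_eq_intros)
  then have "(?g has_real_derivative C * 2 ^ j * (- iter_int V (k - Suc j) (r\<^sup>2) * (2 * r))) (at r)"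
    by (rule DERIV_cmult)
  then have g: "deriv ?g r = C * 2 ^ j * (- iter_int V (k - Suc j) (r\<^sup>2) * (2 * r))"
    by (rule DERIV_imp_deriv)
  \<comment> \<open>\<open>deriv\<close> depends on a neighbourhood of \<open>r\<close>, and the
    closed form of the previous iterate is available at all positive points, hence on such a
    neighbourhood.\<close>
  have "\<forall>\<^sub>F x in nhds r. 0 < x"
    using Suc.prems by (intro order_tendstoD(1)[OF filterlim_ident])
  then have "\<forall>\<^sub>F x in nhds r. (wu_D ^^ j) w x = ?g x"
    by eventually_elim (use Suc in auto)
  then have "deriv ((wu_D ^^ j) w) r = deriv ?g r"
    by (rule deriv_cong_ev) simp
  then show ?case
    using Suc.prems by (simp add: wu_D_def[of "(wu_D ^^ j) w"] g)
qed

definition wu_const :: "real \<Rightarrow> nat \<Rightarrow> real" where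
  "wu_const l k = Gamma (l + 1) / Gamma (l - real k + 1) * (2 / pi) powr (real k / 2)"

lemma wu_P_eq: "wu_P l k x = wu_const l k * trunc_pow (l - real k) (norm x)"
  by (simp add: wu_P_def wu_const_def)

lemma wu_const_pos: "real k \<le> l \<Longrightarrow> 0 < wu_const l k"
  unfolding wu_const_def by (intro mult_pos_pos divide_pos_pos Gamma_real_pos) auto

lemma wu_fun_eq_tconv:
  fixes x :: "'a::euclidean_space"
  assumes l: "real k \<le> l" and dim: "DIM('a) = 2 * k + 1"
  shows "wu_fun l k (norm x) = (wu_const l k)\<^sup>2 * tconv (l - real k) x"
proof -
  define m where "m = l - real k"
  have m: "0 \<le> m" and lm: "l = m + real k" using l by (auto simp: m_def)
  obtain b :: 'a where b: "b \<in> Basis" using nonempty_Basis by blast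
  define V where "V = (\<lambda>s. tconv m (sqrt s *\<^sub>R b))"
  have Vc: "continuous_on UNIV V"
    unfolding V_def by (rule tconv_profile(1)[OF m])
  have Vz: "V s = 0" if "4 \<le> s" for s
    unfolding V_def using b that by (intro tconv_profile(2)) auto
  have V0: "0 \<le> V s" for s by (simp add: V_def tconv_nonneg)
  define G where "G = Gamma (m + 1) / Gamma (l + 1)"
  have G: "0 < G" unfolding G_def using m lm by (intro divide_pos_pos Gamma_real_pos) auto
  have "(pi ^ k * G)\<^sup>2 * wu_conv l r = pi ^ k * iter_int V k (r\<^sup>2)" for r
    using wu_conv_eq_iter_int[OF b dim m, of r] by (simp add: G_def V_def lm)
  then have w: "wu_conv l r = 1 / (pi ^ k * G\<^sup>2) * iter_int V k (r\<^sup>2)" for r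
    using G by (simp add: field_simps power2_eq_square)
  \<comment> \<open>\<open>1 / (pi ^ k * G^2)\<close> is the factor \<open>pi ^ k\<close> of the
    marginal divided by the square of the projection constant \<open>pi ^ k * G\<close>;
    \<open>2 ^ k\<close> comes from the \<open>k\<close> derivatives.\<close>
  have const: "1 / (pi ^ k * G\<^sup>2) * 2 ^ k = (wu_const l k)\<^sup>2"
  proof -
    have "((2 / pi) powr (real k / 2))\<^sup>2 = (2 / pi) ^ k"
      by (simp add: powr_realpow[symmetric] powr_powr)
    then show ?thesis
      by (simp add: wu_const_def G_def m_def power_mult_distrib power_divide)
  qed
  have D: "(wu_D ^^ k) (wu_conv l) r = (wu_const l k)\<^sup>2 * tconv m (r *\<^sub>R b)" if "0 < r" for r
  proof -
    have "(wu_D ^^ k) (wu_conv l) r = (1 / (pi ^ k * G\<^sup>2) * 2 ^ k) * tconv m (r *\<^sub>R b)"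
      using wu_D_iterate[OF Vc Vz V0 w order.refl that] that by (simp add: V_def)
    then show ?thesis unfolding const .
  qed
  show ?thesis
  proof (cases "x = 0")
    case False
    then show ?thesis
      using D[of "norm x"] b tconv_radial[of "norm x *\<^sub>R b" x m] by (simp add: wu_fun_def m_def)
  next
    case True
    \<comment> \<open>At the origin \<open>wu_fun\<close> is a right limit, which the continuity of
      \<open>tconv\<close> identifies.\<close>
    have "((\<lambda>r. (wu_const l k)\<^sup>2 * tconv m (r *\<^sub>R b)) \<longlongrightarrow> (wu_const l k)\<^sup>2 * tconv m (0 *\<^sub>R b)) (at_right 0)"
      using continuous_tconv[OF m, where 'a='a]
      by (intro tendsto_intros isCont_tendsto_compose[where g="tconv m"]) (auto simp: continuous_on_eq_continuous_at)
    moreover have "\<forall>\<^sub>F r in at_right 0. (wu_const l k)\<^sup>2 * tconv m (r *\<^sub>R b) = (wu_D ^^ k) (wu_conv l) r"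
      using D by (auto simp: eventually_at_filter)
    ultimately have "((wu_D ^^ k) (wu_conv l) \<longlongrightarrow> (wu_const l k)\<^sup>2 * tconv m (0::'a)) (at_right 0)"
      by (auto dest: Lim_transform_eventually)
    then have "Lim (at_right 0) ((wu_D ^^ k) (wu_conv l)) = (wu_const l k)\<^sup>2 * tconv m (0::'a)"
      by (intro tendsto_Lim) auto
    then show ?thesis using True by (simp add: wu_fun_def m_def)
  qed
qed

section \<open>Uniqueness of the reproducing kernel Hilbert space\<close>

text \<open>The left side is linear in \<open>t\<close> and the right side quadratic, so small
  \<open>t\<close> of the sign of \<open>u\<close> decide. The test value \<open>u / (c + 1)\<close>
  remains defined for \<open>c = 0\<close>.\<close>

lemma quadratic_bound_imp_zero:
  fixes u c :: real
  assumes "0 \<le> c" "\<And>t. 2 * t * u \<le> t\<^sup>2 * c"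
  shows "u = 0"
proof -
  define w where "w = u / (c + 1)"
  have u: "u = w * (c + 1)" using assms(1) by (simp add: w_def)
  have "w\<^sup>2 * (c + 2) \<le> 0"
    using assms(2)[of w] by (simp add: u power2_eq_square algebra_simps)
  then have "w\<^sup>2 \<le> 0" using assms(1) by (simp add: mult_le_0_iff)
  then show ?thesis by (simp add: u)
qed

locale hilbert_functions =
  fixes H :: "('a \<Rightarrow> real) set" and ip :: "('a \<Rightarrow> real) \<Rightarrow> ('a \<Rightarrow> real) \<Rightarrow> real"
  assumes hilbert: "hilbert_fun_space H ip"
begin

lemma zero_mem: "(\<lambda>x. 0) \<in> H"
  and add_mem: "f \<in> H \<Longrightarrow> g \<in> H \<Longrightarrow> (\<lambda>x. f x + g x) \<in> H"
  and scale_mem: "f \<in> H \<Longrightarrow> (\<lambda>x. c * f x) \<in> H"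
  and ip_commute: "f \<in> H \<Longrightarrow> g \<in> H \<Longrightarrow> ip f g = ip g f"
  and ip_add_left: "f \<in> H \<Longrightarrow> g \<in> H \<Longrightarrow> h \<in> H \<Longrightarrow> ip (\<lambda>x. f x + g x) h = ip f h + ip g h"
  and ip_scale_left: "f \<in> H \<Longrightarrow> g \<in> H \<Longrightarrow> ip (\<lambda>x. c * f x) g = c * ip f g"
  and ip_nonneg: "f \<in> H \<Longrightarrow> 0 \<le> ip f f"
  and ip_definite: "f \<in> H \<Longrightarrow> ip f f = 0 \<Longrightarrow> f = (\<lambda>x. 0)"
  using hilbert unfolding hilbert_fun_space_def by blast+

lemma complete: "(\<And>n. s n \<in> H) \<Longrightarrow>
        (\<And>e. 0 < e \<Longrightarrow> \<exists>N. \<forall>m\<ge>N. \<forall>n\<ge>N. sqrt (ip (\<lambda>x. s m x - s n x) (\<lambda>x. s m x - s n x)) < e) \<Longrightarrow>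
        \<exists>f\<in>H. (\<lambda>n. sqrt (ip (\<lambda>x. s n x - f x) (\<lambda>x. s n x - f x))) \<longlonglongrightarrow> 0"
  using hilbert unfolding hilbert_fun_space_def by blast

lemma lin_mem: "f \<in> H \<Longrightarrow> g \<in> H \<Longrightarrow> (\<lambda>x. f x + c * g x) \<in> H"
  by (rule add_mem[OF _ scale_mem])

lemma diff_mem: "f \<in> H \<Longrightarrow> g \<in> H \<Longrightarrow> (\<lambda>x. f x - g x) \<in> H"
  using lin_mem[of f g "-1"] by simp

lemma ip_lin_left:
  "f \<in> H \<Longrightarrow> g \<in> H \<Longrightarrow> h \<in> H \<Longrightarrow> ip (\<lambda>x. f x + c * g x) h = ip f h + c * ip g h"
  by (simp add: ip_add_left scale_mem ip_scale_left)

lemma ip_lin_right: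
  "f \<in> H \<Longrightarrow> g \<in> H \<Longrightarrow> h \<in> H \<Longrightarrow> ip h (\<lambda>x. f x + c * g x) = ip h f + c * ip h g"
  by (simp add: ip_commute[of h] lin_mem ip_lin_left)

lemma ip_lin_self:
  "f \<in> H \<Longrightarrow> g \<in> H \<Longrightarrow>
    ip (\<lambda>x. f x + c * g x) (\<lambda>x. f x + c * g x) = ip f f + 2 * c * ip f g + c\<^sup>2 * ip g g"
  by (simp add: ip_lin_left ip_lin_right lin_mem ip_commute[of g f] power2_eq_square algebra_simps)

lemma ip_diff_self:
  "f \<in> H \<Longrightarrow> g \<in> H \<Longrightarrow> ip (\<lambda>x. f x - g x) (\<lambda>x. f x - g x) = ip f f - 2 * ip f g + ip g g"
  using ip_lin_self[of f g "-1"] by simp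

lemma Cauchy_Schwarz:
  assumes "f \<in> H" "g \<in> H"
  shows "\<bar>ip f g\<bar> \<le> sqrt (ip f f) * sqrt (ip g g)"
proof (cases "ip g g = 0")
  case True
  then have g: "g = (\<lambda>x. 0)" using assms ip_definite by blast
  have "ip g f = 0 * ip g f"
    using ip_scale_left[of g f 0] assms by (simp add: g)
  then show ?thesis using assms True by (simp add: ip_commute[of f g])
next
  case False
  then have pos: "0 < ip g g" using ip_nonneg[OF assms(2)] by simp
  define t where "t = ip f g / ip g g"
  have "0 \<le> ip (\<lambda>x. f x + (- t) * g x) (\<lambda>x. f x + (- t) * g x)"
    by (rule ip_nonneg[OF lin_mem[OF assms]])
  also have "\<dots> = ip f f - (ip f g)\<^sup>2 / ip g g"
    unfolding ip_lin_self[OF assms] using pos by (simp add: t_def power2_eq_square)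
  finally have "(ip f g)\<^sup>2 \<le> ip f f * ip g g"
    using pos by (simp add: pos_divide_le_eq)
  then have "sqrt ((ip f g)\<^sup>2) \<le> sqrt (ip f f * ip g g)"
    by (rule real_sqrt_le_mono)
  then show ?thesis by (simp add: real_sqrt_mult)
qed

lemma ip_self_tendsto:
  assumes s: "\<And>n. s n \<in> H" and f: "f \<in> H"
    and lim: "(\<lambda>n. sqrt (ip (\<lambda>x. s n x - f x) (\<lambda>x. s n x - f x))) \<longlonglongrightarrow> 0"
  shows "(\<lambda>n. ip (s n) (s n)) \<longlonglongrightarrow> ip f f"
proof -
  let ?d = "\<lambda>n x. s n x - f x"
  have d: "?d n \<in> H" for n using s f by (intro diff_mem)
  have "(\<lambda>n. ip (?d n) f) \<longlonglongrightarrow> 0"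
  proof (rule Lim_null_comparison)
    show "\<forall>\<^sub>F n in sequentially. norm (ip (?d n) f) \<le> sqrt (ip (?d n) (?d n)) * sqrt (ip f f)"
      using Cauchy_Schwarz[OF d f] by simp
    show "(\<lambda>n. sqrt (ip (?d n) (?d n)) * sqrt (ip f f)) \<longlonglongrightarrow> 0"
      using lim by (rule tendsto_mult_left_zero)
  qed
  moreover have "(\<lambda>n. (sqrt (ip (?d n) (?d n)))\<^sup>2) \<longlonglongrightarrow> 0\<^sup>2"
    by (intro tendsto_intros lim)
  ultimately have "(\<lambda>n. (sqrt (ip (?d n) (?d n)))\<^sup>2 + 2 * ip (?d n) f + ip f f) \<longlonglongrightarrow> 0\<^sup>2 + 2 * 0 + ip f f"
    by (intro tendsto_add tendsto_mult tendsto_const)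
  moreover have "(sqrt (ip (?d n) (?d n)))\<^sup>2 + 2 * ip (?d n) f + ip f f = ip (s n) (s n)" for n
    using ip_lin_self[OF d[of n] f, of 1] ip_nonneg[OF d[of n]] by simp
  ultimately show ?thesis by simp
qed

end

text \<open>Linear combinations are built by adding one multiple of a kernel section at a time, so
  that statements about the whole span, such as agreement of two inner products, go by
  induction.\<close>

inductive_set kernel_span :: "('b \<Rightarrow> 'a \<Rightarrow> real) \<Rightarrow> ('a \<Rightarrow> real) set" for K where
  zero: "(\<lambda>x. 0) \<in> kernel_span K"
| lin: "f \<in> kernel_span K \<Longrightarrow> (\<lambda>x. f x + c * K y x) \<in> kernel_span K"

lemma kernel_span_lin:
  assumes "f \<in> kernel_span K" "g \<in> kernel_span K"
  shows "(\<lambda>x. f x + c * g x) \<in> kernel_span K"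
  using assms(2)
proof (induction rule: kernel_span.induct)
  case zero
  then show ?case using assms(1) by simp
next
  case (lin g d y)
  from kernel_span.lin[OF lin.IH, of "c * d" y] show ?case
    by (simp add: algebra_simps)
qed

locale rkhs = hilbert_functions H ip
  for H :: "('a \<Rightarrow> real) set" and ip +
  fixes K :: "'a \<Rightarrow> 'a \<Rightarrow> real"
  assumes K_mem: "K y \<in> H" and reproducing: "f \<in> H \<Longrightarrow> ip f (K y) = f y"
begin

lemma kernel_span_subset: "f \<in> kernel_span K \<Longrightarrow> f \<in> H"
  by (induction rule: kernel_span.induct) (auto intro: zero_mem lin_mem K_mem)

lemma pointwise_limit:
  assumes s: "\<And>n. s n \<in> H" and f: "f \<in> H"
    and lim: "(\<lambda>n. sqrt (ip (\<lambda>x. s n x - f x) (\<lambda>x. s n x - f x))) \<longlonglongrightarrow> 0"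
  shows "(\<lambda>n. s n y) \<longlonglongrightarrow> f y"
proof -
  let ?d = "\<lambda>n x. s n x - f x"
  have d: "?d n \<in> H" for n using s f by (intro diff_mem)
  have "(\<lambda>n. s n y - f y) \<longlonglongrightarrow> 0"
  proof (rule Lim_null_comparison)
    show "\<forall>\<^sub>F n in sequentially. norm (s n y - f y) \<le> sqrt (ip (?d n) (?d n)) * sqrt (ip (K y) (K y))"
      using Cauchy_Schwarz[OF d K_mem, of _ y] by (simp add: reproducing[OF d])
    show "(\<lambda>n. sqrt (ip (?d n) (?d n)) * sqrt (ip (K y) (K y))) \<longlonglongrightarrow> 0"
      using lim by (rule tendsto_mult_left_zero)
  qed
  then show ?thesis by (simp add: LIM_zero_iff)
qed

text \<open>
  A minimising sequence for the distance from \<open>f\<close> to the span is Cauchy by the parallelogram law; its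
  limit agrees with \<open>f\<close> pointwise, since perturbing by a multiple of \<open>K y\<close> cannot reduce the distance.
\<close>

lemma kernel_span_dense:
  assumes f: "f \<in> H"
  obtains s where "\<And>n. s n \<in> kernel_span K"
    "\<And>e. 0 < e \<Longrightarrow> \<exists>N. \<forall>m\<ge>N. \<forall>n\<ge>N. sqrt (ip (\<lambda>x. s m x - s n x) (\<lambda>x. s m x - s n x)) < e"
    "(\<lambda>n. sqrt (ip (\<lambda>x. s n x - f x) (\<lambda>x. s n x - f x))) \<longlonglongrightarrow> 0"
proof -
  define D where "D g = ip (\<lambda>x. f x - g x) (\<lambda>x. f x - g x)" for g
  define d where "d = Inf (D ` kernel_span K)"
  have bdd: "bdd_below (D ` kernel_span K)"
    using f kernel_span_subset by (intro bdd_belowI[of _ 0]) (auto simp: D_def intro!: ip_nonneg diff_mem)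
  have d_le: "d \<le> D g" if "g \<in> kernel_span K" for g
    unfolding d_def using that bdd by (intro cInf_lower) auto
  have "\<exists>g\<in>kernel_span K. D g < d + 1 / real (Suc n)" for n
    using cInf_lessD[of "D ` kernel_span K" "d + 1 / real (Suc n)"] kernel_span.zero[of K]
    unfolding d_def by fastforce
  then obtain s where s: "\<And>n. s n \<in> kernel_span K" and Ds: "\<And>n. D (s n) < d + 1 / real (Suc n)"
    by metis
  have sH: "s n \<in> H" for n using s kernel_span_subset by blast
  have par: "ip (\<lambda>x. s m x - s n x) (\<lambda>x. s m x - s n x) \<le> 2 / real (Suc m) + 2 / real (Suc n)" for m n
  proof -
    \<comment> \<open>The midpoint of \<open>s m\<close> and \<open>s n\<close>, with a leading
      \<open>0 +\<close> to fit \<open>kernel_span_lin\<close>. It lies in the span, so its squared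
      distance from \<open>f\<close> is at least \<open>d\<close>.\<close>
    let ?g = "\<lambda>x. (0 + (1/2) * s m x) + (1/2) * s n x"
    have g: "?g \<in> kernel_span K"
      by (intro kernel_span_lin kernel_span.zero s)
    have "D ?g = ip (\<lambda>x. (f x + (-1/2) * s m x) + (-1/2) * s n x) (\<lambda>x. (f x + (-1/2) * s m x) + (-1/2) * s n x)"
      unfolding D_def by (simp add: algebra_simps)
    also have "\<dots> = ip f f - ip f (s m) - ip f (s n) + (ip (s m) (s m) + ip (s n) (s n) + 2 * ip (s m) (s n)) / 4"
    proof -
      let ?A = "\<lambda>x. f x + (-1/2) * s m x"
      have A: "?A \<in> H" by (intro lin_mem f sH)
      have sq: "1/4 = (-1/2 :: real)\<^sup>2" by (simp add: power2_eq_square)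
      have e1: "ip (\<lambda>x. ?A x + (-1/2) * s n x) (\<lambda>x. ?A x + (-1/2) * s n x)
          = ip ?A ?A + 2 * (-1/2) * ip ?A (s n) + 1/4 * ip (s n) (s n)"
        unfolding sq by (rule ip_lin_self[OF A sH])
      have e2: "ip ?A ?A = ip f f + 2 * (-1/2) * ip f (s m) + 1/4 * ip (s m) (s m)"
        unfolding sq by (rule ip_lin_self[OF f sH])
      have e3: "ip ?A (s n) = ip f (s n) + (-1/2) * ip (s m) (s n)"
        by (rule ip_lin_left[OF f sH sH])
      show ?thesis unfolding e1 e2 e3 by (simp add: field_simps)
    qed
    finally have Dg: "D ?g = ip f f - ip f (s m) - ip f (s n) + (ip (s m) (s m) + ip (s n) (s n) + 2 * ip (s m) (s n)) / 4" .
    have Df: "D (s n) = ip f f - 2 * ip f (s n) + ip (s n) (s n)" for n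
      unfolding D_def by (rule ip_diff_self[OF f sH])
    have "ip (\<lambda>x. s m x - s n x) (\<lambda>x. s m x - s n x) = 2 * D (s m) + 2 * D (s n) - 4 * D ?g"
      unfolding ip_diff_self[OF sH sH] Df Dg by (simp add: field_simps)
    then show ?thesis using d_le[OF g] Ds[of m] Ds[of n] by simp
  qed
  have Cauchy: "\<exists>N. \<forall>m\<ge>N. \<forall>n\<ge>N. sqrt (ip (\<lambda>x. s m x - s n x) (\<lambda>x. s m x - s n x)) < e" if "0 < e" for e
  proof -
    obtain N where N: "4 / real (Suc N) < e\<^sup>2"
    proof -
      obtain N where "4 / e\<^sup>2 < real N" using reals_Archimedean2 by blast
      then have "4 < real N * e\<^sup>2" using \<open>0 < e\<close> by (simp add: pos_divide_less_eq)
      also have "\<dots> \<le> real (Suc N) * e\<^sup>2" by (intro mult_right_mono) auto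
      finally have "4 / real (Suc N) < e\<^sup>2" by (simp add: pos_divide_less_eq mult.commute)
      then show ?thesis by (rule that)
    qed
    have "sqrt (ip (\<lambda>x. s m x - s n x) (\<lambda>x. s m x - s n x)) < e" if "N \<le> m" "N \<le> n" for m n
    proof -
      have "2 / real (Suc m) \<le> 2 / real (Suc N)" "2 / real (Suc n) \<le> 2 / real (Suc N)"
        using that by (auto intro!: divide_left_mono)
      then have "ip (\<lambda>x. s m x - s n x) (\<lambda>x. s m x - s n x) < e\<^sup>2"
        using par[of m n] N by simp
      then show ?thesis using \<open>0 < e\<close> by (intro real_less_lsqrt) auto
    qed
    then show ?thesis by blast
  qed
  from complete[of s, OF sH this] obtain p where p: "p \<in> H"
    and lim: "(\<lambda>n. sqrt (ip (\<lambda>x. s n x - p x) (\<lambda>x. s n x - p x))) \<longlonglongrightarrow> 0"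
    by blast
  have "p y = f y" for y
  proof -
    let ?c = "ip (K y) (K y)"
    \<comment> \<open>\<open>D (s n)\<close> exceeds the infimum \<open>d\<close> by less than
      \<open>1 / Suc n\<close>, so adding \<open>c * K y\<close> gains no more than that; the
      reproducing property turns the cross term into a value at \<open>y\<close>. The limit in
      \<open>n\<close> replaces \<open>s n\<close> by \<open>p\<close>.\<close>
    have *: "2 * c * (f y - p y) \<le> c\<^sup>2 * ?c" for c
    proof -
      have "2 * c * (f y - s n y) \<le> 1 / real (Suc n) + c\<^sup>2 * ?c" for n
      proof -
        have "d \<le> D (\<lambda>x. s n x + c * K y x)"
          by (rule d_le[OF kernel_span.lin[OF s]])
        also have "\<dots> = ip (\<lambda>x. (f x - s n x) + (- c) * K y x) (\<lambda>x. (f x - s n x) + (- c) * K y x)"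
          unfolding D_def by (simp add: algebra_simps)
        also have "\<dots> = D (s n) - 2 * c * (f y - s n y) + c\<^sup>2 * ?c"
          by (simp only: ip_lin_self[OF diff_mem[OF f sH] K_mem] reproducing[OF diff_mem[OF f sH]] D_def) simp
        finally show ?thesis using Ds[of n] by simp
      qed
      moreover have "(\<lambda>n. 2 * c * (f y - s n y)) \<longlonglongrightarrow> 2 * c * (f y - p y)"
        by (intro tendsto_intros pointwise_limit[OF sH p lim])
      moreover have "(\<lambda>n. 1 / real (Suc n) + c\<^sup>2 * ?c) \<longlonglongrightarrow> 0 + c\<^sup>2 * ?c"
        by (intro tendsto_intros LIMSEQ_Suc[OF lim_1_over_n])
      ultimately show ?thesis
        by (metis (no_types, lifting) LIMSEQ_le add_0)
    qed
    have "f y - p y = 0"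
      by (rule quadratic_bound_imp_zero[OF ip_nonneg[OF K_mem] *])
    then show ?thesis by simp
  qed
  then have "p = f" by blast
  then show ?thesis using that[of s] s Cauchy lim by blast
qed

end

text \<open>On the span of the kernel sections both inner products are dictated by \<open>K\<close>.
  A sequence of the span that approximates \<open>f\<close> in \<open>H1\<close> is therefore Cauchy
  in \<open>H2\<close> as well, and since norm convergence implies pointwise convergence in both
  spaces, the two limits are the same function. Used in both directions, this is uniqueness of the
  space and of its norm.\<close>

lemma rkhs_subset:
  assumes "rkhs H1 ip1 K" "rkhs H2 ip2 K" "f \<in> H1"
  shows "f \<in> H2 \<and> ip1 f f = ip2 f f"
proof -
  interpret A: rkhs H1 ip1 K by fact
  interpret B: rkhs H2 ip2 K by fact
  have span: "ip1 g h = ip2 g h" if "g \<in> kernel_span K" "h \<in> kernel_span K" for g h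
    using that(2)
  proof (induction rule: kernel_span.induct)
    case zero
    have "ip1 g (\<lambda>x. 0) = 0 * ip1 g g" "ip2 g (\<lambda>x. 0) = 0 * ip2 g g"
      using A.ip_lin_right[OF A.zero_mem A.zero_mem A.kernel_span_subset[OF that(1)], of 1]
        B.ip_lin_right[OF B.zero_mem B.zero_mem B.kernel_span_subset[OF that(1)], of 1] by auto
    then show ?case by simp
  next
    case (lin h c y)
    then show ?case
      using that(1) A.kernel_span_subset B.kernel_span_subset
      by (simp add: A.ip_lin_right B.ip_lin_right A.K_mem B.K_mem A.reproducing B.reproducing)
  qed
  obtain s where s: "\<And>n. s n \<in> kernel_span K"
    and C: "\<And>e. 0 < e \<Longrightarrow> \<exists>N. \<forall>m\<ge>N. \<forall>n\<ge>N. sqrt (ip1 (\<lambda>x. s m x - s n x) (\<lambda>x. s m x - s n x)) < e"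
    and lim: "(\<lambda>n. sqrt (ip1 (\<lambda>x. s n x - f x) (\<lambda>x. s n x - f x))) \<longlonglongrightarrow> 0"
    using A.kernel_span_dense[OF assms(3)] by blast
  have diff: "(\<lambda>x. s m x - s n x) \<in> kernel_span K" for m n
    using kernel_span_lin[OF s s, of m "-1" n] by simp
  have s1: "s n \<in> H1" and s2: "s n \<in> H2" for n
    using s A.kernel_span_subset B.kernel_span_subset by blast+
  from B.complete[of s, OF s2 C[unfolded span[OF diff diff]]]
  obtain f2 where f2: "f2 \<in> H2" and lim2: "(\<lambda>n. sqrt (ip2 (\<lambda>x. s n x - f2 x) (\<lambda>x. s n x - f2 x))) \<longlonglongrightarrow> 0"
    by blast
  have "f y = f2 y" for y
    using A.pointwise_limit[OF s1 assms(3) lim, of y] B.pointwise_limit[OF s2 f2 lim2, of y]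
    by (rule LIMSEQ_unique)
  then have eq: "f = f2" by blast
  have "ip1 f f = ip2 f2 f2"
    using A.ip_self_tendsto[OF s1 assms(3) lim] B.ip_self_tendsto[OF s2 f2 lim2]
    unfolding span[OF s s] by (rule LIMSEQ_unique)
  then show ?thesis using eq f2 by simp
qed

lemma native_space_iff_rkhs:
  "native_space \<Phi> H ip \<longleftrightarrow> rkhs H ip (\<lambda>y x. \<Phi> (x - y))"
  by (auto simp: native_space_def rkhs_def rkhs_axioms_def hilbert_functions_def)

section \<open>Square-integrable functions\<close>

text \<open>The measure is a parameter because \<open>L2\<close> and \<open>conv\<close> refer to
  \<open>lebesgue\<close>, whereas the Fourier arguments run over \<open>lborel\<close>.\<close>

definition square_integrable :: "'b measure \<Rightarrow> ('b \<Rightarrow> real) set" where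
  "square_integrable M = {f. f \<in> borel_measurable M \<and> integrable M (\<lambda>x. (f x)\<^sup>2)}"

lemma square_integrableD:
  "f \<in> square_integrable M \<Longrightarrow> f \<in> borel_measurable M"
  "f \<in> square_integrable M \<Longrightarrow> integrable M (\<lambda>x. (f x)\<^sup>2)"
  by (auto simp: square_integrable_def)

lemma square_integrable_mult:
  assumes "f \<in> square_integrable M" "g \<in> square_integrable M"
  shows "integrable M (\<lambda>x. f x * g x)"
proof (rule Bochner_Integration.integrable_bound)
  note [measurable] = square_integrableD(1)[OF assms(1)] square_integrableD(1)[OF assms(2)]
  show "integrable M (\<lambda>x. ((f x)\<^sup>2 + (g x)\<^sup>2) / 2)"
    using assms by (auto dest!: square_integrableD)
  show "AE x in M. norm (f x * g x) \<le> norm (((f x)\<^sup>2 + (g x)\<^sup>2) / 2)"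
  proof (rule AE_I2)
    fix x
    have "0 \<le> (\<bar>f x\<bar> - \<bar>g x\<bar>)\<^sup>2" by simp
    then show "norm (f x * g x) \<le> norm (((f x)\<^sup>2 + (g x)\<^sup>2) / 2)"
      by (simp add: power2_diff abs_mult)
  qed
  show "(\<lambda>x. f x * g x) \<in> borel_measurable M" by measurable
qed

lemma square_integrable_lin:
  assumes "f \<in> square_integrable M" "g \<in> square_integrable M"
  shows "(\<lambda>x. f x + c * g x) \<in> square_integrable M"
proof -
  note [measurable] = square_integrableD(1)[OF assms(1)] square_integrableD(1)[OF assms(2)]
  have "integrable M (\<lambda>x. (f x)\<^sup>2 + 2 * c * (f x * g x) + c\<^sup>2 * (g x)\<^sup>2)"
    using assms square_integrable_mult[OF assms] by (auto dest!: square_integrableD)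
  moreover have "(f x + c * g x)\<^sup>2 = (f x)\<^sup>2 + 2 * c * (f x * g x) + c\<^sup>2 * (g x)\<^sup>2" for x
    by (simp add: power2_eq_square algebra_simps)
  ultimately show ?thesis by (simp add: square_integrable_def)
qed

text \<open>Riesz-Fischer theorem. A subsequence with squared increments below
  \<open>(1/8)^k\<close> converges almost everywhere; Fatou's lemma then shows that its limit is the
  norm limit of the whole sequence.\<close>

lemma square_integrable_complete:
  fixes s :: "nat \<Rightarrow> 'b \<Rightarrow> real"
  assumes s: "\<And>n. s n \<in> square_integrable M"
    and C: "\<And>e. 0 < e \<Longrightarrow> \<exists>N. \<forall>m\<ge>N. \<forall>n\<ge>N. (\<integral>x. (s m x - s n x)\<^sup>2 \<partial>M) < e"
  shows "\<exists>f\<in>square_integrable M. (\<lambda>n. \<integral>x. (s n x - f x)\<^sup>2 \<partial>M) \<longlonglongrightarrow> 0"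
proof -
  note [measurable] = square_integrableD(1)[OF s]
  define E where "E m n = (\<integral>\<^sup>+x. ennreal ((s m x - s n x)\<^sup>2) \<partial>M)" for m n
  have diff: "(\<lambda>x. s m x - s n x) \<in> square_integrable M" for m n
    using square_integrable_lin[OF s s, of m "-1" n] by simp
  have E: "E m n = ennreal (\<integral>x. (s m x - s n x)\<^sup>2 \<partial>M)" for m n
    unfolding E_def by (rule nn_integral_eq_integral[OF square_integrableD(2)[OF diff]]) auto
  have "\<exists>N. \<forall>k. (\<forall>m\<ge>N k. \<forall>n\<ge>N k. (\<integral>x. (s m x - s n x)\<^sup>2 \<partial>M) < (1/8)^k)"
    by (intro choice allI C) auto
  then obtain N where N: "\<And>k m n. N k \<le> m \<Longrightarrow> N k \<le> n \<Longrightarrow> (\<integral>x. (s m x - s n x)\<^sup>2 \<partial>M) < (1/8)^k"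
    by blast
  \<comment> \<open>\<open>N\<close> itself need be neither monotone nor unbounded. Summing its
    values puts both \<open>r k\<close> and \<open>r (Suc k)\<close> above \<open>N k\<close>, and
    the summand \<open>k\<close> makes the indices tend to infinity.\<close>
  define r where "r k = k + (\<Sum>j\<le>k. N j)" for k
  have r: "N k \<le> r k" "N k \<le> r (Suc k)" "k \<le> r k" for k
  proof -
    have "N k \<le> (\<Sum>j\<le>k. N j)" by (rule member_le_sum) auto
    then show "N k \<le> r k" "N k \<le> r (Suc k)" "k \<le> r k"
      by (auto simp: r_def)
  qed
  let ?d = "\<lambda>k x. s (r (Suc k)) x - s (r k) x"
  \<comment> \<open>the weights \<open>4 ^ k\<close> make the increments summable pointwise: \<open>\<Sum>k. 4 ^ k * (d k x)\<^sup>2 < \<infinity>\<close>\<close>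
  have "(\<integral>\<^sup>+x. (\<Sum>k. ennreal (4^k * (?d k x)\<^sup>2)) \<partial>M) = (\<Sum>k. \<integral>\<^sup>+x. ennreal (4^k * (?d k x)\<^sup>2) \<partial>M)"
    by (rule nn_integral_suminf) measurable
  also have "\<dots> \<le> (\<Sum>k. ennreal ((1/2)^k))"
  proof (rule suminf_le)
    fix k
    have "(\<integral>\<^sup>+x. ennreal (4^k * (?d k x)\<^sup>2) \<partial>M) = ennreal (4^k) * E (r (Suc k)) (r k)"
      unfolding E_def by (subst nn_integral_cmult[symmetric]) (auto simp: ennreal_mult')
    also have "\<dots> = ennreal (4^k * (\<integral>x. (?d k x)\<^sup>2 \<partial>M))"
      by (simp add: E ennreal_mult')
    also have "\<dots> \<le> ennreal (4^k * (1/8)^k)"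
      using N[OF r(2,1), of k] by (intro ennreal_leI mult_left_mono) auto
    also have "4^k * (1/8)^k = ((1/2)^k :: real)"
      by (simp add: power_mult_distrib[symmetric])
    finally show "(\<integral>\<^sup>+x. ennreal (4^k * (?d k x)\<^sup>2) \<partial>M) \<le> ennreal ((1/2)^k)" .
  qed auto
  also have "\<dots> = ennreal (\<Sum>k. (1/2)^k)"
    by (intro suminf_ennreal2) auto
  also have "\<dots> < \<infinity>" by simp
  finally have "AE x in M. (\<Sum>k. ennreal (4^k * (?d k x)\<^sup>2)) \<noteq> \<infinity>"
    by (intro nn_integral_PInf_AE) auto
  then have conv: "AE x in M. convergent (\<lambda>k. s (r k) x)"
  proof eventually_elim
    case (elim x)
    then have sm: "summable (\<lambda>k. 4^k * (?d k x)\<^sup>2)"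
      by (intro summable_suminf_not_top) auto
    have "summable (\<lambda>k. ?d k x)"
    proof (rule summable_comparison_test')
      show "summable (\<lambda>k. 4^k * (?d k x)\<^sup>2 + (1/4 :: real)^k)"
        by (intro summable_add sm summable_geometric) auto
      fix k :: nat
      \<comment> \<open>Weighted inequality of arithmetic and geometric means: it bounds the
        increment by \<open>4^k\<close> times its square plus \<open>(1/4)^k\<close>, both
        summable.\<close>
      have "0 \<le> (2^k * \<bar>?d k x\<bar> - (1/2)^k)\<^sup>2" by simp
      also have "\<dots> = (2^k)\<^sup>2 * (?d k x)\<^sup>2 - 2 * (2^k * (1/2)^k) * \<bar>?d k x\<bar> + ((1/2)^k)\<^sup>2"
        by (simp add: power2_diff power_mult_distrib)
      also have "(2^k)\<^sup>2 = (4^k :: real)" by (simp add: power2_eq_square power_mult_distrib[symmetric])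
      also have "2^k * (1/2)^k = (1::real)" by (simp add: power_mult_distrib[symmetric])
      also have "((1/2)^k)\<^sup>2 = ((1/4)^k :: real)" by (simp add: power2_eq_square power_mult_distrib[symmetric])
      finally have "0 \<le> 4^k * (?d k x)\<^sup>2 - 2 * 1 * \<bar>?d k x\<bar> + (1/4)^k" .
      moreover have "a \<le> b + c" if "0 \<le> b - 2 * 1 * a + c" "0 \<le> a" for a b c :: real
        using that by linarith
      ultimately show "norm (?d k x) \<le> 4^k * (?d k x)\<^sup>2 + (1/4)^k"
        unfolding real_norm_def using abs_ge_zero by blast
    qed
    then have "convergent (\<lambda>n. \<Sum>k<n. ?d k x)"
      by (simp add: summable_iff_convergent)
    then have "convergent (\<lambda>n. s (r n) x - s (r 0) x)"
      by (simp only: sum_lessThan_telescope[of "\<lambda>k. s (r k) x"])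
    then show "convergent (\<lambda>n. s (r n) x)"
      using convergent_add[OF _ convergent_const[of "s (r 0) x"]] by fastforce
  qed
  define f where "f x = lim (\<lambda>k. s (r k) x)" for x
  have [measurable]: "f \<in> borel_measurable M" unfolding f_def by measurable
  have lim: "AE x in M. (\<lambda>k. s (r k) x) \<longlonglongrightarrow> f x"
    using conv by eventually_elim (simp add: f_def convergent_LIMSEQ_iff)
  have bound: "(\<integral>\<^sup>+x. ennreal ((s n x - f x)\<^sup>2) \<partial>M) \<le> ennreal e"
    if "0 < e" and Ne: "\<And>m. N' \<le> m \<Longrightarrow> (\<integral>x. (s n x - s m x)\<^sup>2 \<partial>M) \<le> e" for n e N'
  proof -
    have "(\<integral>\<^sup>+x. ennreal ((s n x - f x)\<^sup>2) \<partial>M) = (\<integral>\<^sup>+x. liminf (\<lambda>k. ennreal ((s n x - s (r k) x)\<^sup>2)) \<partial>M)"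
    proof (rule nn_integral_cong_AE)
      show "AE x in M. ennreal ((s n x - f x)\<^sup>2) = liminf (\<lambda>k. ennreal ((s n x - s (r k) x)\<^sup>2))"
        using lim
      proof eventually_elim
        case (elim x)
        have "(\<lambda>k. ennreal ((s n x - s (r k) x)\<^sup>2)) \<longlonglongrightarrow> ennreal ((s n x - f x)\<^sup>2)"
          by (intro tendsto_ennrealI tendsto_intros elim)
        then show ?case by (intro lim_imp_Liminf[symmetric]) auto
      qed
    qed
    also have "\<dots> \<le> liminf (\<lambda>k. E n (r k))"
      unfolding E_def by (rule nn_integral_liminf) measurable
    also have "\<dots> \<le> ennreal e"
    proof (rule Liminf_le)
      have "\<forall>\<^sub>F k in sequentially. N' \<le> k" by (rule eventually_ge_at_top)
      then show "\<forall>\<^sub>F k in sequentially. E n (r k) \<le> ennreal e"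
      proof eventually_elim
        case (elim k)
        then show ?case unfolding E using Ne[of "r k"] r(3)[of k] by (intro ennreal_leI) auto
      qed
    qed simp
    finally show ?thesis .
  qed
  have small: "\<exists>N'. \<forall>n\<ge>N'. (\<integral>\<^sup>+x. ennreal ((s n x - f x)\<^sup>2) \<partial>M) \<le> ennreal e" if "0 < e" for e
  proof -
    obtain N' where "\<And>m n. N' \<le> m \<Longrightarrow> N' \<le> n \<Longrightarrow> (\<integral>x. (s m x - s n x)\<^sup>2 \<partial>M) < e"
      using C[OF \<open>0 < e\<close>] by blast
    then show ?thesis using bound[OF \<open>0 < e\<close>, of N'] by (meson less_imp_le)
  qed
  have sf: "integrable M (\<lambda>x. (s n x - f x)\<^sup>2)" if "(\<integral>\<^sup>+x. ennreal ((s n x - f x)\<^sup>2) \<partial>M) \<le> ennreal e" for n e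
    using that by (intro integrableI_bounded) (auto intro: le_less_trans)
  obtain n0 where n0: "integrable M (\<lambda>x. (s n0 x - f x)\<^sup>2)"
    using small[of 1] sf by fastforce
  then have "(\<lambda>x. s n0 x - f x) \<in> square_integrable M"
    by (simp add: square_integrable_def)
  from square_integrable_lin[OF s[of n0] this, of "-1"] have f: "f \<in> square_integrable M"
    by simp
  have "(\<lambda>n. \<integral>x. (s n x - f x)\<^sup>2 \<partial>M) \<longlonglongrightarrow> 0"
  proof (rule LIMSEQ_I)
    fix e :: real assume "0 < e"
    then obtain N' where N': "\<And>n. N' \<le> n \<Longrightarrow> (\<integral>\<^sup>+x. ennreal ((s n x - f x)\<^sup>2) \<partial>M) \<le> ennreal (e/2)"
      using small[of "e/2"] by auto
    have "norm ((\<integral>x. (s n x - f x)\<^sup>2 \<partial>M) - 0) < e" if "N' \<le> n" for n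
    proof -
      have "ennreal (\<integral>x. (s n x - f x)\<^sup>2 \<partial>M) \<le> ennreal (e/2)"
        using N'[OF that] nn_integral_eq_integral[OF sf[OF N'[OF that]]] by simp
      then show ?thesis using \<open>0 < e\<close> by (simp add: ennreal_le_iff)
    qed
    then show "\<exists>N'. \<forall>n\<ge>N'. norm ((\<integral>x. (s n x - f x)\<^sup>2 \<partial>M) - 0) < e" by blast
  qed
  with f show ?thesis by blast
qed

section \<open>Gaussians and a Plancherel inequality\<close>

lemma lborel_Fubini_swap:
  fixes f :: "'a::euclidean_space \<Rightarrow> 'b::euclidean_space \<Rightarrow> real"
  assumes [measurable]: "case_prod f \<in> borel_measurable (lborel \<Otimes>\<^sub>M lborel)"
    and fin: "(\<integral>\<^sup>+x. (\<integral>\<^sup>+y. ennreal \<bar>f x y\<bar> \<partial>lborel) \<partial>lborel) < \<infinity>"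
  shows "(\<integral>x. (\<integral>y. f x y \<partial>lborel) \<partial>lborel) = (\<integral>y. (\<integral>x. f x y \<partial>lborel) \<partial>lborel)"
proof -
  have "integrable (lborel \<Otimes>\<^sub>M lborel) (case_prod f)"
  proof (rule integrableI_bounded)
    show "(\<integral>\<^sup>+p. ennreal (norm (case_prod f p)) \<partial>(lborel \<Otimes>\<^sub>M lborel)) < \<infinity>"
      using fin by (subst lborel.nn_integral_fst[symmetric]) (auto simp: case_prod_beta')
  qed measurable
  then show ?thesis by (rule lborel_pair.Fubini_integral[symmetric])
qed

lemma nn_integral_lborel_pair_le:
  fixes f :: "'a::euclidean_space \<Rightarrow> real" and g :: "'b::euclidean_space \<Rightarrow> real"
  assumes "integrable lborel f" "integrable lborel g"
    and [measurable]: "case_prod k \<in> borel_measurable (lborel \<Otimes>\<^sub>M lborel)"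
    and k: "\<And>x y. \<bar>k x y\<bar> \<le> 1"
  shows "(\<integral>\<^sup>+x. (\<integral>\<^sup>+y. ennreal \<bar>f x * (g y * k x y)\<bar> \<partial>lborel) \<partial>lborel) < \<infinity>"
proof -
  note [measurable] = borel_measurable_integrable[OF assms(1)] borel_measurable_integrable[OF assms(2)]
  have "(\<integral>\<^sup>+x. (\<integral>\<^sup>+y. ennreal \<bar>f x * (g y * k x y)\<bar> \<partial>lborel) \<partial>lborel)
      \<le> (\<integral>\<^sup>+x. (\<integral>\<^sup>+y. ennreal \<bar>f x\<bar> * ennreal \<bar>g y\<bar> \<partial>lborel) \<partial>lborel)"
  proof (intro nn_integral_mono)
    fix x y
    have "\<bar>f x\<bar> * (\<bar>g y\<bar> * \<bar>k x y\<bar>) \<le> \<bar>f x\<bar> * (\<bar>g y\<bar> * 1)"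
      using k by (intro mult_left_mono) auto
    then show "ennreal \<bar>f x * (g y * k x y)\<bar> \<le> ennreal \<bar>f x\<bar> * ennreal \<bar>g y\<bar>"
      by (simp add: abs_mult ennreal_mult'[symmetric] ennreal_leI)
  qed
  also have "\<dots> = (\<integral>\<^sup>+x. ennreal \<bar>f x\<bar> \<partial>lborel) * (\<integral>\<^sup>+y. ennreal \<bar>g y\<bar> \<partial>lborel)"
    by (simp add: nn_integral_cmult nn_integral_multc)
  also have "\<dots> < \<infinity>"
    using assms(1,2) by (simp add: integrable_iff_bounded ennreal_mult_less_top)
  finally show ?thesis .
qed

text \<open>A kernel bounded by 1 keeps the double integral absolutely convergent. With the cosine
  as kernel, the identity moves a transform from one factor to the other.\<close>

lemma lborel_kernel_swap:
  fixes f :: "'a::euclidean_space \<Rightarrow> real" and g :: "'b::euclidean_space \<Rightarrow> real"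
  assumes "integrable lborel f" "integrable lborel g"
    and [measurable]: "case_prod k \<in> borel_measurable (lborel \<Otimes>\<^sub>M lborel)"
    and k: "\<And>x y. \<bar>k x y\<bar> \<le> 1"
  shows "(\<integral>x. f x * (\<integral>y. g y * k x y \<partial>lborel) \<partial>lborel) = (\<integral>y. g y * (\<integral>x. f x * k x y \<partial>lborel) \<partial>lborel)"
proof -
  note [measurable] = borel_measurable_integrable[OF assms(1)] borel_measurable_integrable[OF assms(2)]
  have "(\<integral>x. f x * (\<integral>y. g y * k x y \<partial>lborel) \<partial>lborel) = (\<integral>x. (\<integral>y. f x * (g y * k x y) \<partial>lborel) \<partial>lborel)"
    by simp
  also have "\<dots> = (\<integral>y. (\<integral>x. f x * (g y * k x y) \<partial>lborel) \<partial>lborel)"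
    using nn_integral_lborel_pair_le[OF assms] by (intro lborel_Fubini_swap) measurable
  also have "\<dots> = (\<integral>y. (\<integral>x. g y * (f x * k x y) \<partial>lborel) \<partial>lborel)"
    by (simp only: mult.left_commute)
  finally show ?thesis by simp
qed

text \<open>Rescaling by \<open>1 / sqrt a\<close> reduces the integral to the characteristic
  function of the standard normal distribution.\<close>

lemma gaussian_cis_real:
  fixes a z :: real
  assumes a: "0 < a"
  shows "integrable lborel (\<lambda>t. exp (- a * t\<^sup>2 / 2) *\<^sub>R cis (z * t))"
    "(\<integral>t. exp (- a * t\<^sup>2 / 2) *\<^sub>R cis (z * t) \<partial>lborel) = complex_of_real (sqrt (2 * pi / a) * exp (- z\<^sup>2 / (2 * a)))"
proof -
  let ?F = "\<lambda>t. exp (- a * t\<^sup>2 / 2) *\<^sub>R cis (z * t)"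
  have eq: "?F (0 + (1 / sqrt a) * t) = sqrt (2 * pi) *\<^sub>R (std_normal_density t *\<^sub>R cis (z / sqrt a * t))" for t
    using a by (simp add: std_normal_density_def power_divide)
  have [measurable]: "(\<lambda>t. cis (z / sqrt a * t)) \<in> borel_measurable borel"
    by (intro borel_measurable_continuous_onI continuous_intros)
  have int: "integrable lborel (\<lambda>t. std_normal_density t *\<^sub>R cis (z / sqrt a * t))"
  proof (rule Bochner_Integration.integrable_bound)
    show "integrable lborel std_normal_density" by simp
    show "(\<lambda>t. std_normal_density t *\<^sub>R cis (z / sqrt a * t)) \<in> borel_measurable lborel"
      by measurable
  qed (simp add: normal_density_nonneg)
  have "integrable lborel (\<lambda>t. ?F (0 + (1 / sqrt a) * t))"
    unfolding eq by (intro integrable_scaleR_right int)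
  then show I: "integrable lborel ?F"
    using a by (subst (asm) lborel_integrable_real_affine_iff) auto
  have "(\<integral>t. ?F t \<partial>lborel) = \<bar>1 / sqrt a\<bar> *\<^sub>R (\<integral>t. ?F (0 + (1 / sqrt a) * t) \<partial>lborel)"
    using a by (intro lborel_integral_real_affine) auto
  also have "\<dots> = (1 / sqrt a * sqrt (2 * pi)) *\<^sub>R (\<integral>t. std_normal_density t *\<^sub>R cis (z / sqrt a * t) \<partial>lborel)"
    unfolding eq by (simp only: integral_scaleR_right) (use a in simp)
  also have "(\<integral>t. std_normal_density t *\<^sub>R cis (z / sqrt a * t) \<partial>lborel) = char std_normal_distribution (z / sqrt a)"
    unfolding char_def by (subst integral_density) (auto simp: normal_density_nonneg cis_conv_exp)
  also have "\<dots> = complex_of_real (exp (- (z\<^sup>2 / (2 * a))))"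
    using a by (simp add: char_std_normal_distribution power_divide)
  finally show "(\<integral>t. ?F t \<partial>lborel) = complex_of_real (sqrt (2 * pi / a) * exp (- z\<^sup>2 / (2 * a)))"
    by (simp add: real_sqrt_divide scaleR_conv_of_real)
qed

text \<open>\<open>cis\<close> of a sum factors over the coordinates, which the cosine does not;
  hence the complex form here, with the real part taken afterwards.\<close>

lemma gaussian_cis:
  fixes z :: "'a::euclidean_space"
  assumes a: "0 < a"
  shows "integrable lborel (\<lambda>x. exp (- a * (norm x)\<^sup>2 / 2) *\<^sub>R cis (z \<bullet> x))"
    "(\<integral>x. exp (- a * (norm x)\<^sup>2 / 2) *\<^sub>R cis (z \<bullet> x) \<partial>lborel)
      = complex_of_real (sqrt (2 * pi / a) ^ DIM('a) * exp (- (norm z)\<^sup>2 / (2 * a)))"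
proof -
  interpret product_sigma_finite "\<lambda>_. lborel :: real measure" by standard
  let ?F = "\<lambda>x::'a. exp (- a * (norm x)\<^sup>2 / 2) *\<^sub>R cis (z \<bullet> x)"
  let ?f = "\<lambda>b t. exp (- a * t\<^sup>2 / 2) *\<^sub>R cis ((z \<bullet> b) * t)"
  let ?S = "\<lambda>f. \<Sum>c\<in>Basis. f c *\<^sub>R (c :: 'a)"
  have n: "(norm (?S f))\<^sup>2 = (\<Sum>b\<in>Basis. (f b)\<^sup>2)" for f
    by (subst norm_sum_Pythagorean) (auto simp: pairwise_def orthogonal_def inner_Basis)
  have cis_sum: "cis (sum g B) = (\<Prod>b\<in>B. cis (g b))" if "finite B" for g and B :: "'a set"
    using that by (induction B rule: finite_induct) (auto simp: cis_mult[symmetric])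
  have prod: "?F (?S f) = (\<Prod>b\<in>Basis. ?f b (f b))" for f
  proof -
    have "(\<Prod>b\<in>Basis. ?f b (f b)) = (\<Prod>b\<in>Basis. complex_of_real (exp (- a * (f b)\<^sup>2 / 2))) * (\<Prod>b\<in>Basis. cis ((z \<bullet> b) * f b))"
      by (simp add: scaleR_conv_of_real prod.distrib)
    also have "(\<Prod>b\<in>Basis. complex_of_real (exp (- a * (f b)\<^sup>2 / 2))) = complex_of_real (exp (\<Sum>b\<in>Basis. - a * (f b)\<^sup>2 / 2))"
      by (simp add: exp_sum)
    also have "(\<Sum>b\<in>Basis. - a * (f b)\<^sup>2 / 2) = - a * (norm (?S f))\<^sup>2 / 2"
      by (simp add: n sum_distrib_left sum_divide_distrib sum_negf)
    also have "(\<Prod>b\<in>Basis. cis ((z \<bullet> b) * f b)) = cis (z \<bullet> ?S f)"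
      by (subst cis_sum[symmetric]) (auto simp: inner_sum_right mult.commute)
    finally show ?thesis by (simp add: scaleR_conv_of_real)
  qed
  have [measurable]: "?F \<in> borel_measurable borel"
    by (intro borel_measurable_continuous_onI continuous_intros) auto
  have [measurable]: "?S \<in> Pi\<^sub>M Basis (\<lambda>_. lborel) \<rightarrow>\<^sub>M borel" by measurable
  have L: "lborel = distr (Pi\<^sub>M Basis (\<lambda>_. lborel)) borel ?S" by (rule lborel_eq)
  have I: "integrable (Pi\<^sub>M Basis (\<lambda>_. lborel)) (\<lambda>f. \<Prod>b\<in>Basis. ?f b (f b))"
    by (intro product_integrable_prod gaussian_cis_real a) auto
  show "integrable lborel ?F"
    by (subst L, subst integrable_distr_eq) (use I in \<open>simp_all only: prod, measurable\<close>)
  have "(\<integral>x. ?F x \<partial>lborel) = (\<integral>f. (\<Prod>b\<in>Basis. ?f b (f b)) \<partial>Pi\<^sub>M Basis (\<lambda>_. lborel))"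
    by (subst L, subst integral_distr) (simp_all only: prod, measurable)
  also have "\<dots> = (\<Prod>b\<in>Basis. \<integral>t. ?f b t \<partial>lborel)"
    by (intro product_integral_prod gaussian_cis_real a) auto
  also have "\<dots> = (\<Prod>b\<in>(Basis::'a set). complex_of_real (sqrt (2 * pi / a) * exp (- (z \<bullet> b)\<^sup>2 / (2 * a))))"
    by (simp only: gaussian_cis_real(2)[OF a])
  also have "\<dots> = complex_of_real (sqrt (2 * pi / a) ^ DIM('a) * exp (\<Sum>b\<in>(Basis::'a set). - (z \<bullet> b)\<^sup>2 / (2 * a)))"
    by (simp add: prod.distrib exp_sum)
  also have "(\<Sum>b\<in>(Basis::'a set). - (z \<bullet> b)\<^sup>2 / (2 * a)) = - (norm z)\<^sup>2 / (2 * a)"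
  proof -
    have "(norm z)\<^sup>2 = (\<Sum>b\<in>Basis. (z \<bullet> b)\<^sup>2)"
      using dot_square_norm[of z] euclidean_inner[of z z] by (simp add: power2_eq_square)
    then show ?thesis by (simp add: sum_negf sum_divide_distrib)
  qed
  finally show "(\<integral>x. ?F x \<partial>lborel)
      = complex_of_real (sqrt (2 * pi / a) ^ DIM('a) * exp (- (norm z)\<^sup>2 / (2 * a)))" .
qed

lemma integrable_gaussian:
  "0 < a \<Longrightarrow> integrable lborel (\<lambda>x::'a::euclidean_space. exp (- a * (norm x)\<^sup>2 / 2))"
  using integrable_Re[OF gaussian_cis(1)[of a "0::'a"]] by simp

lemma gaussian_cos:
  fixes z :: "'a::euclidean_space"
  assumes a: "0 < a"
  shows "(\<integral>x. exp (- a * (norm x)\<^sup>2 / 2) * cos (z \<bullet> x) \<partial>lborel)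
      = sqrt (2 * pi / a) ^ DIM('a) * exp (- (norm z)\<^sup>2 / (2 * a))"
  using integral_Re[OF gaussian_cis(1)[OF a, of z]] gaussian_cis(2)[OF a, of z] by simp

lemma integral_gaussian:
  "0 < a \<Longrightarrow> (\<integral>(x::'a::euclidean_space). exp (- a * (norm x)\<^sup>2 / 2) \<partial>lborel) = sqrt (2 * pi / a) ^ DIM('a)"
  using gaussian_cos[of a "0::'a"] by simp

section \<open>An upper bound in L^2 for the cosine transform\<close>

lemma ennreal_abs_integral_le:
  fixes f :: "'b \<Rightarrow> real"
  shows "ennreal \<bar>\<integral>x. f x \<partial>M\<bar> \<le> (\<integral>\<^sup>+x. ennreal \<bar>f x\<bar> \<partial>M)"
proof (cases "integrable M f")
  case True
  then show ?thesis using integral_norm_bound_ennreal[OF True] by simp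
qed (simp add: not_integrable_integral_eq)

lemma ennreal_half_sum:
  assumes "0 \<le> u" "0 \<le> v"
  shows "ennreal (1/2) * (ennreal u + ennreal v) = ennreal ((u + v) / 2)"
proof -
  have "ennreal (1/2) * (ennreal u + ennreal v) = ennreal (1/2 * (u + v))"
    by (subst ennreal_plus[OF assms, symmetric], subst ennreal_mult'[of "1/2"]) auto
  then show ?thesis by simp
qed

text \<open>
  Against a Gaussian weight, the integral of the squared transform is a quadratic form in \<open>A\<close>
  with a positive kernel \<open>K\<close> whose row integrals are \<open>(2 \<pi>)\<^sup>d\<close> independently of the width (Schur test).
\<close>

lemma Plancherel_upper_bound:
  fixes A :: "'a::euclidean_space \<Rightarrow> real"
  assumes A: "integrable lborel A" and A2: "integrable lborel (\<lambda>x. (A x)\<^sup>2)"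
  shows "(\<integral>\<^sup>+x. ennreal ((\<integral>\<xi>. A \<xi> * cos (\<xi> \<bullet> x) \<partial>lborel)\<^sup>2) \<partial>lborel)
    \<le> ennreal ((2 * pi) ^ DIM('a) * (\<integral>\<xi>. (A \<xi>)\<^sup>2 \<partial>lborel))"
proof -
  note [measurable] = borel_measurable_integrable[OF A]
  define C where "C x = (\<integral>\<xi>. A \<xi> * cos (\<xi> \<bullet> x) \<partial>lborel)" for x
  define N where "N = (\<integral>\<xi>. \<bar>A \<xi>\<bar> \<partial>lborel)"
  have [measurable]: "C \<in> borel_measurable borel" unfolding C_def by measurable
  have C_bd: "\<bar>C x\<bar> \<le> N" for x
  proof -
    have "\<bar>C x\<bar> \<le> (\<integral>\<xi>. \<bar>A \<xi> * cos (\<xi> \<bullet> x)\<bar> \<partial>lborel)"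
      unfolding C_def by (rule integral_abs_bound)
    also have "\<dots> \<le> N"
      unfolding N_def
    proof (rule integral_mono)
      show "integrable lborel (\<lambda>\<xi>. \<bar>A \<xi> * cos (\<xi> \<bullet> x)\<bar>)"
        by (rule Bochner_Integration.integrable_bound[OF A]) (auto simp: abs_mult intro!: mult_left_le)
      show "\<bar>A \<xi> * cos (\<xi> \<bullet> x)\<bar> \<le> \<bar>A \<xi>\<bar>" for \<xi>
        by (auto simp: abs_mult intro!: mult_left_le)
    qed (use A in auto)
    finally show ?thesis .
  qed
  let ?B = "(2 * pi) ^ DIM('a) * (\<integral>\<xi>. (A \<xi>)\<^sup>2 \<partial>lborel)"
  have main: "(\<integral>\<^sup>+x. ennreal (exp (- a * (norm x)\<^sup>2 / 2) * (C x)\<^sup>2) \<partial>lborel) \<le> ennreal ?B" if a: "0 < a" for a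
  proof -
    let ?G = "\<lambda>x::'a. exp (- a * (norm x)\<^sup>2 / 2)"
    \<comment> \<open>\<open>h\<close> is the cosine transform of the weight, and \<open>K\<close>
      arises from \<open>2 * cos u * cos v = cos (u - v) + cos (u + v)\<close>.\<close>
    define h where "h z = sqrt (2 * pi / a) ^ DIM('a) * exp (- (norm z)\<^sup>2 / (2 * a))" for z :: 'a
    define K where "K \<xi> \<eta> = (h (\<xi> - \<eta>) + h (\<xi> + \<eta>)) / 2" for \<xi> \<eta>
    have h0: "0 \<le> h z" for z
      using a by (auto simp: h_def intro!: mult_nonneg_nonneg zero_le_power)
    have K0: "0 \<le> K \<xi> \<eta>" for \<xi> \<eta> using h0 by (simp add: K_def)
    have [measurable]: "h \<in> borel_measurable borel"
      unfolding h_def by measurable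
    have Ksym: "K \<xi> \<eta> = K \<eta> \<xi>" for \<xi> \<eta>
      by (simp add: K_def h_def norm_minus_commute add.commute)
    have [measurable]: "case_prod K \<in> borel_measurable (lborel \<Otimes>\<^sub>M lborel)"
      unfolding K_def by measurable
    have intG: "integrable lborel (\<lambda>x. ?G x * cos (\<xi> \<bullet> x))" for \<xi>
      by (rule Bochner_Integration.integrable_bound[OF integrable_gaussian[OF a]])
         (auto simp: abs_mult intro!: mult_left_le)
    have GK: "(\<integral>x. ?G x * cos (\<xi> \<bullet> x) * cos (\<eta> \<bullet> x) \<partial>lborel) = K \<xi> \<eta>" for \<xi> \<eta>
    proof -
      have "(\<integral>x. ?G x * cos (\<xi> \<bullet> x) * cos (\<eta> \<bullet> x) \<partial>lborel)
          = (\<integral>x. (?G x * cos ((\<xi> - \<eta>) \<bullet> x) + ?G x * cos ((\<xi> + \<eta>) \<bullet> x)) / 2 \<partial>lborel)"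
        by (intro Bochner_Integration.integral_cong refl)
           (simp add: inner_diff_left inner_add_left cos_diff cos_add algebra_simps)
      also have "\<dots> = ((\<integral>x. ?G x * cos ((\<xi> - \<eta>) \<bullet> x) \<partial>lborel) + (\<integral>x. ?G x * cos ((\<xi> + \<eta>) \<bullet> x) \<partial>lborel)) / 2"
        by (simp only: integral_divide_zero Bochner_Integration.integral_add[OF intG intG])
      also have "\<dots> = K \<xi> \<eta>"
        unfolding gaussian_cos[OF a] K_def h_def ..
      finally show ?thesis .
    qed
    have hK: "(\<integral>\<^sup>+\<eta>. ennreal (K \<xi> \<eta>) \<partial>lborel) = ennreal ((2 * pi) ^ DIM('a))" for \<xi>
    proof -
      have hh: "(\<integral>\<^sup>+z. ennreal (h z) \<partial>lborel) = ennreal ((2 * pi) ^ DIM('a))"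
      proof -
        have a': "0 < 1 / a" using a by simp
        have eq: "h z = sqrt (2 * pi / a) ^ DIM('a) * exp (- (1/a) * (norm z)\<^sup>2 / 2)" for z
          by (simp add: h_def)
        have "(\<integral>\<^sup>+z. ennreal (h z) \<partial>lborel) = ennreal (\<integral>z. h z \<partial>lborel)"
          unfolding eq using a
          by (intro nn_integral_eq_integral integrable_mult_right integrable_gaussian[OF a'] AE_I2
              mult_nonneg_nonneg zero_le_power) auto
        also have "(\<integral>z. h z \<partial>lborel) = sqrt (2 * pi / a) ^ DIM('a) * sqrt (2 * pi / (1 / a)) ^ DIM('a)"
          unfolding eq by (simp only: integral_mult_right_zero integral_gaussian[OF a'])
        also have "\<dots> = (sqrt (2 * pi / a) * sqrt (2 * pi / (1 / a))) ^ DIM('a)"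
          by (rule power_mult_distrib[symmetric])
        also have "sqrt (2 * pi / a) * sqrt (2 * pi / (1 / a)) = sqrt ((2 * pi)\<^sup>2)"
          unfolding real_sqrt_mult[symmetric] using a by (simp add: power2_eq_square)
        also have "sqrt ((2 * pi)\<^sup>2) = 2 * pi" by (rule real_sqrt_unique) auto
        finally show ?thesis .
      qed
      have s1: "(\<integral>\<^sup>+\<eta>. ennreal (h (\<xi> - \<eta>)) \<partial>lborel) = (\<integral>\<^sup>+z. ennreal (h z) \<partial>lborel)"
        by (rule nn_integral_lborel_minus[where f="\<lambda>z. ennreal (h z)"]) measurable
      have s2: "(\<integral>\<^sup>+\<eta>. ennreal (h (\<xi> + \<eta>)) \<partial>lborel) = (\<integral>\<^sup>+z. ennreal (h z) \<partial>lborel)"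
        by (rule nn_integral_lborel_shift[where f="\<lambda>z. ennreal (h z)"]) measurable
      have "(\<integral>\<^sup>+\<eta>. ennreal (K \<xi> \<eta>) \<partial>lborel) = (\<integral>\<^sup>+\<eta>. ennreal (1/2) * (ennreal (h (\<xi> - \<eta>)) + ennreal (h (\<xi> + \<eta>))) \<partial>lborel)"
        by (intro nn_integral_cong) (simp only: K_def ennreal_half_sum[OF h0 h0])
      also have "\<dots> = ennreal (1/2) * ((\<integral>\<^sup>+\<eta>. ennreal (h (\<xi> - \<eta>)) \<partial>lborel) + (\<integral>\<^sup>+\<eta>. ennreal (h (\<xi> + \<eta>)) \<partial>lborel))"
        by (simp add: nn_integral_cmult nn_integral_add)
      also have "\<dots> = ennreal ((2 * pi) ^ DIM('a))"
        unfolding s1 s2 hh by (subst ennreal_half_sum) auto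
      finally show ?thesis .
    qed
    have GC: "integrable lborel (\<lambda>x. ?G x * C x)"
      by (rule Bochner_Integration.integrable_bound[OF integrable_mult_right[OF integrable_gaussian[OF a], of N]])
         (use C_bd in \<open>auto simp: abs_mult mult.commute[of N] intro!: mult_left_mono order_trans[OF C_bd abs_ge_self]\<close>)
    have inner: "(\<integral>x. (?G x * C x) * cos (\<xi> \<bullet> x) \<partial>lborel) = (\<integral>\<eta>. A \<eta> * K \<xi> \<eta> \<partial>lborel)" for \<xi>
    proof -
      have "(\<integral>x. (?G x * C x) * cos (\<xi> \<bullet> x) \<partial>lborel)
          = (\<integral>x. (?G x * cos (\<xi> \<bullet> x)) * (\<integral>\<eta>. A \<eta> * cos (\<eta> \<bullet> x) \<partial>lborel) \<partial>lborel)"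
        by (simp add: C_def mult_ac)
      also have "\<dots> = (\<integral>\<eta>. A \<eta> * (\<integral>x. (?G x * cos (\<xi> \<bullet> x)) * cos (\<eta> \<bullet> x) \<partial>lborel) \<partial>lborel)"
        by (rule lborel_kernel_swap[OF intG A]) auto
      finally show ?thesis by (simp only: GK)
    qed
    have "(\<integral>x. ?G x * (C x)\<^sup>2 \<partial>lborel) = (\<integral>x. (?G x * C x) * (\<integral>\<xi>. A \<xi> * cos (\<xi> \<bullet> x) \<partial>lborel) \<partial>lborel)"
      by (simp add: power2_eq_square mult.assoc C_def)
    also have "\<dots> = (\<integral>\<xi>. A \<xi> * (\<integral>x. (?G x * C x) * cos (\<xi> \<bullet> x) \<partial>lborel) \<partial>lborel)"
      by (rule lborel_kernel_swap[OF GC A]) auto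
    also have "\<dots> = (\<integral>\<xi>. A \<xi> * (\<integral>\<eta>. A \<eta> * K \<xi> \<eta> \<partial>lborel) \<partial>lborel)"
      by (simp only: inner)
    finally have eq: "(\<integral>x. ?G x * (C x)\<^sup>2 \<partial>lborel) = (\<integral>\<xi>. (\<integral>\<eta>. A \<xi> * (A \<eta> * K \<xi> \<eta>) \<partial>lborel) \<partial>lborel)"
      by simp
    have GC2: "integrable lborel (\<lambda>x. ?G x * (C x)\<^sup>2)"
    proof (rule Bochner_Integration.integrable_bound[OF integrable_mult_right[OF GC, of N]])
      show "AE x in lborel. norm (?G x * (C x)\<^sup>2) \<le> norm (N * (?G x * C x))"
      proof (rule AE_I2)
        fix x
        have "norm (?G x * (C x)\<^sup>2) = ?G x * (\<bar>C x\<bar> * \<bar>C x\<bar>)"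
          by (simp add: abs_mult power2_eq_square)
        also have "\<dots> \<le> ?G x * (\<bar>N\<bar> * \<bar>C x\<bar>)"
          using C_bd[of x] by (intro mult_left_mono mult_right_mono) auto
        also have "\<dots> = norm (N * (?G x * C x))"
          by (simp only: real_norm_def abs_mult abs_exp_cancel mult.left_commute)
        finally show "norm (?G x * (C x)\<^sup>2) \<le> norm (N * (?G x * C x))" .
      qed
    qed measurable
    have "(\<integral>\<^sup>+x. ennreal (?G x * (C x)\<^sup>2) \<partial>lborel) = ennreal (\<integral>x. ?G x * (C x)\<^sup>2 \<partial>lborel)"
      by (intro nn_integral_eq_integral GC2) auto
    also have "\<dots> \<le> (\<integral>\<^sup>+\<xi>. ennreal \<bar>\<integral>\<eta>. A \<xi> * (A \<eta> * K \<xi> \<eta>) \<partial>lborel\<bar> \<partial>lborel)"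
      unfolding eq by (rule order_trans[OF ennreal_leI[OF abs_ge_self] ennreal_abs_integral_le])
    also have "\<dots> \<le> (\<integral>\<^sup>+\<xi>. (\<integral>\<^sup>+\<eta>. ennreal \<bar>A \<xi> * (A \<eta> * K \<xi> \<eta>)\<bar> \<partial>lborel) \<partial>lborel)"
      by (intro nn_integral_mono ennreal_abs_integral_le)
    \<comment> \<open>Half the sum of the squares bounds
      \<open>\<bar>A \<xi>\<bar> * \<bar>A \<eta>\<bar>\<close> and decouples the variables; by
      symmetry of \<open>K\<close> the two halves contribute equally.\<close>
    also have "\<dots> \<le> (\<integral>\<^sup>+\<xi>. (\<integral>\<^sup>+\<eta>. ennreal (1/2) * (ennreal ((A \<xi>)\<^sup>2) * ennreal (K \<xi> \<eta>) + ennreal ((A \<eta>)\<^sup>2) * ennreal (K \<xi> \<eta>)) \<partial>lborel) \<partial>lborel)"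
    proof (intro nn_integral_mono)
      fix \<xi> \<eta>
      have "0 \<le> (\<bar>A \<xi>\<bar> - \<bar>A \<eta>\<bar>)\<^sup>2" by simp
      then have "\<bar>A \<xi>\<bar> * \<bar>A \<eta>\<bar> \<le> 1/2 * ((A \<xi>)\<^sup>2 + (A \<eta>)\<^sup>2)"
        by (simp add: power2_diff)
      from mult_right_mono[OF this K0[of \<xi> \<eta>]]
      have "\<bar>A \<xi> * (A \<eta> * K \<xi> \<eta>)\<bar> \<le> ((A \<xi>)\<^sup>2 * K \<xi> \<eta> + (A \<eta>)\<^sup>2 * K \<xi> \<eta>) / 2"
        using K0 by (simp add: abs_mult algebra_simps)
      from ennreal_leI[OF this] show "ennreal \<bar>A \<xi> * (A \<eta> * K \<xi> \<eta>)\<bar>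
          \<le> ennreal (1/2) * (ennreal ((A \<xi>)\<^sup>2) * ennreal (K \<xi> \<eta>) + ennreal ((A \<eta>)\<^sup>2) * ennreal (K \<xi> \<eta>))"
        unfolding ennreal_mult'[OF zero_le_power2, symmetric]
        by (subst ennreal_half_sum) (auto intro!: mult_nonneg_nonneg K0)
    qed
    also have "\<dots> = ennreal (1/2) * ((\<integral>\<^sup>+\<xi>. (\<integral>\<^sup>+\<eta>. ennreal ((A \<xi>)\<^sup>2) * ennreal (K \<xi> \<eta>) \<partial>lborel) \<partial>lborel)
        + (\<integral>\<^sup>+\<xi>. (\<integral>\<^sup>+\<eta>. ennreal ((A \<eta>)\<^sup>2) * ennreal (K \<xi> \<eta>) \<partial>lborel) \<partial>lborel))"
      by (simp add: nn_integral_cmult nn_integral_add)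
    also have "(\<integral>\<^sup>+\<xi>. (\<integral>\<^sup>+\<eta>. ennreal ((A \<eta>)\<^sup>2) * ennreal (K \<xi> \<eta>) \<partial>lborel) \<partial>lborel)
        = (\<integral>\<^sup>+\<eta>. (\<integral>\<^sup>+\<xi>. ennreal ((A \<eta>)\<^sup>2) * ennreal (K \<xi> \<eta>) \<partial>lborel) \<partial>lborel)"
      by (rule lborel_pair.Fubini') measurable
    also have "\<dots> = (\<integral>\<^sup>+\<eta>. (\<integral>\<^sup>+\<xi>. ennreal ((A \<eta>)\<^sup>2) * ennreal (K \<eta> \<xi>) \<partial>lborel) \<partial>lborel)"
      by (subst Ksym) (rule refl)
    also have "(\<integral>\<^sup>+\<xi>. (\<integral>\<^sup>+\<eta>. ennreal ((A \<xi>)\<^sup>2) * ennreal (K \<xi> \<eta>) \<partial>lborel) \<partial>lborel) = ennreal ?B"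
    proof -
      have "(\<integral>\<^sup>+\<xi>. (\<integral>\<^sup>+\<eta>. ennreal ((A \<xi>)\<^sup>2) * ennreal (K \<xi> \<eta>) \<partial>lborel) \<partial>lborel)
          = (\<integral>\<^sup>+\<xi>. ennreal ((A \<xi>)\<^sup>2) * ennreal ((2 * pi) ^ DIM('a)) \<partial>lborel)"
        by (simp add: nn_integral_cmult hK)
      also have "\<dots> = ennreal (\<integral>\<xi>. (A \<xi>)\<^sup>2 \<partial>lborel) * ennreal ((2 * pi) ^ DIM('a))"
        by (subst nn_integral_multc) (auto simp: nn_integral_eq_integral[OF A2])
      also have "\<dots> = ennreal ?B"
        by (simp add: ennreal_mult'[symmetric] mult.commute)
      finally show ?thesis .
    qed
    also have "ennreal (1/2) * (ennreal ?B + ennreal ?B) = ennreal ?B"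
    proof -
      have "0 \<le> ?B" by (intro mult_nonneg_nonneg Bochner_Integration.integral_nonneg) auto
      then show ?thesis
        by (subst ennreal_half_sum) auto
    qed
    finally show ?thesis .
  qed
  \<comment> \<open>The Gaussian weights tend to 1 as their parameter tends to 0; Fatou's lemma
    removes them, because the bound in \<open>main\<close> does not depend on the parameter.\<close>
  have "(\<integral>\<^sup>+x. ennreal ((C x)\<^sup>2) \<partial>lborel)
      = (\<integral>\<^sup>+x. liminf (\<lambda>n. ennreal (exp (- (1 / real (Suc n)) * (norm x)\<^sup>2 / 2) * (C x)\<^sup>2)) \<partial>lborel)"
  proof (rule nn_integral_cong)
    fix x
    have "(\<lambda>n. exp (- (1 / real (Suc n)) * (norm x)\<^sup>2 / 2) * (C x)\<^sup>2) \<longlonglongrightarrow> exp (- 0 * (norm x)\<^sup>2 / 2) * (C x)\<^sup>2"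
      by (intro tendsto_intros LIMSEQ_Suc[OF lim_1_over_n]) auto
    then have "(\<lambda>n. ennreal (exp (- (1 / real (Suc n)) * (norm x)\<^sup>2 / 2) * (C x)\<^sup>2)) \<longlonglongrightarrow> ennreal ((C x)\<^sup>2)"
      by (intro tendsto_ennrealI) simp
    then show "ennreal ((C x)\<^sup>2) = liminf (\<lambda>n. ennreal (exp (- (1 / real (Suc n)) * (norm x)\<^sup>2 / 2) * (C x)\<^sup>2))"
      by (intro lim_imp_Liminf[symmetric]) auto
  qed
  also have "\<dots> \<le> liminf (\<lambda>n. \<integral>\<^sup>+x. ennreal (exp (- (1 / real (Suc n)) * (norm x)\<^sup>2 / 2) * (C x)\<^sup>2) \<partial>lborel)"
    by (rule nn_integral_liminf) measurable
  also have "\<dots> \<le> ennreal ?B"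
    by (intro Liminf_le always_eventually allI main) auto
  finally show ?thesis by (simp add: C_def)
qed

section \<open>Injectivity of convolution with a radial kernel\<close>

lemma integrable_lborel_minus:
  fixes f :: "'a::euclidean_space \<Rightarrow> real"
  assumes "integrable lborel f"
  shows "integrable lborel (\<lambda>y. f (c - y))"
proof -
  have "integrable (distr lborel borel (\<lambda>y. c - y)) f"
    using assms by (simp only: lborel_distr_minus)
  then show ?thesis
    by (subst (asm) integrable_distr_eq) (use borel_measurable_integrable[OF assms] in auto)
qed

text \<open>The integral of \<open>p\<close> is the value of its Fourier transform at 0; being
  nonzero, it keeps the transform from vanishing identically. The bounded support lets the transform
  along an axis extend to an entire function.\<close>

locale radial_kernel =
  fixes p :: "'a::euclidean_space \<Rightarrow> real"
  assumes p_int: "integrable lborel p" and radial: "\<And>x y. norm x = norm y \<Longrightarrow> p x = p y"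
    and supp: "\<And>x. 1 < norm x \<Longrightarrow> p x = 0" and integral_nonzero: "(\<integral>x. p x \<partial>lborel) \<noteq> 0"
begin

section \<open>The Fourier transform of the kernel and its zeros\<close>

lemma p_measurable [measurable]: "p \<in> borel_measurable borel"
  using borel_measurable_integrable[OF p_int] by simp

text \<open>As \<open>p\<close> is even, the cosine integral is the full Fourier transform.\<close>

definition four :: "'a \<Rightarrow> real" where
  "four \<xi> = (\<integral>y. p y * cos (\<xi> \<bullet> y) \<partial>lborel)"

lemma integrable_p_cos: "integrable lborel (\<lambda>y. p y * cos (f y))" if [measurable]: "f \<in> borel_measurable borel"
  by (rule Bochner_Integration.integrable_bound[OF p_int]) (auto simp: abs_mult intro!: mult_left_le)

lemma four_measurable [measurable]: "four \<in> borel_measurable borel"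
  unfolding four_def by measurable

lemma four_radial:
  assumes "norm x = norm y"
  shows "four x = four y"
proof -
  obtain T :: "'a \<Rightarrow> 'a" where T: "linear T" "\<And>z. norm (T z) = norm z" "\<And>z. T (T z) = z" "T x = y"
    using reflection_exists[OF assms] by blast
  have "four y = (\<integral>z. p (T z) * cos (T x \<bullet> T z) \<partial>lborel)"
    unfolding four_def T(4)
    by (rule integral_lborel_isometry[OF T(1-3), symmetric, where f="\<lambda>z. p z * cos (y \<bullet> z)"]) measurable
  also have "\<dots> = (\<integral>z. p z * cos (x \<bullet> z) \<partial>lborel)"
    using radial[OF T(2)] by (simp add: isometry_inner[OF T(1,2)])
  finally show ?thesis by (simp add: four_def)
qed

text \<open>The cosine is an eigenfunction of convolution with \<open>p\<close>: evenness allows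
  averaging over \<open>z\<close> and \<open>- z\<close>, and
  \<open>cos (u - v) + cos (u + v) = 2 * cos u * cos v\<close> separates the variables.\<close>

lemma convolution_cos: "(\<integral>y. p (x - y) * cos (\<xi> \<bullet> y) \<partial>lborel) = four \<xi> * cos (\<xi> \<bullet> x)"
proof -
  let ?I = "\<integral>y. p (x - y) * cos (\<xi> \<bullet> y) \<partial>lborel"
  have I1: "?I = (\<integral>z. p z * cos (\<xi> \<bullet> (x - z)) \<partial>lborel)"
    using integral_lborel_minus[of "\<lambda>z. p z * cos (\<xi> \<bullet> (x - z))" x] by simp
  also have "\<dots> = (\<integral>z. p (0 - z) * cos (\<xi> \<bullet> (x - (0 - z))) \<partial>lborel)"
    by (rule integral_lborel_minus[symmetric, where f="\<lambda>z. p z * cos (\<xi> \<bullet> (x - z))"]) measurable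
  also have "\<dots> = (\<integral>z. p z * cos (\<xi> \<bullet> (x + z)) \<partial>lborel)"
    using radial[of "- z" z for z] by simp
  finally have I2: "?I = (\<integral>z. p z * cos (\<xi> \<bullet> (x + z)) \<partial>lborel)" .
  have "?I + ?I = (\<integral>z. p z * cos (\<xi> \<bullet> (x - z)) + p z * cos (\<xi> \<bullet> (x + z)) \<partial>lborel)"
    by (subst (1) I1, subst I2, rule Bochner_Integration.integral_add[symmetric]; rule integrable_p_cos; measurable)
  also have "\<dots> = (\<integral>z. (2 * cos (\<xi> \<bullet> x)) * (p z * cos (\<xi> \<bullet> z)) \<partial>lborel)"
    by (simp add: inner_diff_right inner_add_right cos_diff cos_add algebra_simps)
  also have "\<dots> = 2 * cos (\<xi> \<bullet> x) * four \<xi>"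
    by (simp add: four_def)
  finally show ?thesis by simp
qed

text \<open>The cosine series is integrated term by term. Since \<open>p\<close> lives on the unit
  ball, every moment is at most the L^1 norm of \<open>p\<close>, so the coefficients decay like
  \<open>1 / n!\<close> and the series converges everywhere.\<close>

lemma four_power_series:
  assumes b: "b \<in> Basis"
  defines "a \<equiv> (\<lambda>n. cos_coeff n * (\<integral>y. p y * (y \<bullet> b) ^ n \<partial>lborel))"
  shows "(\<lambda>n. a n * s ^ n) sums four (s *\<^sub>R b)"
    and "\<bar>a n\<bar> \<le> (\<integral>y. \<bar>p y\<bar> \<partial>lborel) * inverse (fact n)"
proof -
  let ?N = "\<integral>y. \<bar>p y\<bar> \<partial>lborel"
  have co: "\<bar>cos_coeff n\<bar> \<le> inverse (fact n)" for n
    by (simp add: cos_coeff_def field_simps)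
  have pw: "\<bar>p y * (y \<bullet> b) ^ n\<bar> \<le> \<bar>p y\<bar>" for y n
  proof (cases "1 < norm y")
    case False
    then have "\<bar>y \<bullet> b\<bar> \<le> 1" using Basis_le_norm[OF b, of y] by linarith
    then have "\<bar>y \<bullet> b\<bar> ^ n \<le> 1" by (intro power_le_one) auto
    then show ?thesis by (simp add: abs_mult power_abs mult_left_le)
  qed (simp add: supp)
  have int: "integrable lborel (\<lambda>y. p y * (y \<bullet> b) ^ n)" for n
    by (rule Bochner_Integration.integrable_bound[OF p_int]) (use pw in auto)
  have M: "\<bar>\<integral>y. p y * (y \<bullet> b) ^ n \<partial>lborel\<bar> \<le> ?N" for n
    by (rule order_trans[OF integral_abs_bound integral_mono]) (use pw int p_int in auto)
  have abs_int: "(\<integral>y. \<bar>p y * (y \<bullet> b) ^ n\<bar> \<partial>lborel) \<le> ?N" for n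
    by (rule integral_mono) (use pw int p_int in auto)
  show "\<bar>a n\<bar> \<le> ?N * inverse (fact n)"
    unfolding a_def abs_mult using mult_mono[OF co[of n] M[of n]] by (simp add: mult.commute)
  let ?f = "\<lambda>n y. (cos_coeff n * s ^ n) * (p y * (y \<bullet> b) ^ n)"
  have bd: "\<bar>cos_coeff n * s ^ n\<bar> \<le> \<bar>s\<bar> ^ n * inverse (fact n)" for n
    using mult_right_mono[OF co[of n], of "\<bar>s\<bar> ^ n"] by (simp add: abs_mult power_abs mult.commute)
  have se: "summable (\<lambda>n. \<bar>s\<bar> ^ n * inverse (fact n))"
    using summable_exp[of "\<bar>s\<bar>"] by (simp add: mult.commute)
  have "(\<lambda>n. \<integral>y. ?f n y \<partial>lborel) sums (\<integral>y. (\<Sum>n. ?f n y) \<partial>lborel)"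
  proof (rule sums_integral)
    show "integrable lborel (?f n)" for n
      by (intro integrable_mult_right int)
    show "AE y in lborel. summable (\<lambda>n. norm (?f n y))"
    proof (rule AE_I2)
      fix y
      show "summable (\<lambda>n. norm (?f n y))"
      proof (rule summable_comparison_test')
        show "summable (\<lambda>n. (\<bar>s\<bar> ^ n * inverse (fact n)) * \<bar>p y\<bar>)" by (intro summable_mult2 se)
        show "norm (norm (?f n y)) \<le> (\<bar>s\<bar> ^ n * inverse (fact n)) * \<bar>p y\<bar>" for n
          using mult_mono[OF bd[of n] pw[of y n]] by (simp add: abs_mult)
      qed
    qed
    show "summable (\<lambda>n. \<integral>y. norm (?f n y) \<partial>lborel)"
    proof (rule summable_comparison_test')
      show "summable (\<lambda>n. (\<bar>s\<bar> ^ n * inverse (fact n)) * ?N)" by (intro summable_mult2 se)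
      fix n :: nat
      have "(\<integral>y. norm (?f n y) \<partial>lborel) = \<bar>cos_coeff n * s ^ n\<bar> * (\<integral>y. \<bar>p y * (y \<bullet> b) ^ n\<bar> \<partial>lborel)"
        unfolding real_norm_def abs_mult[of "cos_coeff n * s ^ n"] by (rule integral_mult_right_zero)
      also have "\<dots> \<le> (\<bar>s\<bar> ^ n * inverse (fact n)) * ?N"
        by (rule mult_mono[OF bd abs_int]) auto
      finally show "norm (\<integral>y. norm (?f n y) \<partial>lborel) \<le> (\<bar>s\<bar> ^ n * inverse (fact n)) * ?N"
        by simp
    qed
  qed
  moreover have "(\<Sum>n. ?f n y) = p y * cos ((s *\<^sub>R b) \<bullet> y)" for y
  proof -
    have "(\<lambda>n. p y * (cos_coeff n *\<^sub>R (s * (b \<bullet> y)) ^ n)) sums (p y * cos (s * (b \<bullet> y)))"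
      by (intro sums_mult cos_converges)
    then show ?thesis
      by (simp add: sums_iff power_mult_distrib inner_commute mult_ac)
  qed
  moreover have "(\<integral>y. ?f n y \<partial>lborel) = a n * s ^ n" for n
    by (simp add: a_def)
  ultimately show "(\<lambda>n. a n * s ^ n) sums four (s *\<^sub>R b)"
    by (simp only: four_def)
qed

text \<open>The same coefficients define an entire function \<open>F\<close> that extends
  \<open>four\<close> from the axis to the complex plane. Its value at 0 is the integral of
  \<open>p\<close>, so \<open>F\<close> is not identically zero and has only countably many
  zeros.\<close>

lemma four_zeros_on_axis:
  assumes b: "b \<in> Basis"
  shows "countable {s. four (s *\<^sub>R b) = 0}"
proof -
  define a where "a n = cos_coeff n * (\<integral>y. p y * (y \<bullet> b) ^ n \<partial>lborel)" for n
  define F where "F z = (\<Sum>n. complex_of_real (a n) * z ^ n)" for z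
  have ps: "(\<lambda>n. a n * s ^ n) sums four (s *\<^sub>R b)" and bd: "\<bar>a n\<bar> \<le> (\<integral>y. \<bar>p y\<bar> \<partial>lborel) * inverse (fact n)" for s n
    using four_power_series[OF b] by (auto simp: a_def)
  have sF: "(\<lambda>n. complex_of_real (a n) * z ^ n) sums F z" for z
  proof -
    have "summable (\<lambda>n. complex_of_real (a n) * z ^ n)"
    proof (rule summable_comparison_test')
      show "summable (\<lambda>n. (\<integral>y. \<bar>p y\<bar> \<partial>lborel) * (inverse (fact n) * norm z ^ n))"
        by (intro summable_mult summable_exp)
      show "norm (complex_of_real (a n) * z ^ n) \<le> (\<integral>y. \<bar>p y\<bar> \<partial>lborel) * (inverse (fact n) * norm z ^ n)" for n
        using mult_right_mono[OF bd[of n], of "norm z ^ n"] by (simp add: norm_mult norm_power mult.assoc)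
    qed
    then show ?thesis unfolding F_def by (rule summable_sums)
  qed
  have holb: "F holomorphic_on ball 0 r" for r
    by (rule power_series_holomorphic[where a="\<lambda>n. complex_of_real (a n)"]) (unfold diff_zero, rule sF)
  have "F field_differentiable at z" for z
    by (rule holomorphic_on_imp_differentiable_at[OF holb[of "norm z + 1"]]) simp_all
  then have hol: "F holomorphic_on UNIV"
    by (simp add: holomorphic_on_def)
  have Fr: "F (complex_of_real s) = complex_of_real (four (s *\<^sub>R b))" for s
  proof -
    have "(\<lambda>n. complex_of_real (a n) * complex_of_real s ^ n) sums complex_of_real (four (s *\<^sub>R b))"
      using sums_of_real[OF ps[of s], where 'a=complex] by simp
    then show ?thesis using sF sums_unique2 by blast
  qed
  have F0: "F 0 \<noteq> 0"
    using Fr[of 0] integral_nonzero by (simp add: four_def)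
  have "countable {z. F z = 0}"
  proof (cases "F constant_on UNIV")
    case True
    then have "{z. F z = 0} = {}" using F0 by (auto simp: constant_on_def)
    then show ?thesis by simp
  next
    case False
    then show ?thesis
      using holomorphic_countable_zeros[OF hol open_UNIV connected_UNIV fsigma_UNIV False] by simp
  qed
  then have "countable (Re ` {z. F z = 0})"
    by (rule countable_image)
  moreover have "{s. four (s *\<^sub>R b) = 0} \<subseteq> Re ` {z. F z = 0}"
  proof
    fix s assume "s \<in> {s. four (s *\<^sub>R b) = 0}"
    then have "F (complex_of_real s) = 0" by (simp add: Fr)
    then show "s \<in> Re ` {z. F z = 0}"
      by (intro image_eqI[where x="complex_of_real s"]) auto
  qed
  ultimately show ?thesis
    by (rule countable_subset[rotated])
qed

lemma four_AE_nonzero: "AE \<xi> in lborel. four \<xi> \<noteq> 0"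
proof -
  obtain b :: 'a where b: "b \<in> Basis" using nonempty_Basis by blast
  have "AE \<xi> in lborel. \<forall>s\<in>{s. four (s *\<^sub>R b) = 0}. norm (\<xi> :: 'a) \<noteq> s"
    using AE_norm_neq by (subst AE_ball_countable[OF four_zeros_on_axis[OF b]]) blast
  then show ?thesis
  proof eventually_elim
    case (elim \<xi>)
    have "four \<xi> = four (norm \<xi> *\<^sub>R b)" using b by (intro four_radial) simp
    then show ?case using elim by auto
  qed
qed

text \<open>By \<open>convolution_cos\<close>, the transform of \<open>A * four\<close> is the
  convolution of \<open>p\<close> with the transform \<open>C\<close> of \<open>A\<close>; Fubini
  hands \<open>p\<close> over to \<open>g\<close>, where \<open>g0\<close> makes it vanish. Absolute
  convergence comes from \<open>p\<close> in L^1 and \<open>g\<close>, \<open>C\<close> in L^2, the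
  latter by \<open>Plancherel_upper_bound\<close>.\<close>

lemma kernel_orthogonal_multiplier:
  fixes A g :: "'a \<Rightarrow> real"
  assumes [measurable]: "g \<in> borel_measurable borel" and g2: "integrable lborel (\<lambda>x. (g x)\<^sup>2)"
    and g0: "\<And>x. (\<integral>y. p (x - y) * g y \<partial>lborel) = 0"
    and A: "integrable lborel A" and A2: "integrable lborel (\<lambda>x. (A x)\<^sup>2)"
  shows "(\<integral>x. g x * (\<integral>\<xi>. A \<xi> * four \<xi> * cos (\<xi> \<bullet> x) \<partial>lborel) \<partial>lborel) = 0"
proof -
  note [measurable] = borel_measurable_integrable[OF A]
  define C where "C y = (\<integral>\<xi>. A \<xi> * cos (\<xi> \<bullet> y) \<partial>lborel)" for y
  have [measurable]: "C \<in> borel_measurable borel" unfolding C_def by measurable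
  have D: "(\<integral>\<xi>. A \<xi> * four \<xi> * cos (\<xi> \<bullet> x) \<partial>lborel) = (\<integral>y. p (x - y) * C y \<partial>lborel)" for x
  proof -
    have "(\<integral>\<xi>. A \<xi> * four \<xi> * cos (\<xi> \<bullet> x) \<partial>lborel) = (\<integral>\<xi>. A \<xi> * (\<integral>y. p (x - y) * cos (\<xi> \<bullet> y) \<partial>lborel) \<partial>lborel)"
      by (simp only: convolution_cos mult.assoc)
    also have "\<dots> = (\<integral>y. p (x - y) * (\<integral>\<xi>. A \<xi> * cos (\<xi> \<bullet> y) \<partial>lborel) \<partial>lborel)"
      by (rule lborel_kernel_swap[OF A integrable_lborel_minus[OF p_int]]) auto
    finally show ?thesis by (simp only: C_def)
  qed
  have C2: "(\<integral>\<^sup>+x. ennreal ((C x)\<^sup>2) \<partial>lborel) < \<infinity>"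
    using Plancherel_upper_bound[OF A A2] unfolding C_def[symmetric] by (rule le_less_trans) simp
  have G2: "(\<integral>\<^sup>+x. ennreal ((g x)\<^sup>2) \<partial>lborel) < \<infinity>"
    by (simp add: nn_integral_eq_integral[OF g2])
  have p1: "(\<integral>\<^sup>+y. ennreal \<bar>p y\<bar> \<partial>lborel) < \<infinity>"
    using p_int by (simp add: integrable_iff_bounded)
  have pa: "(\<integral>\<^sup>+y. ennreal \<bar>p (x - y)\<bar> \<partial>lborel) = (\<integral>\<^sup>+y. ennreal \<bar>p y\<bar> \<partial>lborel)" for x
    by (rule nn_integral_lborel_minus[where f="\<lambda>y. ennreal \<bar>p y\<bar>"]) measurable
  have pb: "(\<integral>\<^sup>+x. ennreal \<bar>p (x - y)\<bar> \<partial>lborel) = (\<integral>\<^sup>+x. ennreal \<bar>p x\<bar> \<partial>lborel)" for y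
    using pa[of y] radial[of "x - y" "y - x" for x] by (simp add: norm_minus_commute)
  have "(\<integral>\<^sup>+x. (\<integral>\<^sup>+y. ennreal \<bar>g x * (p (x - y) * C y)\<bar> \<partial>lborel) \<partial>lborel)
      \<le> (\<integral>\<^sup>+x. (\<integral>\<^sup>+y. ennreal ((g x)\<^sup>2) * ennreal \<bar>p (x - y)\<bar> + ennreal ((C y)\<^sup>2) * ennreal \<bar>p (x - y)\<bar> \<partial>lborel) \<partial>lborel)"
  proof (intro nn_integral_mono)
    fix x y
    have "0 \<le> (\<bar>g x\<bar> - \<bar>C y\<bar>)\<^sup>2" by simp
    then have "2 * (\<bar>g x\<bar> * \<bar>C y\<bar>) \<le> (g x)\<^sup>2 + (C y)\<^sup>2" by (simp add: power2_diff)
    moreover have "0 \<le> \<bar>g x\<bar> * \<bar>C y\<bar>" by simp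
    ultimately have "\<bar>g x\<bar> * \<bar>C y\<bar> \<le> (g x)\<^sup>2 + (C y)\<^sup>2" by linarith
    from mult_right_mono[OF this, of "\<bar>p (x - y)\<bar>"]
    have "\<bar>g x * (p (x - y) * C y)\<bar> \<le> (g x)\<^sup>2 * \<bar>p (x - y)\<bar> + (C y)\<^sup>2 * \<bar>p (x - y)\<bar>"
      by (simp add: abs_mult algebra_simps)
    from ennreal_leI[OF this] show "ennreal \<bar>g x * (p (x - y) * C y)\<bar>
        \<le> ennreal ((g x)\<^sup>2) * ennreal \<bar>p (x - y)\<bar> + ennreal ((C y)\<^sup>2) * ennreal \<bar>p (x - y)\<bar>"
      by (simp add: ennreal_mult')
  qed
  also have "\<dots> = (\<integral>\<^sup>+x. (\<integral>\<^sup>+y. ennreal ((g x)\<^sup>2) * ennreal \<bar>p (x - y)\<bar> \<partial>lborel) \<partial>lborel)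
      + (\<integral>\<^sup>+x. (\<integral>\<^sup>+y. ennreal ((C y)\<^sup>2) * ennreal \<bar>p (x - y)\<bar> \<partial>lborel) \<partial>lborel)"
    by (simp add: nn_integral_add)
  also have "(\<integral>\<^sup>+x. (\<integral>\<^sup>+y. ennreal ((C y)\<^sup>2) * ennreal \<bar>p (x - y)\<bar> \<partial>lborel) \<partial>lborel)
      = (\<integral>\<^sup>+y. (\<integral>\<^sup>+x. ennreal ((C y)\<^sup>2) * ennreal \<bar>p (x - y)\<bar> \<partial>lborel) \<partial>lborel)"
    by (rule lborel_pair.Fubini') measurable
  also have "(\<integral>\<^sup>+x. (\<integral>\<^sup>+y. ennreal ((g x)\<^sup>2) * ennreal \<bar>p (x - y)\<bar> \<partial>lborel) \<partial>lborel) + \<dots> < \<infinity>"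
    using C2 G2 p1 by (simp add: nn_integral_cmult nn_integral_multc pa pb ennreal_mult_less_top)
  finally have fin: "(\<integral>\<^sup>+x. (\<integral>\<^sup>+y. ennreal \<bar>g x * (p (x - y) * C y)\<bar> \<partial>lborel) \<partial>lborel) < \<infinity>" .
  have "(\<integral>x. g x * (\<integral>y. p (x - y) * C y \<partial>lborel) \<partial>lborel) = (\<integral>x. (\<integral>y. g x * (p (x - y) * C y) \<partial>lborel) \<partial>lborel)"
    by simp
  also have "\<dots> = (\<integral>y. (\<integral>x. g x * (p (x - y) * C y) \<partial>lborel) \<partial>lborel)"
    by (rule lborel_Fubini_swap[OF _ fin]) measurable
  also have "\<dots> = (\<integral>y. (\<integral>x. (p (y - x) * g x) * C y \<partial>lborel) \<partial>lborel)"
    using radial[of "x - y" "y - x" for x y] by (simp add: norm_minus_commute mult_ac)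
  also have "\<dots> = 0" by (simp only: integral_mult_left_zero g0) simp
  finally show ?thesis by (simp only: D)
qed

text \<open>
  The Gaussian \<open>\<eta>\<close> is split as \<open>A n * four + R n\<close>, where \<open>A n = \<eta> / four\<close> off the set on which \<open>four\<close>
  is small. The first part is orthogonal to \<open>g\<close>; the transform of the second one tends to zero in \<open>L\<^sup>2\<close>.
\<close>

lemma kernel_orthogonal_gaussian:
  fixes g :: "'a \<Rightarrow> real"
  assumes [measurable]: "g \<in> borel_measurable borel" and g2: "integrable lborel (\<lambda>x. (g x)\<^sup>2)"
    and g0: "\<And>x. (\<integral>y. p (x - y) * g y \<partial>lborel) = 0" and a: "0 < a"
  shows "(\<integral>x. g x * exp (- (norm x)\<^sup>2 / (2 * a)) \<partial>lborel) = 0"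
proof -
  define \<eta> where "\<eta> \<xi> = exp (- a * (norm \<xi>)\<^sup>2 / 2)" for \<xi> :: 'a
  have [measurable]: "\<eta> \<in> borel_measurable borel" unfolding \<eta>_def by measurable
  have \<eta>_int: "integrable lborel \<eta>" unfolding \<eta>_def by (rule integrable_gaussian[OF a])
  have \<eta>2_int: "integrable lborel (\<lambda>\<xi>. (\<eta> \<xi>)\<^sup>2)"
    using integrable_gaussian[of "2 * a", where 'a='a] a
    by (simp add: \<eta>_def power2_eq_square exp_add[symmetric] algebra_simps)
  have \<eta>0: "0 \<le> \<eta> \<xi>" for \<xi> by (simp add: \<eta>_def)
  define S where "S n = {\<xi>. \<bar>four \<xi>\<bar> > 1 / real (Suc n)}" for n
  have [measurable]: "S n \<in> sets borel" for n
    unfolding S_def by measurable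
  define A where "A n \<xi> = indicator (S n) \<xi> * (\<eta> \<xi> / four \<xi>)" for n \<xi>
  define R where "R n \<xi> = indicator (- S n) \<xi> * \<eta> \<xi>" for n \<xi>
  have [measurable]: "A n \<in> borel_measurable borel" "R n \<in> borel_measurable borel" for n
    unfolding A_def R_def by measurable
  have A_bd: "\<bar>A n \<xi>\<bar> \<le> real (Suc n) * \<eta> \<xi>" for n \<xi>
  proof (cases "\<xi> \<in> S n")
    case True
    then have f: "1 / real (Suc n) < \<bar>four \<xi>\<bar>" by (simp add: S_def)
    have "0 < 1 / real (Suc n)" by simp
    then have "0 < \<bar>four \<xi>\<bar>" using f by (rule less_trans)
    moreover have "1 < \<bar>four \<xi>\<bar> * real (Suc n)"
      using f by (simp only: pos_divide_less_eq of_nat_0_less_iff zero_less_Suc)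
    ultimately have "1 / \<bar>four \<xi>\<bar> \<le> real (Suc n)"
      by (simp only: pos_divide_le_eq mult.commute[of "real (Suc n)"] less_imp_le)
    from mult_right_mono[OF this \<eta>0[of \<xi>]] show ?thesis
      using True \<eta>0 by (simp add: A_def)
  qed (simp add: A_def \<eta>0)
  have A_int: "integrable lborel (A n)" for n
  proof (rule Bochner_Integration.integrable_bound[OF integrable_mult_right[OF \<eta>_int, of "real (Suc n)"]])
    show "AE \<xi> in lborel. norm (A n \<xi>) \<le> norm (real (Suc n) * \<eta> \<xi>)"
      unfolding real_norm_def by (intro AE_I2 order_trans[OF A_bd abs_ge_self])
  qed measurable
  have A2_int: "integrable lborel (\<lambda>\<xi>. (A n \<xi>)\<^sup>2)" for n
  proof (rule Bochner_Integration.integrable_bound[OF integrable_mult_right[OF \<eta>2_int, of "(real (Suc n))\<^sup>2"]])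
    show "AE \<xi> in lborel. norm ((A n \<xi>)\<^sup>2) \<le> norm ((real (Suc n))\<^sup>2 * (\<eta> \<xi>)\<^sup>2)"
    proof (rule AE_I2)
      fix \<xi>
      have "\<bar>A n \<xi>\<bar>\<^sup>2 \<le> (real (Suc n) * \<eta> \<xi>)\<^sup>2"
        by (intro power_mono A_bd) auto
      then show "norm ((A n \<xi>)\<^sup>2) \<le> norm ((real (Suc n))\<^sup>2 * (\<eta> \<xi>)\<^sup>2)"
        by (simp only: power2_abs power_mult_distrib real_norm_def abs_mult) simp
    qed
  qed measurable
  have R_int: "integrable lborel (R n)" for n
    by (rule Bochner_Integration.integrable_bound[OF \<eta>_int]) (auto simp: R_def indicator_def)
  have R2_int: "integrable lborel (\<lambda>\<xi>. (R n \<xi>)\<^sup>2)" for n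
    by (rule Bochner_Integration.integrable_bound[OF \<eta>2_int]) (auto simp: R_def indicator_def)
  have split: "\<eta> \<xi> = A n \<xi> * four \<xi> + R n \<xi>" for n \<xi>
    using a by (auto simp: A_def R_def S_def indicator_def)
  have R_lim: "(\<lambda>n. \<integral>\<xi>. (R n \<xi>)\<^sup>2 \<partial>lborel) \<longlonglongrightarrow> (\<integral>(\<xi>::'a). 0 \<partial>lborel)"
  proof (rule integral_dominated_convergence[OF _ _ \<eta>2_int])
    show "AE \<xi> in lborel. (\<lambda>n. (R n \<xi>)\<^sup>2) \<longlonglongrightarrow> 0"
      using four_AE_nonzero
    proof eventually_elim
      case (elim \<xi>)
      have "\<forall>\<^sub>F n in sequentially. 1 / real (Suc n) < \<bar>four \<xi>\<bar>"
        using elim by (intro order_tendstoD(2)[OF LIMSEQ_Suc[OF lim_1_over_n]]) auto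
      then have "\<forall>\<^sub>F n in sequentially. (R n \<xi>)\<^sup>2 = 0"
        by eventually_elim (simp add: R_def S_def)
      then show ?case by (rule tendsto_eventually)
    qed
  qed (auto simp: R_def indicator_def)
  define W where "W n x = (\<integral>\<xi>. R n \<xi> * cos (\<xi> \<bullet> x) \<partial>lborel)" for n x
  have [measurable]: "W n \<in> borel_measurable borel" for n unfolding W_def by measurable
  define E where "E n = (2 * pi) ^ DIM('a) * (\<integral>\<xi>. (R n \<xi>)\<^sup>2 \<partial>lborel)" for n
  have E0: "0 \<le> E n" for n
    unfolding E_def by (intro mult_nonneg_nonneg Bochner_Integration.integral_nonneg) auto
  have W2: "(\<integral>\<^sup>+x. ennreal ((W n x)\<^sup>2) \<partial>lborel) \<le> ennreal (E n)" for n
    unfolding W_def E_def by (rule Plancherel_upper_bound[OF R_int R2_int])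
  have W2_int: "integrable lborel (\<lambda>x. (W n x)\<^sup>2)" for n
    by (rule integrableI_bounded) (use le_less_trans[OF W2] in auto)
  have W2_le: "(\<integral>x. (W n x)\<^sup>2 \<partial>lborel) \<le> E n" for n
    using W2[of n] E0[of n] by (simp add: nn_integral_eq_integral[OF W2_int])
  let ?c = "sqrt (2 * pi / a) ^ DIM('a)"
  have c: "0 < ?c" using a by simp
  have \<eta>_hat: "?c * exp (- (norm x)\<^sup>2 / (2 * a)) = (\<integral>\<xi>. A n \<xi> * four \<xi> * cos (\<xi> \<bullet> x) \<partial>lborel) + W n x" for n x
  proof -
    have i1: "integrable lborel (\<lambda>\<xi>. A n \<xi> * four \<xi> * cos (\<xi> \<bullet> x))"
      by (rule Bochner_Integration.integrable_bound[OF \<eta>_int])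
         (auto simp: A_def indicator_def abs_mult \<eta>0 intro!: mult_left_le)
    have i2: "integrable lborel (\<lambda>\<xi>. R n \<xi> * cos (\<xi> \<bullet> x))"
      by (rule Bochner_Integration.integrable_bound[OF R_int[of n]]) (auto simp: abs_mult intro!: mult_left_le)
    have "?c * exp (- (norm x)\<^sup>2 / (2 * a)) = (\<integral>\<xi>. \<eta> \<xi> * cos (\<xi> \<bullet> x) \<partial>lborel)"
      using gaussian_cos[OF a, of x] by (simp only: \<eta>_def inner_commute[of _ x])
    also have "\<dots> = (\<integral>\<xi>. A n \<xi> * four \<xi> * cos (\<xi> \<bullet> x) + R n \<xi> * cos (\<xi> \<bullet> x) \<partial>lborel)"
      by (subst split[of _ n]) (simp only: distrib_right)
    also have "\<dots> = (\<integral>\<xi>. A n \<xi> * four \<xi> * cos (\<xi> \<bullet> x) \<partial>lborel) + W n x"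
      unfolding W_def by (rule Bochner_Integration.integral_add[OF i1 i2])
    finally show ?thesis .
  qed
  let ?e = "\<lambda>x::'a. exp (- (norm x)\<^sup>2 / (2 * a))"
  define I where "I = (\<integral>x. g x * ?e x \<partial>lborel)"
  have gW_int: "integrable lborel (\<lambda>x. g x * W n x)" for n
    by (rule square_integrable_mult) (use g2 W2_int in \<open>auto simp: square_integrable_def\<close>)
  have ge_int: "integrable lborel (\<lambda>x. g x * ?e x)"
  proof (rule square_integrable_mult)
    have "integrable lborel (\<lambda>x::'a. exp (- (2 / a) * (norm x)\<^sup>2 / 2))"
      using a by (intro integrable_gaussian) auto
    moreover have "exp (- (2 / a) * (norm x)\<^sup>2 / 2) = (?e x)\<^sup>2" for x
      by (simp add: power2_eq_square exp_add[symmetric])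
    ultimately show "?e \<in> square_integrable lborel"
      by (simp add: square_integrable_def)
  qed (use g2 in \<open>auto simp: square_integrable_def\<close>)
  \<comment> \<open>The pairing of \<open>g\<close> with \<open>W n\<close> is thus the same for all
    \<open>n\<close>, although \<open>W n\<close> tends to 0 in L^2. Expanding the square of
    \<open>t * g - W n\<close> and letting \<open>n\<close> grow turns this into a bound linear
    against quadratic in \<open>t\<close>, which forces \<open>I = 0\<close>.\<close>
  have I_eq: "?c * I = (\<integral>x. g x * W n x \<partial>lborel)" for n
  proof -
    have "g x * (\<integral>\<xi>. A n \<xi> * four \<xi> * cos (\<xi> \<bullet> x) \<partial>lborel) = ?c * (g x * ?e x) - g x * W n x" for x
      using \<eta>_hat[of x n] by (simp add: algebra_simps)
    then have "0 = (\<integral>x. ?c * (g x * ?e x) - g x * W n x \<partial>lborel)"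
      using kernel_orthogonal_multiplier[OF _ g2 g0 A_int A2_int, of n] by simp
    also have "\<dots> = ?c * I - (\<integral>x. g x * W n x \<partial>lborel)"
      unfolding I_def integral_mult_right_zero[symmetric]
      by (rule Bochner_Integration.integral_diff[OF integrable_mult_right[OF ge_int] gW_int])
    finally show ?thesis by simp
  qed
  have E_lim: "E \<longlonglongrightarrow> 0"
    using tendsto_mult_left[OF R_lim, of "(2 * pi) ^ DIM('a)"] unfolding E_def by simp
  have "2 * t * (?c * I) \<le> t\<^sup>2 * (\<integral>x. (g x)\<^sup>2 \<partial>lborel)" for t
  proof -
    have "2 * t * (?c * I) \<le> t\<^sup>2 * (\<integral>x. (g x)\<^sup>2 \<partial>lborel) + E n" for n
    proof -
      have "0 \<le> (\<integral>x. (t * g x - W n x)\<^sup>2 \<partial>lborel)"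
        by (rule Bochner_Integration.integral_nonneg) simp
      also have "\<dots> = (\<integral>x. t\<^sup>2 * (g x)\<^sup>2 - 2 * t * (g x * W n x) + (W n x)\<^sup>2 \<partial>lborel)"
        by (simp add: power2_diff power_mult_distrib algebra_simps)
      also have "\<dots> = t\<^sup>2 * (\<integral>x. (g x)\<^sup>2 \<partial>lborel) - 2 * t * (\<integral>x. g x * W n x \<partial>lborel) + (\<integral>x. (W n x)\<^sup>2 \<partial>lborel)"
        using g2 gW_int W2_int by simp
      finally show ?thesis using W2_le[of n] I_eq[of n] by simp
    qed
    moreover have "(\<lambda>n. t\<^sup>2 * (\<integral>x. (g x)\<^sup>2 \<partial>lborel) + E n) \<longlonglongrightarrow> t\<^sup>2 * (\<integral>x. (g x)\<^sup>2 \<partial>lborel) + 0"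
      by (intro tendsto_intros E_lim)
    ultimately show ?thesis
      by (intro LIMSEQ_le_const[where X="\<lambda>n. t\<^sup>2 * (\<integral>x. (g x)\<^sup>2 \<partial>lborel) + E n"]) auto
  qed
  then have "?c * I = 0"
    by (rule quadratic_bound_imp_zero[rotated]) (rule Bochner_Integration.integral_nonneg, simp)
  then show ?thesis using c a by (simp add: I_def)
qed

end

section \<open>From orthogonality to Gaussians to injectivity\<close>

lemma integral_lborel_scale:
  fixes f :: "'a::euclidean_space \<Rightarrow> real"
  assumes [measurable]: "f \<in> borel_measurable borel" and c: "c \<noteq> 0"
  shows "(\<integral>x. f x \<partial>lborel) = \<bar>c\<bar> ^ DIM('a) * (\<integral>x. f (c *\<^sub>R x) \<partial>lborel)"
proof -
  have "(\<integral>x. f x \<partial>lborel) = (\<integral>x. f x \<partial>density (distr lborel borel (\<lambda>x. 0 + c *\<^sub>R x)) (\<lambda>_. ennreal (\<bar>c\<bar> ^ DIM('a))))"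
    using lborel_affine[OF c, where t="0::'a"] by (simp add: ennreal_power[symmetric])
  also have "\<dots> = (\<integral>x. \<bar>c\<bar> ^ DIM('a) * f (c *\<^sub>R x) \<partial>lborel)"
    by (subst integral_density) (auto simp: integral_distr)
  finally show ?thesis by simp
qed

text \<open>\<open>ennreal\<close> cuts negative values to 0, so the two densities are the positive
  and the negative part of \<open>g\<close>. They agree on boxes, an intersection-stable generator,
  hence as measures; and \<open>ennreal t = ennreal (- t)\<close> holds only for
  \<open>t = 0\<close>.\<close>

lemma AE_eq_0_if_box_integrals_eq_0:
  fixes g :: "'a::euclidean_space \<Rightarrow> real"
  assumes [measurable]: "g \<in> borel_measurable borel"
    and int: "\<And>l u. integrable lborel (\<lambda>x. indicator (box l u) x * g x)"
    and zero: "\<And>l u. (\<integral>x. indicator (box l u) x * g x \<partial>lborel) = 0"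
  shows "AE x in lborel. g x = 0"
proof -
  let ?M = "density lborel (\<lambda>x. ennreal (g x))" and ?N = "density lborel (\<lambda>x. ennreal (- g x))"
  have em: "emeasure ?M (box l u) = (\<integral>\<^sup>+x. ennreal (indicator (box l u) x * g x) \<partial>lborel)"
    "emeasure ?N (box l u) = (\<integral>\<^sup>+x. ennreal (- (indicator (box l u) x * g x)) \<partial>lborel)" for l u
    by (subst emeasure_density, auto intro!: nn_integral_cong simp: indicator_def)+
  have fin: "(\<integral>\<^sup>+x. ennreal (indicator (box l u) x * g x) \<partial>lborel) \<noteq> \<infinity>"
    "(\<integral>\<^sup>+x. ennreal (- (indicator (box l u) x * g x)) \<partial>lborel) \<noteq> \<infinity>" for l u
    using int[of l u] by (auto simp: real_integrable_def)
  have eq: "emeasure ?M (box l u) = emeasure ?N (box l u)" for l u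
  proof -
    have "enn2real (\<integral>\<^sup>+x. ennreal (indicator (box l u) x * g x) \<partial>lborel)
        = enn2real (\<integral>\<^sup>+x. ennreal (- (indicator (box l u) x * g x)) \<partial>lborel)"
      using zero[of l u] by (simp add: real_lebesgue_integral_def[OF int])
    then show ?thesis
      unfolding em using fin[of l u]
      by (cases "\<integral>\<^sup>+x. ennreal (indicator (box l u) x * g x) \<partial>lborel";
          cases "\<integral>\<^sup>+x. ennreal (- (indicator (box l u) x * g x)) \<partial>lborel") simp_all
  qed
  have "?M = ?N"
  proof (rule measure_eqI_generator_eq)
    let ?E = "range (\<lambda>(a, b). box a b::'a set)"
    show "Int_stable ?E"
      by (auto simp: Int_stable_def box_Int_box)
    show "?E \<subseteq> Pow UNIV" "sets ?M = sigma_sets UNIV ?E" "sets ?N = sigma_sets UNIV ?E"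
      by (simp_all add: borel_eq_box)
    let ?A = "\<lambda>n::nat. box (- (real n *\<^sub>R One)) (real n *\<^sub>R One) :: 'a set"
    show "range ?A \<subseteq> ?E" "(\<Union>i. ?A i) = UNIV"
      unfolding UN_box_eq_UNIV by auto
    show "emeasure ?M (?A i) \<noteq> \<infinity>" for i
      unfolding em by (rule fin)
    show "emeasure ?M X = emeasure ?N X" if "X \<in> ?E" for X
      using that eq by auto
  qed
  then have "AE x in lborel. ennreal (g x) = ennreal (- g x)"
    by (intro sigma_finite_measure.density_unique[OF sigma_finite_lborel]) auto
  then show ?thesis
  proof eventually_elim
    case (elim x)
    then show ?case
      by (cases "g x" "0::real" rule: linorder_cases) (auto simp: ennreal_neg)
  qed
qed

context radial_kernel
begin

text \<open>Translating \<open>g\<close> preserves \<open>g0\<close>, so \<open>g\<close> is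
  orthogonal to Gaussians with any centre. Shrinking a Gaussian to a point requires continuity,
  which \<open>g\<close> lacks; the limit is therefore taken on the integrals \<open>c\<close> of
  \<open>g\<close> over translated boxes.\<close>

lemma convolution_injective:
  fixes g :: "'a \<Rightarrow> real"
  assumes [measurable]: "g \<in> borel_measurable borel" and g2: "integrable lborel (\<lambda>x. (g x)\<^sup>2)"
    and g0: "\<And>x. (\<integral>y. p (x - y) * g y \<partial>lborel) = 0"
  shows "AE x in lborel. g x = 0"
proof (rule AE_eq_0_if_box_integrals_eq_0)
  have le: "\<bar>i * t\<bar> \<le> i + t\<^sup>2" if "i = 0 \<or> i = 1" for i t :: real
  proof -
    have "0 \<le> (\<bar>t\<bar> - 1)\<^sup>2 + t\<^sup>2 + 1" by simp
    then show ?thesis using that by (auto simp: power2_diff)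
  qed
  have ind: "indicator A x = 0 \<or> indicator A x = (1::real)" for A and x :: 'a
    by (simp add: indicator_def)
  have int_ind: "integrable lborel (\<lambda>x. indicator A x * g x)"
    if [measurable]: "A \<in> sets borel" and "emeasure lborel A < \<infinity>" for A
  proof (rule Bochner_Integration.integrable_bound)
    show "integrable lborel (\<lambda>x. indicator A x + (g x)\<^sup>2)"
      using that g2 by (intro Bochner_Integration.integrable_add) (auto simp: integrable_indicator_iff)
    show "AE x in lborel. norm (indicator A x * g x) \<le> norm (indicator A x + (g x)\<^sup>2)"
      unfolding real_norm_def by (intro AE_I2 order_trans[OF le[OF ind] abs_ge_self])
  qed measurable
  fix l u :: 'a
  define B where "B = box l u"
  have [measurable]: "B \<in> sets borel" by (simp add: B_def)
  have B_fin: "emeasure lborel B < \<infinity>" unfolding B_def by (rule emeasure_lborel_box_finite)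
  show "integrable lborel (\<lambda>x. indicator (box l u) x * g x)"
    using int_ind[OF _ B_fin] by (simp add: B_def)
  have ortho: "(\<integral>x. g (z + x) * exp (- (norm x)\<^sup>2 / (2 * a)) \<partial>lborel) = 0" if "0 < a" for z a
  proof (rule kernel_orthogonal_gaussian[OF _ _ _ that])
    have "integrable (distr lborel borel ((+) z)) (\<lambda>x. (g x)\<^sup>2)"
      using g2 by (simp add: lborel_distr_plus)
    then show "integrable lborel (\<lambda>x. (g (z + x))\<^sup>2)"
      by (subst (asm) integrable_distr_eq) auto
    show "(\<integral>y. p (x - y) * g (z + y) \<partial>lborel) = 0" for x
      using integral_lborel_shift[of "\<lambda>y. p ((z + x) - y) * g y" z] g0[of "z + x"] by simp
  qed measurable
  \<comment> \<open>\<open>c 0\<close> is the box integral in question, and \<open>c\<close> is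
    continuous because the boundary of a box is a null set.\<close>
  define c where "c v = (\<integral>x. indicator B (x - v) * g x \<partial>lborel)" for v
  define M where "M = measure lborel B + (\<integral>x. (g x)\<^sup>2 \<partial>lborel)"
  have c_cont: "continuous_on UNIV c"
  proof -
    obtain R where R: "\<And>x. x \<in> B \<Longrightarrow> norm x \<le> R"
      using bounded_box[of l u] by (auto simp: bounded_iff B_def)
    have "AE z in lborel. isCont (\<lambda>z. indicator B (- z) :: real) z"
    proof -
      have "negligible (frontier B)"
        unfolding B_def by (intro negligible_convex_frontier convex_box)
      then have "frontier B \<in> null_sets lborel"
        by (simp add: negligible_iff_null_sets null_sets_completion_iff)
      then have "AE z in lborel. z \<notin> frontier B"
        by (rule AE_not_in)
      then have "AE z in lborel. 0 - z \<notin> frontier B"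
        by (rule AE_lborel_minus)
      then show ?thesis
      proof eventually_elim
        case (elim z)
        then have "isCont (indicator B :: 'a \<Rightarrow> real) (- z)"
          by (simp add: isCont_indicator)
        then show ?case
          by (rule isCont_o2[rotated]) (intro continuous_intros)
      qed
    qed
    then have "continuous_on UNIV (\<lambda>v. \<integral>x. indicator B (- (v - x)) * g x \<partial>lborel)"
    proof (rule continuous_convolution[where C=1 and R=R, rotated 4])
      show "integrable lborel (\<lambda>y. indicator (cball 0 r) y * g y)" for r
        using int_ind[OF _ emeasure_lborel_cball_finite] by simp
      show "indicator B (- z) = (0::real)" if "R < norm z" for z
        using R[of "- z"] that by (auto simp: indicator_def)
    qed (auto simp: indicator_def)
    then show ?thesis by (simp add: c_def[abs_def])
  qed
  have c_bd: "\<bar>c v\<bar> \<le> M" for v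
  proof -
    have i: "integrable lborel (\<lambda>x. indicator B (x - v) :: real)"
    proof -
      have "integrable lborel (indicator B :: 'a \<Rightarrow> real)" using B_fin by (simp add: integrable_indicator_iff)
      then have "integrable (distr lborel borel ((+) (- v))) (indicator B :: 'a \<Rightarrow> real)"
        by (simp add: lborel_distr_plus)
      then show ?thesis by (subst (asm) integrable_distr_eq) auto
    qed
    have "\<bar>c v\<bar> \<le> (\<integral>x. \<bar>indicator B (x - v) * g x\<bar> \<partial>lborel)"
      unfolding c_def by (rule integral_abs_bound)
    also have "\<dots> \<le> (\<integral>x. indicator B (x - v) + (g x)\<^sup>2 \<partial>lborel)"
    proof (rule integral_mono_AE')
      show "integrable lborel (\<lambda>x. indicator B (x - v) + (g x)\<^sup>2)"
        by (intro Bochner_Integration.integrable_add i g2)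
      show "AE x in lborel. \<bar>indicator B (x - v) * g x\<bar> \<le> indicator B (x - v) + (g x)\<^sup>2"
        by (intro AE_I2 le ind)
    qed auto
    also have "\<dots> = (\<integral>x. indicator B (x - v) \<partial>lborel) + (\<integral>x. (g x)\<^sup>2 \<partial>lborel)"
      by (rule Bochner_Integration.integral_add[OF i g2])
    also have "(\<integral>x. indicator B (x - v) \<partial>lborel) = measure lborel B"
      using integral_lborel_shift[of "indicator B" "- v"] by simp
    finally show ?thesis by (simp add: M_def)
  qed
  \<comment> \<open>Fubini moves the box to the outside; for each fixed point of it, the inner
    integral is a translate of \<open>g\<close> against a centred Gaussian.\<close>
  have c_gauss: "(\<integral>v. exp (- (norm v)\<^sup>2 / (2 * a)) * c v \<partial>lborel) = 0" if a: "0 < a" for a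
  proof -
    let ?e = "\<lambda>v::'a. exp (- (norm v)\<^sup>2 / (2 * a))"
    have e_int: "integrable lborel ?e"
      using integrable_gaussian[of "1 / a", where 'a='a] a by (simp add: mult.commute)
    have shift: "c v = (\<integral>b. indicator B b * g (v + b) \<partial>lborel)" for v
      using integral_lborel_shift[of "\<lambda>x. indicator B (x - v) * g x" v] by (simp add: c_def)
    have fin: "(\<integral>\<^sup>+v. (\<integral>\<^sup>+b. ennreal \<bar>?e v * (indicator B b * g (v + b))\<bar> \<partial>lborel) \<partial>lborel) < \<infinity>"
    proof -
      have "(\<integral>\<^sup>+v. (\<integral>\<^sup>+b. ennreal \<bar>?e v * (indicator B b * g (v + b))\<bar> \<partial>lborel) \<partial>lborel)
          \<le> (\<integral>\<^sup>+v. (\<integral>\<^sup>+b. ennreal (?e v) * (indicator B b + ennreal ((g (v + b))\<^sup>2)) \<partial>lborel) \<partial>lborel)"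
      proof (intro nn_integral_mono)
        fix v b
        have "\<bar>?e v * (indicator B b * g (v + b))\<bar> \<le> ?e v * (indicator B b + (g (v + b))\<^sup>2)"
          unfolding abs_mult[of "?e v"] abs_exp_cancel by (intro mult_left_mono le ind) auto
        from ennreal_leI[OF this] show "ennreal \<bar>?e v * (indicator B b * g (v + b))\<bar>
            \<le> ennreal (?e v) * (indicator B b + ennreal ((g (v + b))\<^sup>2))"
          by (simp add: ennreal_mult' ennreal_indicator)
      qed
      also have "\<dots> = (\<integral>\<^sup>+v. ennreal (?e v) * (emeasure lborel B + (\<integral>\<^sup>+b. ennreal ((g b)\<^sup>2) \<partial>lborel)) \<partial>lborel)"
        using nn_integral_lborel_shift[of "\<lambda>x. ennreal ((g x)\<^sup>2)"]
        by (simp add: nn_integral_cmult nn_integral_add)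
      also have "\<dots> = (\<integral>\<^sup>+v. ennreal (?e v) \<partial>lborel) * (emeasure lborel B + (\<integral>\<^sup>+b. ennreal ((g b)\<^sup>2) \<partial>lborel))"
        by (rule nn_integral_multc) measurable
      also have "\<dots> < \<infinity>"
      proof -
        have "(\<integral>\<^sup>+v. ennreal (?e v) \<partial>lborel) < \<infinity>"
          by (subst nn_integral_eq_integral[OF e_int]) auto
        moreover have "emeasure lborel B + (\<integral>\<^sup>+b. ennreal ((g b)\<^sup>2) \<partial>lborel) < \<infinity>"
          using B_fin by (simp add: nn_integral_eq_integral[OF g2])
        ultimately show ?thesis
          by (simp only: infinity_ennreal_def ennreal_mult_less_top simp_thms)
      qed
      finally show ?thesis .
    qed
    have "(\<integral>v. ?e v * c v \<partial>lborel) = (\<integral>v. (\<integral>b. ?e v * (indicator B b * g (v + b)) \<partial>lborel) \<partial>lborel)"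
      by (simp add: shift)
    also have "\<dots> = (\<integral>b. (\<integral>v. ?e v * (indicator B b * g (v + b)) \<partial>lborel) \<partial>lborel)"
      by (rule lborel_Fubini_swap[OF _ fin]) measurable
    also have "\<dots> = (\<integral>b. (\<integral>v. indicator B b * (g (b + v) * ?e v) \<partial>lborel) \<partial>lborel)"
    proof -
      have "?e v * (indicator B b * g (v + b)) = indicator B b * (g (b + v) * ?e v)" for v b
        by (simp add: add.commute)
      then show ?thesis by (simp only:)
    qed
    also have "\<dots> = 0"
      by (simp only: integral_mult_right_zero ortho[OF a]) simp
    finally show ?thesis .
  qed
  have [measurable]: "c \<in> borel_measurable borel"
    by (rule borel_measurable_continuous_onI[OF c_cont])
  let ?G = "\<lambda>x::'a. exp (- 1 * (norm x)\<^sup>2 / 2)"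
  \<comment> \<open>The shrinking is carried by the argument of \<open>c\<close>, so the Gaussian
    stays fixed and dominates. Undoing the rescaling, each integral pairs \<open>c\<close> with a
    Gaussian of variance \<open>(1 / Suc n)^2\<close> and is 0 by \<open>c_gauss\<close>.\<close>
  have "(\<lambda>n. \<integral>x. ?G x * c ((1 / real (Suc n)) *\<^sub>R x) \<partial>lborel) \<longlonglongrightarrow> (\<integral>x. ?G x * c 0 \<partial>lborel)"
  proof (rule integral_dominated_convergence)
    show "integrable lborel (\<lambda>x. ?G x * M)"
      by (intro integrable_mult_left integrable_gaussian) simp
    show "AE x in lborel. (\<lambda>n. ?G x * c ((1 / real (Suc n)) *\<^sub>R x)) \<longlonglongrightarrow> ?G x * c 0"
    proof (rule AE_I2)
      fix x :: 'a
      have "(\<lambda>n. (1 / real (Suc n)) *\<^sub>R x) \<longlonglongrightarrow> 0 *\<^sub>R x"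
        by (intro tendsto_intros LIMSEQ_Suc[OF lim_1_over_n])
      then have "(\<lambda>n. c ((1 / real (Suc n)) *\<^sub>R x)) \<longlonglongrightarrow> c 0"
        using c_cont by (intro isCont_tendsto_compose[of 0 c]) (auto simp: continuous_on_eq_continuous_at)
      then show "(\<lambda>n. ?G x * c ((1 / real (Suc n)) *\<^sub>R x)) \<longlonglongrightarrow> ?G x * c 0"
        by (intro tendsto_intros)
    qed
    show "AE x in lborel. norm (?G x * c ((1 / real (Suc n)) *\<^sub>R x)) \<le> ?G x * M" for n
      using c_bd by (intro AE_I2) (simp add: abs_mult)
  qed measurable
  moreover have "(\<integral>x. ?G x * c ((1 / real (Suc n)) *\<^sub>R x) \<partial>lborel) = 0" for n
  proof -
    let ?k = "1 / real (Suc n)"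
    have k: "?k \<noteq> 0" "0 < ?k\<^sup>2" by auto
    let ?f = "\<lambda>v. exp (- (norm v)\<^sup>2 / (2 * ?k\<^sup>2)) * c v"
    have "0 = \<bar>?k\<bar> ^ DIM('a) * (\<integral>x. ?f (?k *\<^sub>R x) \<partial>lborel)"
      using integral_lborel_scale[of ?f ?k] k(1) c_gauss[OF k(2)] by simp
    then have "(\<integral>x. ?f (?k *\<^sub>R x) \<partial>lborel) = 0" by simp
    moreover have "- (norm (?k *\<^sub>R x))\<^sup>2 / (2 * ?k\<^sup>2) = - 1 * (norm x)\<^sup>2 / 2" for x :: 'a
      by (simp add: power_divide)
    ultimately show ?thesis by (simp only:)
  qed
  ultimately have "(\<integral>x. ?G x * c 0 \<partial>lborel) = 0"
    by (simp add: LIMSEQ_const_iff)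
  then have "c 0 = 0"
    using integral_gaussian[of 1, where 'a='a] by simp
  then show "(\<integral>x. indicator (box l u) x * g x \<partial>lborel) = 0"
    by (simp add: c_def B_def)
qed measurable

end

section \<open>The native space\<close>

lemma L2_eq_square_integrable: "L2 = square_integrable lebesgue"
  by (simp add: L2_def square_integrable_def)

lemma square_integrable_lebesgueI:
  fixes f :: "'a::euclidean_space \<Rightarrow> real"
  assumes "f \<in> square_integrable lborel"
  shows "f \<in> square_integrable lebesgue"
  using assms unfolding square_integrable_def
  by (auto simp: integrable_completion measurable_completion)

text \<open>Members of \<open>L2\<close> are Lebesgue measurable, while the injectivity argument
  runs over Borel functions; convolution integrals do not see the difference.\<close>

lemma square_integrable_lebesgue_borel_rep:
  fixes f :: "'a::euclidean_space \<Rightarrow> real"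
  assumes "f \<in> square_integrable lebesgue"
  obtains f' where "f' \<in> square_integrable lborel" "AE x in lebesgue. f x = f' x"
proof -
  obtain f' where [measurable]: "f' \<in> borel_measurable lborel" and eq: "AE x in lborel. f x = f' x"
    using completion_ex_borel_measurable_real[OF square_integrableD(1)[OF assms]] by blast
  have eq': "AE x in lebesgue. f x = f' x" using eq by (rule AE_completion)
  have [measurable]: "f' \<in> borel_measurable lebesgue" "f \<in> borel_measurable lebesgue"
    using square_integrableD(1)[OF assms] by (auto intro: measurable_completion)
  have "integrable lebesgue (\<lambda>x. (f' x)\<^sup>2)"
    using square_integrableD(2)[OF assms]
    by (rule integrable_cong_AE_imp) (use eq' in auto)
  then have "f' \<in> square_integrable lborel"
    by (simp add: square_integrable_def integrable_completion)
  then show ?thesis using eq' that by blast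
qed

text \<open>Square integrability of \<open>p\<close> makes \<open>conv p g x\<close> an absolutely
  convergent integral at every point \<open>x\<close>, so the range consists of genuine functions,
  and it puts the translates of \<open>p\<close> into the domain of the convolution.\<close>

locale square_radial_kernel = radial_kernel p for p :: "'a::euclidean_space \<Rightarrow> real" +
  assumes p2_int: "integrable lborel (\<lambda>x. (p x)\<^sup>2)"
begin

lemma p_minus: "p (x - y) = p (y - x)"
  by (rule radial) (rule norm_minus_commute)

lemma translate_square_integrable: "(\<lambda>y. p (x - y)) \<in> square_integrable lebesgue"
  by (rule square_integrable_lebesgueI)
     (simp add: square_integrable_def integrable_lborel_minus[OF p2_int])

lemma conv_integrable: "g \<in> square_integrable lebesgue \<Longrightarrow> integrable lebesgue (\<lambda>y. p (x - y) * g y)"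
  by (rule square_integrable_mult[OF translate_square_integrable])

lemma conv_lin:
  assumes "g \<in> square_integrable lebesgue" "h \<in> square_integrable lebesgue"
  shows "conv p (\<lambda>x. g x + c * h x) = (\<lambda>x. conv p g x + c * conv p h x)"
proof
  fix x
  have "conv p (\<lambda>x. g x + c * h x) x = (\<integral>y. p (x - y) * g y + c * (p (x - y) * h y) \<partial>lebesgue)"
    by (simp add: conv_def algebra_simps)
  also have "\<dots> = conv p g x + c * conv p h x"
    using conv_integrable[OF assms(1), of x] conv_integrable[OF assms(2), of x] by (simp add: conv_def)
  finally show "conv p (\<lambda>x. g x + c * h x) x = conv p g x + c * conv p h x" .
qed

lemma conv_cong_AE:
  assumes "g \<in> square_integrable lebesgue" "h \<in> square_integrable lebesgue" "AE x in lebesgue. g x = h x"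
  shows "conv p g = conv p h"
proof
  fix x
  show "conv p g x = conv p h x"
    unfolding conv_def
  proof (rule integral_cong_AE)
    show "AE y in lebesgue. p (x - y) * g y = p (x - y) * h y"
      using assms(3) by eventually_elim simp
  qed (use conv_integrable assms in \<open>auto intro: borel_measurable_integrable\<close>)
qed

lemma zero_square_integrable: "(\<lambda>x. 0) \<in> square_integrable M"
  by (simp add: square_integrable_def)

lemma conv_zero: "conv p (\<lambda>x. 0) = (\<lambda>x. 0)"
  by (simp add: conv_def fun_eq_iff)

lemma conv_inj:
  assumes g: "g \<in> square_integrable lebesgue" and h: "h \<in> square_integrable lebesgue"
    and eq: "conv p g = conv p h"
  shows "AE x in lebesgue. g x = h x"
proof -
  let ?d = "\<lambda>x. g x + (- 1) * h x"
  have d: "?d \<in> square_integrable lebesgue" by (rule square_integrable_lin[OF g h])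
  obtain d' where d': "d' \<in> square_integrable lborel" and dd: "AE x in lebesgue. ?d x = d' x"
    using square_integrable_lebesgue_borel_rep[OF d] by blast
  note [measurable] = square_integrableD(1)[OF d']
  have "conv p d' = (\<lambda>x. 0)"
    using conv_cong_AE[OF d square_integrable_lebesgueI[OF d'] dd] conv_lin[OF g h, of "- 1"] eq by simp
  moreover have "conv p d' x = (\<integral>y. p (x - y) * d' y \<partial>lborel)" for x
    unfolding conv_def by (rule integral_completion) measurable
  ultimately have "(\<integral>y. p (x - y) * d' y \<partial>lborel) = 0" for x
    by metis
  then have "AE x in lborel. d' x = 0"
    using square_integrableD[OF d'] by (intro convolution_injective) auto
  then have "AE x in lebesgue. d' x = 0" by (rule AE_completion)
  with dd show ?thesis by eventually_elim simp
qed

section \<open>The range of the convolution as a reproducing kernel Hilbert space\<close>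

definition range_conv :: "('a \<Rightarrow> real) set" where
  "range_conv = {conv p g | g. g \<in> square_integrable lebesgue}"

text \<open>A preimage is determined only up to null sets, hence the choice; \<open>range_ip\<close>
  does not depend on it.\<close>

definition preimage :: "('a \<Rightarrow> real) \<Rightarrow> 'a \<Rightarrow> real" where
  "preimage f = (SOME g. g \<in> square_integrable lebesgue \<and> conv p g = f)"

definition range_ip :: "('a \<Rightarrow> real) \<Rightarrow> ('a \<Rightarrow> real) \<Rightarrow> real" where
  "range_ip f h = (\<integral>x. preimage f x * preimage h x \<partial>lebesgue)"

lemma range_convE:
  assumes "f \<in> range_conv"
  obtains g where "g \<in> square_integrable lebesgue" "f = conv p g"
  using assms by (auto simp: range_conv_def)

text \<open>By \<open>conv_inj\<close> the chosen preimage of \<open>conv p g\<close> agrees with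
  \<open>g\<close> almost everywhere. This makes \<open>conv p\<close> an isometry onto its
  range.\<close>

lemma range_ip_conv:
  assumes g: "g \<in> square_integrable lebesgue" and h: "h \<in> square_integrable lebesgue"
  shows "range_ip (conv p g) (conv p h) = (\<integral>x. g x * h x \<partial>lebesgue)"
proof -
  have pre: "preimage (conv p g) \<in> square_integrable lebesgue \<and> conv p (preimage (conv p g)) = conv p g"
    if "g \<in> square_integrable lebesgue" for g
    unfolding preimage_def by (rule someI[of _ g]) (use that in simp)
  have ae: "AE x in lebesgue. preimage (conv p g) x = g x" if "g \<in> square_integrable lebesgue" for g
    using conv_inj[of "preimage (conv p g)" g] pre[OF that] that by simp
  show ?thesis
    unfolding range_ip_def
  proof (rule integral_cong_AE)
    show "AE x in lebesgue. preimage (conv p g) x * preimage (conv p h) x = g x * h x"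
      using ae[OF g] ae[OF h] by eventually_elim simp
  qed (use pre[OF g] pre[OF h] g h square_integrable_mult in \<open>blast intro: borel_measurable_integrable\<close>)+
qed

text \<open>Every axiom is transported from the square-integrable functions along
  \<open>conv p\<close>; completeness is \<open>square_integrable_complete\<close>, and definiteness
  holds as an equality of functions because \<open>conv p\<close> sends null functions to 0 at every
  point.\<close>

lemma hilbert_range_conv: "hilbert_fun_space range_conv range_ip"
  unfolding hilbert_fun_space_def
proof (intro conjI ballI allI impI)
  let ?S = "square_integrable lebesgue :: ('a \<Rightarrow> real) set"
  have scale: "conv p (\<lambda>x. c * g x) = (\<lambda>x. c * conv p g x)" "(\<lambda>x. c * g x) \<in> ?S" if "g \<in> ?S" for c g
    using conv_lin[OF zero_square_integrable that, of c] square_integrable_lin[OF zero_square_integrable that, of c]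
    by (simp_all add: conv_zero)
  have add: "conv p (\<lambda>x. g x + h x) = (\<lambda>x. conv p g x + conv p h x)" "(\<lambda>x. g x + h x) \<in> ?S"
    if "g \<in> ?S" "h \<in> ?S" for g h
    using conv_lin[OF that, of 1] square_integrable_lin[OF that, of 1] by simp_all
  have diff: "conv p (\<lambda>x. g x - h x) = (\<lambda>x. conv p g x - conv p h x)" "(\<lambda>x. g x - h x) \<in> ?S"
    if "g \<in> ?S" "h \<in> ?S" for g h
    using conv_lin[OF that, of "- 1"] square_integrable_lin[OF that, of "- 1"] by simp_all
  have mem: "conv p g \<in> range_conv" if "g \<in> ?S" for g
    using that by (auto simp: range_conv_def)
  show "(\<lambda>x. 0) \<in> range_conv"
    using mem[OF zero_square_integrable] by (simp only: conv_zero)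
  {
    fix f1 f2 assume "f1 \<in> range_conv" "f2 \<in> range_conv"
    then obtain g1 g2 where g: "g1 \<in> ?S" "g2 \<in> ?S" and f: "f1 = conv p g1" "f2 = conv p g2"
      by (auto elim!: range_convE)
    show "(\<lambda>x. f1 x + f2 x) \<in> range_conv"
      unfolding f add(1)[OF g, symmetric] by (rule mem[OF add(2)[OF g]])
    show "range_ip f1 f2 = range_ip f2 f1"
      by (simp add: f range_ip_conv g mult.commute)
    show "range_ip (\<lambda>x. c * f1 x) f2 = c * range_ip f1 f2" for c
      unfolding f scale(1)[OF g(1), symmetric] range_ip_conv[OF scale(2)[OF g(1)] g(2)] range_ip_conv[OF g]
      by (simp add: mult.assoc)
    fix f3 assume "f3 \<in> range_conv"
    then obtain g3 where g3: "g3 \<in> ?S" and f3: "f3 = conv p g3"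
      by (auto elim!: range_convE)
    show "range_ip (\<lambda>x. f1 x + f2 x) f3 = range_ip f1 f3 + range_ip f2 f3"
      unfolding f f3 add(1)[OF g, symmetric] range_ip_conv[OF add(2)[OF g] g3] range_ip_conv[OF g(1) g3] range_ip_conv[OF g(2) g3]
      using square_integrable_mult[OF g(1) g3] square_integrable_mult[OF g(2) g3]
      by (simp add: distrib_right)
  }
  {
    fix f assume "f \<in> range_conv"
    then obtain g where g: "g \<in> ?S" and f: "f = conv p g"
      by (rule range_convE)
    show "(\<lambda>x. c * f x) \<in> range_conv" for c
      unfolding f scale(1)[OF g, symmetric] by (rule mem[OF scale(2)[OF g]])
    show "0 \<le> range_ip f f"
      unfolding f range_ip_conv[OF g g] by (rule Bochner_Integration.integral_nonneg) simp
    assume "range_ip f f = 0"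
    then have "(\<integral>x. (g x)\<^sup>2 \<partial>lebesgue) = 0"
      unfolding f range_ip_conv[OF g g] by (simp add: power2_eq_square)
    then have "AE x in lebesgue. (g x)\<^sup>2 = 0"
      using square_integrableD(2)[OF g] by (subst (asm) integral_nonneg_eq_0_iff_AE) auto
    then have "AE x in lebesgue. g x = 0" by eventually_elim simp
    then show "f = (\<lambda>x. 0)"
      using conv_cong_AE[OF g zero_square_integrable] f by (simp only: conv_zero)
  }
  fix s :: "nat \<Rightarrow> 'a \<Rightarrow> real"
  assume "\<forall>n. s n \<in> range_conv"
    and C: "\<forall>e>0. \<exists>N. \<forall>m\<ge>N. \<forall>n\<ge>N. sqrt (range_ip (\<lambda>x. s m x - s n x) (\<lambda>x. s m x - s n x)) < e"
  then have "\<forall>n. \<exists>g. g \<in> ?S \<and> s n = conv p g"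
    by (auto simp: range_conv_def)
  then obtain g where g: "\<And>n. g n \<in> ?S" and s: "\<And>n. s n = conv p (g n)"
    by metis
  have ip: "range_ip (\<lambda>x. conv p u x - conv p v x) (\<lambda>x. conv p u x - conv p v x) = (\<integral>x. (u x - v x)\<^sup>2 \<partial>lebesgue)"
    if "u \<in> ?S" "v \<in> ?S" for u v
    unfolding diff(1)[OF that, symmetric] range_ip_conv[OF diff(2)[OF that] diff(2)[OF that]]
    by (simp add: power2_eq_square)
  have "\<exists>N. \<forall>m\<ge>N. \<forall>n\<ge>N. (\<integral>x. (g m x - g n x)\<^sup>2 \<partial>lebesgue) < e" if "0 < e" for e
  proof -
    from that have "0 < sqrt e" by simp
    with C obtain N where "\<forall>m\<ge>N. \<forall>n\<ge>N. sqrt (range_ip (\<lambda>x. s m x - s n x) (\<lambda>x. s m x - s n x)) < sqrt e"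
      by blast
    then show ?thesis unfolding s ip[OF g g] real_sqrt_less_iff by blast
  qed
  from square_integrable_complete[of g, OF g this]
  obtain f where f: "f \<in> ?S" and lim: "(\<lambda>n. \<integral>x. (g n x - f x)\<^sup>2 \<partial>lebesgue) \<longlonglongrightarrow> 0"
    by blast
  have "(\<lambda>n. sqrt (range_ip (\<lambda>x. s n x - conv p f x) (\<lambda>x. s n x - conv p f x))) \<longlonglongrightarrow> 0"
    unfolding s ip[OF g f] using tendsto_real_sqrt[OF lim] by simp
  then show "\<exists>f\<in>range_conv. (\<lambda>n. sqrt (range_ip (\<lambda>x. s n x - f x) (\<lambda>x. s n x - f x))) \<longlonglongrightarrow> 0"
    using mem[OF f] by blast
qed

text \<open>As \<open>p\<close> is even, \<open>conv p g y\<close> is the inner product of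
  \<open>g\<close> with the translate of \<open>p\<close> to \<open>y\<close>; the image of this
  translate under the isometry therefore represents evaluation at \<open>y\<close>.\<close>

lemma rkhs_range_conv: "rkhs range_conv range_ip (\<lambda>y. conv p (\<lambda>z. p (z - y)))"
proof -
  have S: "(\<lambda>z. p (z - y)) \<in> square_integrable lebesgue" for y
    using translate_square_integrable[of y] by (simp add: p_minus[of y])
  show ?thesis
  proof (intro rkhs.intro rkhs_axioms.intro)
    show "hilbert_functions range_conv range_ip"
      by (rule hilbert_functions.intro[OF hilbert_range_conv])
    show "conv p (\<lambda>z. p (z - y)) \<in> range_conv" for y
      using S by (auto simp: range_conv_def)
    fix f y assume "f \<in> range_conv"
    then obtain g where g: "g \<in> square_integrable lebesgue" and f: "f = conv p g"
      by (rule range_convE)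
    show "range_ip f (conv p (\<lambda>z. p (z - y))) = f y"
      unfolding f range_ip_conv[OF g S] by (simp add: conv_def p_minus[of _ y] mult.commute)
  qed
qed

end

section \<open>The kernel of the Wu function\<close>

lemma square_radial_kernel_wu_P:
  assumes l: "real k \<le> l"
  shows "square_radial_kernel (wu_P l k :: 'a::euclidean_space \<Rightarrow> real)"
proof
  define m where "m = l - real k"
  have m: "0 \<le> m" using l by (simp add: m_def)
  have P: "wu_P l k = (\<lambda>x::'a. wu_const l k * trunc_pow m (norm x))"
    by (simp add: wu_P_eq m_def fun_eq_iff)
  show i: "integrable lborel (wu_P l k :: 'a \<Rightarrow> real)"
    unfolding P by (intro integrable_mult_right integrable_trunc_pow m)
  show "norm x = norm y \<Longrightarrow> wu_P l k x = wu_P l k y" for x y :: 'a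
    by (simp add: P)
  show "1 < norm x \<Longrightarrow> wu_P l k x = 0" for x :: 'a
    by (simp add: P trunc_pow_eq_0)
  have nonneg: "0 \<le> wu_P l k x" for x :: 'a
    using wu_const_pos[OF l] by (simp add: P)
  show "integral\<^sup>L lborel (wu_P l k :: 'a \<Rightarrow> real) \<noteq> 0"
  proof
    assume "integral\<^sup>L lborel (wu_P l k :: 'a \<Rightarrow> real) = 0"
    then have "AE x in lborel. wu_P l k (x::'a) = 0"
      using i nonneg by (subst (asm) integral_nonneg_eq_0_iff_AE) auto
    then have "AE x in lborel. x \<notin> ball (0::'a) 1"
    proof eventually_elim
      case (elim x)
      show ?case
      proof
        assume "x \<in> ball 0 1"
        then have "(norm x)\<^sup>2 < 1" by (simp add: power_less_one_iff abs_square_less_1)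
        then have "0 < trunc_pow m (norm x)" by (simp add: trunc_pow_def)
        then show False using elim wu_const_pos[OF l] by (simp add: P)
      qed
    qed
    moreover have "{x \<in> space lborel. \<not> x \<notin> ball (0::'a) 1} = ball 0 1"
      by auto
    ultimately have "emeasure lborel (ball (0::'a) 1) = 0"
      using AE_iff_measurable[of "ball (0::'a) 1" lborel "\<lambda>x. x \<notin> ball 0 1"] by simp
    then show False
      using unit_ball_vol_pos[of "real DIM('a)"] by (auto simp: emeasure_ball simp del: unit_ball_vol_pos)
  qed
  show "integrable lborel (\<lambda>x::'a. (wu_P l k x)\<^sup>2)"
  proof (rule Bochner_Integration.integrable_bound)
    show "integrable lborel (\<lambda>x::'a. (wu_const l k)\<^sup>2 * trunc_pow m (norm x))"
      by (intro integrable_mult_right integrable_trunc_pow m)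
    show "(\<lambda>x::'a. (wu_P l k x)\<^sup>2) \<in> borel_measurable lborel"
      using borel_measurable_integrable[OF i] by measurable
    show "AE x in lborel. norm ((wu_P l k (x::'a))\<^sup>2) \<le> norm ((wu_const l k)\<^sup>2 * trunc_pow m (norm x))"
    proof (rule AE_I2)
      fix x :: 'a
      have "(trunc_pow m (norm x))\<^sup>2 \<le> trunc_pow m (norm x)"
        using trunc_pow_le_1[OF m, of "norm x"] by (simp add: power2_eq_square mult_left_le)
      then show "norm ((wu_P l k x)\<^sup>2) \<le> norm ((wu_const l k)\<^sup>2 * trunc_pow m (norm x))"
        by (simp add: P power_mult_distrib mult_left_mono)
    qed
  qed
qed

lemma wu_fun_eq_conv:
  fixes x y :: "'a::euclidean_space"
  assumes "real k \<le> l" and "DIM('a) = 2 * k + 1"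
  shows "wu_fun l k (norm (x - y)) = conv (wu_P l k) (\<lambda>z. wu_P l k (z - y)) x"
proof -
  have [measurable]: "(wu_P l k :: 'a \<Rightarrow> real) \<in> borel_measurable borel"
    unfolding wu_P_eq[abs_def] by measurable
  have "conv (wu_P l k) (\<lambda>z. wu_P l k (z - y)) x = (\<integral>z. wu_P l k (x - z) * wu_P l k (z - y) \<partial>lborel)"
    unfolding conv_def by (rule integral_completion) measurable
  also have "\<dots> = (\<integral>z. wu_P l k (x - (y + z)) * wu_P l k ((y + z) - y) \<partial>lborel)"
    by (rule integral_lborel_shift[symmetric, where f="\<lambda>z. wu_P l k (x - z) * wu_P l k (z - y)"]) measurable
  also have "\<dots> = (\<integral>z. (wu_const l k)\<^sup>2 * (trunc_pow (l - real k) (norm ((x - y) - z)) * trunc_pow (l - real k) (norm z)) \<partial>lborel)"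
    by (simp add: wu_P_eq power2_eq_square algebra_simps)
  also have "\<dots> = (wu_const l k)\<^sup>2 * tconv (l - real k) (x - y)"
    by (simp add: tconv_def)
  also have "\<dots> = wu_fun l k (norm (x - y))"
    by (rule wu_fun_eq_tconv[OF assms, symmetric])
  finally show ?thesis ..
qed

text \<open>The native space is given by a predicate, so its existence is asserted beside the claims
  about every \<open>H\<close> and \<open>ip\<close> that satisfy it. Elements of \<open>L2\<close>
  are functions and not classes, hence injectivity up to null sets; surjectivity of the operator is
  the set equality.\<close>

theorem theorem3p10:
  fixes k :: nat and l :: real
  assumes "real k \<le> l"
    and "DIM('a::euclidean_space) = 2 * k + 1"
  shows "(\<exists>H ip. native_space (\<lambda>x::'a. wu_fun l k (norm x)) H ip) \<and>
    (\<forall>H ip. native_space (\<lambda>x::'a. wu_fun l k (norm x)) H ip \<longrightarrow>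
       H = {conv (wu_P l k) g | g. g \<in> (L2 :: ('a \<Rightarrow> real) set)} \<and>
       (\<forall>g\<in>(L2 :: ('a \<Rightarrow> real) set).
          sqrt (ip (conv (wu_P l k) g) (conv (wu_P l k) g)) = L2_norm g) \<and>
       (\<forall>g\<in>(L2 :: ('a \<Rightarrow> real) set). \<forall>h\<in>L2.
          conv (wu_P l k) g = conv (wu_P l k) h \<longrightarrow> (AE x in lebesgue. g x = h x)))"
proof -
  interpret P: square_radial_kernel "wu_P l k :: 'a \<Rightarrow> real"
    by (rule square_radial_kernel_wu_P[OF assms(1)])
  have kernel: "(\<lambda>y x. wu_fun l k (norm (x - y))) = (\<lambda>y::'a. conv (wu_P l k) (\<lambda>z. wu_P l k (z - y)))"
    by (simp add: fun_eq_iff wu_fun_eq_conv[OF assms])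
  note native = native_space_iff_rkhs[of "\<lambda>x::'a. wu_fun l k (norm x)", unfolded kernel]
  have range: "P.range_conv = {conv (wu_P l k) g | g. g \<in> L2}"
    by (simp add: P.range_conv_def L2_eq_square_integrable)
  show ?thesis
  proof (intro conjI allI impI ballI)
    show "\<exists>H ip. native_space (\<lambda>x::'a. wu_fun l k (norm x)) H ip"
      using P.rkhs_range_conv native by blast
    show "AE x in lebesgue. g x = h x"
      if "g \<in> L2" "h \<in> L2" "conv (wu_P l k) g = conv (wu_P l k) h" for g h :: "'a \<Rightarrow> real"
      using P.conv_inj that by (simp add: L2_eq_square_integrable)
    fix H :: "('a \<Rightarrow> real) set" and ip
    assume "native_space (\<lambda>x::'a. wu_fun l k (norm x)) H ip"
    then have R: "rkhs H ip (\<lambda>y. conv (wu_P l k) (\<lambda>z. wu_P l k (z - y)))"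
      by (simp only: native)
    \<comment> \<open>The two directions give both inclusions, and each of them also the agreement
      of the norms.\<close>
    note sub = rkhs_subset[OF R P.rkhs_range_conv] rkhs_subset[OF P.rkhs_range_conv R]
    show "H = {conv (wu_P l k) g | g. g \<in> (L2 :: ('a \<Rightarrow> real) set)}"
      unfolding range[symmetric] using sub by blast
    fix g :: "'a \<Rightarrow> real" assume g: "g \<in> L2"
    then have "conv (wu_P l k) g \<in> P.range_conv"
      unfolding range by blast
    from sub(2)[OF this]
    have "ip (conv (wu_P l k) g) (conv (wu_P l k) g) = P.range_ip (conv (wu_P l k) g) (conv (wu_P l k) g)"
      by simp
    also have "\<dots> = (\<integral>x. g x * g x \<partial>lebesgue)"
      using g by (intro P.range_ip_conv) (simp_all add: L2_eq_square_integrable)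
    finally show "sqrt (ip (conv (wu_P l k) g) (conv (wu_P l k) g)) = L2_norm g"
      by (simp add: L2_norm_def power2_eq_square)
  qed
qed

end
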